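(* Let $n\ge 2$ and let $X\subseteq\mathbb P^1\times\mathbb P^n$ be a finite set of points without the inclusion property with respect to $\pi_1$, such that the points in $\pi_1(A_X)$ and in $B_Y=\pi_1(B_X)$ are generic in $\mathbb P^n$. Let $Y_1,\dots,Y_t$ be the images under $\pi_1$ of the level sets of $X$, and assume moreover that $Y_i\cap Y_j\subseteq B_Y$ for all $i\ne j$. Then $X$ is arithmetically Cohen-Macaulay if and only if $N_1(X)\in\mathcal D(X)$.
   Context: We work over a field $k$ of characteristic zero. Let $R=k[x_0,x_1,y_0,\dots,y_n]$ be the coordinate ring of $\mathbb P^1\times\mathbb P^n$, with $\deg x_i=(1,0)$, $\deg y_j=(0,1)$. For a finite set of points $X$, $I_X\subset R$ is the ideal generated by all bihomogeneous polynomials vanishing on $X$, and $X$ is arithmetically Cohen-Macaulay if $R/I_X$ is a Cohen-Macaulay ring. Let $\eta_1:\mathbb P^1\times\mathbb P^n\to\mathbb P^1$ and $\pi_1:\mathbb P^1\times\mathbb P^n\to\mathbb P^n$ be the two projections. Write $\eta_1(X)=\{P_1,\dots,P_t\}$, let $X_i=\eta_1^{-1}(P_i)\cap X$ (the level sets) and $Y_i=\pi_1(X_i)\subset\mathbb P^n$. $X$ has the inclusion property with respect to $\pi_1$ if $Y_1,\dots,Y_t$ are totally ordered by inclusion (the additional requirement in the general definition that each $Y_i$ be arithmetically Cohen-Macaulay is automatic for finite sets in $\mathbb P^n$). Write $X=A_X\cup B_X$ as a disjoint union, where a point $P\times Q\in X$ belongs to $B_X$ if and only if $Q\in\bigcap_{i=1}^tY_i$.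 Put $B_Y=\pi_1(B_X)$, $N_0(X)=\#\pi_1(A_X)$, $N_1(X)=\#\pi_1(B_X)$, and $$\mathcal D(X)=\bigcup_{i\in\mathbb Z}\left\{\binom{N_0(X)+i}{n},\ \binom{N_0(X)+i}{n}+1,\ \ldots,\ \binom{N_0(X)+i+1}{n}-N_0(X)\right\},$$ where $\binom mn=0$ for $m<n$, and each set in the union is the set of integers from its first to its last displayed element (empty if the first exceeds the last). Genericity of the points of $\pi_1(A_X)$ and $\pi_1(B_X)$ has its usual meaning: the $N_0(X)+N_1(X)$ distinct points of $\pi_1(A_X)\cup\pi_1(B_X)$, viewed as an element of $(\mathbb P^n)^{N_0(X)+N_1(X)}$, lie in a suitable nonempty Zariski-open subset (the remaining data, i.e. the points of $\eta_1(X)$ and the incidence pattern, being fixed). *)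

theory Defs
  imports "HOL-Library.Poly_Mapping" "HOL-Library.Extended_Nat" "HOL-Algebra.QuotRing" "HOL-Algebra.Ring_Divisibility"
begin

section \<open>Cohen-Macaulay rings\<close>

text \<open>Fractions \<open>a / s\<close> are represented by pairs \<open>(a, s)\<close>.\<close>

definition frac_rel :: "('a, 'b) ring_scheme \<Rightarrow> 'a set \<Rightarrow> (('a \<times> 'a) \<times> ('a \<times> 'a)) set" where
  "frac_rel R S = {((a, s), (b, t)).
     a \<in> carrier R \<and> s \<in> S \<and> b \<in> carrier R \<and> t \<in> S \<and>
     (\<exists>u\<in>S. u \<otimes>\<^bsub>R\<^esub> (t \<otimes>\<^bsub>R\<^esub> a) = u \<otimes>\<^bsub>R\<^esub> (s \<otimes>\<^bsub>R\<^esub> b))}"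

definition ring_of_fractions :: "('a, 'b) ring_scheme \<Rightarrow> 'a set \<Rightarrow> ('a \<times> 'a) set ring" where
  "ring_of_fractions R S =
     \<lparr>carrier = (carrier R \<times> S) // frac_rel R S,
      mult = (\<lambda>F G. \<Union>(a, s)\<in>F. \<Union>(b, t)\<in>G. frac_rel R S `` {(a \<otimes>\<^bsub>R\<^esub> b, s \<otimes>\<^bsub>R\<^esub> t)}),
      one = frac_rel R S `` {(\<one>\<^bsub>R\<^esub>, \<one>\<^bsub>R\<^esub>)},
      zero = frac_rel R S `` {(\<zero>\<^bsub>R\<^esub>, \<one>\<^bsub>R\<^esub>)},
      add = (\<lambda>F G. \<Union>(a, s)\<in>F. \<Union>(b, t)\<in>G.
               frac_rel R S `` {((t \<otimes>\<^bsub>R\<^esub> a) \<oplus>\<^bsub>R\<^esub> (s \<otimes>\<^bsub>R\<^esub> b), s \<otimes>\<^bsub>R\<^esub> t)})\<rparr>"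

definition localization_at :: "('a, 'b) ring_scheme \<Rightarrow> 'a set \<Rightarrow> ('a \<times> 'a) set ring" where
  "localization_at R p = ring_of_fractions R (carrier R - p)"

definition krull_dim :: "('a, 'b) ring_scheme \<Rightarrow> enat" where
  "krull_dim R = Sup {enat d | d. \<exists>C :: nat \<Rightarrow> 'a set.
     (\<forall>i\<le>d. primeideal (C i) R) \<and> (\<forall>i<d. C i \<subset> C (Suc i))}"

text \<open>
  The second clause says that \<open>xs ! i\<close> is a non-zero-divisor on the quotient of \<open>R\<close> by the
  ideal generated by \<open>xs ! 0, \<dots>, xs ! (i - 1)\<close>.
\<close>

definition regular_sequence :: "('a, 'b) ring_scheme \<Rightarrow> 'a list \<Rightarrow> bool" where
  "regular_sequence R xs \<longleftrightarrow>
     set xs \<subseteq> carrier R \<and>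
     (\<forall>i<length xs. \<forall>a\<in>carrier R.
        xs ! i \<otimes>\<^bsub>R\<^esub> a \<in> Idl\<^bsub>R\<^esub> (set (take i xs)) \<longrightarrow> a \<in> Idl\<^bsub>R\<^esub> (set (take i xs))) \<and>
     Idl\<^bsub>R\<^esub> (set xs) \<noteq> carrier R"

definition depth :: "('a, 'b) ring_scheme \<Rightarrow> 'a set \<Rightarrow> enat" where
  "depth R I = Sup {enat (length xs) | xs. set xs \<subseteq> I \<and> regular_sequence R xs}"

definition cohen_macaulay_local :: "('a, 'b) ring_scheme \<Rightarrow> bool" where
  "cohen_macaulay_local R \<longleftrightarrow> cring R \<and> noetherian_ring R \<and>
     (\<exists>m. {I. maximalideal I R} = {m} \<and> depth R m = krull_dim R)"

definition cohen_macaulay :: "('a, 'b) ring_scheme \<Rightarrow> bool" where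
  "cohen_macaulay R \<longleftrightarrow> cring R \<and> noetherian_ring R \<and>
     (\<forall>m. maximalideal m R \<longrightarrow> cohen_macaulay_local (localization_at R m))"


section \<open>Polynomials and projective space\<close>

type_synonym ('v, 'k) mpoly = "('v \<Rightarrow>\<^sub>0 nat) \<Rightarrow>\<^sub>0 'k"

definition vars :: "('v, 'k::zero) mpoly \<Rightarrow> 'v set" where
  "vars f = (\<Union>m\<in>Poly_Mapping.keys f. Poly_Mapping.keys m)"

definition eval_poly :: "('v \<Rightarrow> 'k) \<Rightarrow> ('v, 'k::comm_semiring_1) mpoly \<Rightarrow> 'k" where
  "eval_poly v f = (\<Sum>m\<in>Poly_Mapping.keys f.
     Poly_Mapping.lookup f m * (\<Prod>x\<in>Poly_Mapping.keys m. v x ^ Poly_Mapping.lookup m x))"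

text \<open>
  Homogeneous coordinate vectors \<open>(v\<^sub>0, \<dots>, v\<^sub>n)\<close> are functions on \<open>nat\<close> that vanish beyond \<open>n\<close>;
  a point of projective space is the set of all its coordinate vectors.
\<close>

type_synonym 'k proj_point = "(nat \<Rightarrow> 'k) set"

definition coord_vectors :: "nat \<Rightarrow> (nat \<Rightarrow> 'k::field) set" where
  "coord_vectors n = {v. (\<forall>i>n. v i = 0) \<and> (\<exists>i. v i \<noteq> 0)}"

definition proportional :: "((nat \<Rightarrow> 'k::field) \<times> (nat \<Rightarrow> 'k)) set" where
  "proportional = {(v, w). \<exists>c. c \<noteq> 0 \<and> w = (\<lambda>i. c * v i)}"

definition proj_space :: "nat \<Rightarrow> 'k::field proj_point set" where
  "proj_space n = coord_vectors n // proportional"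


section \<open>The coordinate ring of \<open>\<P>\<^sup>1 \<times> \<P>\<^sup>n\<close>\<close>

text \<open>The variable \<open>x\<^sub>i\<close> is \<open>Inl i\<close> and the variable \<open>y\<^sub>j\<close> is \<open>Inr j\<close>.\<close>

definition coord_ring :: "nat \<Rightarrow> (nat + nat, 'k::field) mpoly ring" where
  "coord_ring n = \<lparr>carrier = {f. vars f \<subseteq> Inl ` {..1} \<union> Inr ` {..n}},
     mult = (*), one = 1, zero = 0, add = (+)\<rparr>"

definition bihomogeneous :: "nat \<Rightarrow> (nat + nat, 'k::field) mpoly \<Rightarrow> bool" where
  "bihomogeneous n f \<longleftrightarrow> (\<exists>d e. \<forall>m\<in>Poly_Mapping.keys f.
     (\<Sum>i\<le>1. Poly_Mapping.lookup m (Inl i)) = d \<and> (\<Sum>j\<le>n. Poly_Mapping.lookup m (Inr j)) = e)"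

definition vanishes_on ::
  "(nat + nat, 'k::field) mpoly \<Rightarrow> ('k proj_point \<times> 'k proj_point) set \<Rightarrow> bool" where
  "vanishes_on f X \<longleftrightarrow> (\<forall>(P, Q)\<in>X. \<forall>a\<in>P. \<forall>b\<in>Q. eval_poly (case_sum a b) f = 0)"

definition vanishing_ideal ::
  "nat \<Rightarrow> ('k::field proj_point \<times> 'k proj_point) set \<Rightarrow> (nat + nat, 'k) mpoly set" where
  "vanishing_ideal n X =
     Idl\<^bsub>coord_ring n\<^esub> {f \<in> carrier (coord_ring n). bihomogeneous n f \<and> vanishes_on f X}"

definition arithmetically_cohen_macaulay ::
  "nat \<Rightarrow> ('k::field proj_point \<times> 'k proj_point) set \<Rightarrow> bool" where
  "arithmetically_cohen_macaulay n X \<longleftrightarrow>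
     cohen_macaulay (coord_ring n Quot vanishing_ideal n X)"


section \<open>Level sets and numerical data of a set of points\<close>

text \<open>
  The level sets are indexed by the points of the first projection \<open>fst ` X\<close>;
  \<open>level_image X P\<close> is the image in the second factor of the level set over \<open>P\<close>.
\<close>

definition level_set :: "('a \<times> 'b) set \<Rightarrow> 'a \<Rightarrow> ('a \<times> 'b) set" where
  "level_set X P = {z \<in> X. fst z = P}"

definition level_image :: "('a \<times> 'b) set \<Rightarrow> 'a \<Rightarrow> 'b set" where
  "level_image X P = snd ` level_set X P"

definition inclusion_property :: "('a \<times> 'b) set \<Rightarrow> bool" where
  "inclusion_property X \<longleftrightarrow> (\<forall>P\<in>fst ` X. \<forall>P'\<in>fst ` X.
     level_image X P \<subseteq> level_image X P' \<or> level_image X P' \<subseteq> level_image X P)"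

definition B_part :: "('a \<times> 'b) set \<Rightarrow> ('a \<times> 'b) set" where
  "B_part X = {z \<in> X. snd z \<in> (\<Inter>P\<in>fst ` X. level_image X P)}"

definition A_part :: "('a \<times> 'b) set \<Rightarrow> ('a \<times> 'b) set" where
  "A_part X = X - B_part X"

definition N0 :: "('a \<times> 'b) set \<Rightarrow> nat" where
  "N0 X = card (snd ` A_part X)"

definition N1 :: "('a \<times> 'b) set \<Rightarrow> nat" where
  "N1 X = card (snd ` B_part X)"

definition int_binom :: "int \<Rightarrow> nat \<Rightarrow> int" where
  "int_binom m n = (if m < int n then 0 else int (nat m choose n))"

definition D_set :: "nat \<Rightarrow> ('a \<times> 'b) set \<Rightarrow> int set" where
  "D_set n X = (\<Union>i::int. {int_binom (int (N0 X) + i) n ..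
                            int_binom (int (N0 X) + i + 1) n - int (N0 X)})"


section \<open>Generic tuples of points\<close>

text \<open>
  A point of \<open>(\<P>\<^sup>n)\<^sup>N\<close> is an extensional function on \<open>{..<N}\<close>. The variable \<open>(j, i)\<close> is the
  \<open>i\<close>-th homogeneous coordinate on the \<open>j\<close>-th factor.
\<close>

definition proj_power :: "nat \<Rightarrow> nat \<Rightarrow> (nat \<Rightarrow> 'k::field proj_point) set" where
  "proj_power n N = {..<N} \<rightarrow>\<^sub>E proj_space n"

definition multihomogeneous :: "nat \<Rightarrow> nat \<Rightarrow> (nat \<times> nat, 'k::field) mpoly \<Rightarrow> bool" where
  "multihomogeneous n N f \<longleftrightarrow> vars f \<subseteq> {..<N} \<times> {..n} \<and>
     (\<exists>d. \<forall>m\<in>Poly_Mapping.keys f. \<forall>j<N. (\<Sum>i\<le>n. Poly_Mapping.lookup m (j, i)) = d j)"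

definition zero_locus ::
  "nat \<Rightarrow> nat \<Rightarrow> (nat \<times> nat, 'k::field) mpoly set \<Rightarrow> (nat \<Rightarrow> 'k proj_point) set" where
  "zero_locus n N F = {Q \<in> proj_power n N.
     \<forall>f\<in>F. \<forall>v. (\<forall>j<N. v j \<in> Q j) \<longrightarrow> eval_poly (\<lambda>(j, i). v j i) f = 0}"

definition zariski_open :: "nat \<Rightarrow> nat \<Rightarrow> (nat \<Rightarrow> 'k::field proj_point) set \<Rightarrow> bool" where
  "zariski_open n N U \<longleftrightarrow>
     (\<exists>F. (\<forall>f\<in>F. multihomogeneous n N f) \<and> U = proj_power n N - zero_locus n N F)"

definition holds_generically ::
  "nat \<Rightarrow> nat \<Rightarrow> ((nat \<Rightarrow> 'k::field proj_point) \<Rightarrow> bool) \<Rightarrow> bool" where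
  "holds_generically n N \<Phi> \<longleftrightarrow>
     (\<exists>U. zariski_open n N U \<and> U \<noteq> {} \<and> (\<forall>Q\<in>U. inj_on Q {..<N} \<longrightarrow> \<Phi> Q))"

text \<open>
  The set of points \<open>P\<^sub>i \<times> Q\<^sub>j\<close> with \<open>(i, j)\<close> in the incidence pattern \<open>E\<close>.
\<close>

definition point_configuration ::
  "(nat \<times> nat) set \<Rightarrow> (nat \<Rightarrow> 'a) \<Rightarrow> (nat \<Rightarrow> 'b) \<Rightarrow> ('a \<times> 'b) set" where
  "point_configuration E P Q = (\<lambda>(i, j). (P i, Q j)) ` E"

end

theory Submission
  imports Defs "HOL-Library.Function_Algebras" "HOL-Computational_Algebra.Polynomial"
    "Jordan_Normal_Form.Determinant"
begin

text \<open>
  Choose linear forms in the \<open>x\<^sub>i\<close> and in the \<open>y\<^sub>j\<close> that vanish at none of the points and normalize all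
  coordinate vectors accordingly. Evaluation at the points identifies \<open>R / I\<^sub>X\<close> with the ring of sums
  \<open>\<Sum> \<phi>\<^sub>i\<^sub>j s\<^sup>i u\<^sup>j\<close>, where \<open>\<phi>\<^sub>i\<^sub>j\<close> lies in the space \<open>V i j\<close> of functions on \<open>X\<close> given by forms of bidegree
  \<open>(i, j)\<close>, and the two linear forms become \<open>s\<close> and \<open>u\<close>. The ring is Cohen-Macaulay if and only if
  \<open>s, u\<close> is a regular sequence, that is, \<open>V (i + 1) j \<inter> V i (j + 1) \<subseteq> V i j\<close> for all \<open>i, j\<close>.

  If the number of monomials of degree \<open>d\<close> is at least the number of all points in the second factor, then
  forms of degree \<open>d\<close> give all functions there. If it is at most \<open>N\<^sub>1\<close>, then a form of degree \<open>d\<close> is determined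
  by its values on the points common to all level sets, where the powers of the coordinate of the first factor
  are linearly independent. In both cases the inclusion holds. If the number lies strictly between, then the
  product of the coordinate of the first factor with a suitable form of degree \<open>d\<close> violates it.
\<close>

section \<open>Rings of fractions\<close>

text \<open>The definition asks for the Cohen-Macaulay property at every maximal ideal, graded or
  not, over a field that need not be algebraically closed. Failure is visible at the ideal of
  elements without constant term, but the positive direction needs a regular sequence at each
  maximal ideal. It comes from an embedding: the ring contains k[s,u] as the constant functions on
  the points and lies in the free k[s,u]-module of all functions on the points. The same embedding
  gives the Noetherian property and bounds the dimension by two; since depth never exceeds
  dimension, two regular elements suffice.

  The link with \<open>D_set\<close> is that its binomial coefficients count monomials: N_1 belongs
  to it exactly when no number of monomials of one degree lies strictly between N_1 and N_0 + N_1,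
  the number of all points in the second factor. Genericity amounts to finitely many nonvanishing
  determinants, because from degree N_0 + N_1 on the forms give all functions on the points; so one
  multihomogeneous polynomial cuts out the excluded locus.\<close>

locale fractions = cring R for R (structure) +
  fixes S :: "'a set"
  assumes S_subset: "S \<subseteq> carrier R"
    and S_one: "\<one> \<in> S"
    and S_mult: "\<lbrakk>s \<in> S; t \<in> S\<rbrakk> \<Longrightarrow> s \<otimes> t \<in> S"
begin

definition fr :: "'a \<Rightarrow> 'a \<Rightarrow> ('a \<times> 'a) set" where
  "fr a s = frac_rel R S `` {(a, s)}"

abbreviation Q where "Q \<equiv> ring_of_fractions R S"

lemma S_carrier [simp]: "s \<in> S \<Longrightarrow> s \<in> carrier R"
  using S_subset by blast

declare S_one [simp] S_mult [simp]

text \<open>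
  Declared anew, these rules are tried before \<open>S_carrier\<close>; otherwise the simplifier needs time
  exponential in the size of a product to show that it lies in the carrier.
\<close>

declare m_closed [simp del] a_closed [simp del]
declare m_closed [simp] a_closed [simp]

lemma equiv_frac_rel: "equiv (carrier R \<times> S) (frac_rel R S)"
proof (rule equivI)
  show "frac_rel R S \<subseteq> (carrier R \<times> S) \<times> carrier R \<times> S"
    by (auto simp: frac_rel_def)
  show "refl_on (carrier R \<times> S) (frac_rel R S)"
    unfolding refl_on_def frac_rel_def using S_one by auto
  show "sym (frac_rel R S)"
    unfolding sym_def frac_rel_def by (auto, metis)
  show "trans (frac_rel R S)"
  proof (rule transI, clarsimp simp: frac_rel_def)
    fix a s b t c r u v
    assume *: "a \<in> carrier R" "s \<in> S" "b \<in> carrier R" "t \<in> S" "c \<in> carrier R" "r \<in> S" "u \<in> S" "v \<in> S"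
      and 1: "u \<otimes> (t \<otimes> a) = u \<otimes> (s \<otimes> b)" and 2: "v \<otimes> (r \<otimes> b) = v \<otimes> (t \<otimes> c)"
    \<comment> \<open>The middle denominator \<open>t\<close> has to join the witness: only after
      multiplying by it can the two relations be composed.\<close>
    have "(u \<otimes> v \<otimes> t) \<otimes> (r \<otimes> a) = (v \<otimes> r) \<otimes> (u \<otimes> (t \<otimes> a))"
      using * by (simp add: m_ac)
    also have "\<dots> = (u \<otimes> s) \<otimes> (v \<otimes> (r \<otimes> b))"
      unfolding 1 using * by (simp add: m_ac)
    also have "\<dots> = (u \<otimes> v \<otimes> t) \<otimes> (s \<otimes> c)"
      unfolding 2 using * by (simp add: m_ac)
    finally show "\<exists>w\<in>S. w \<otimes> (r \<otimes> a) = w \<otimes> (s \<otimes> c)"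
      using * by (intro bexI[of _ "u \<otimes> v \<otimes> t"]) auto
  qed
qed

lemma fr_eq_iff:
  assumes "a \<in> carrier R" "s \<in> S" "b \<in> carrier R" "t \<in> S"
  shows "fr a s = fr b t \<longleftrightarrow> (\<exists>u\<in>S. u \<otimes> (t \<otimes> a) = u \<otimes> (s \<otimes> b))"
  unfolding fr_def using assms eq_equiv_class_iff[OF equiv_frac_rel, of "(a,s)" "(b,t)"]
  by (auto simp: frac_rel_def)

lemma fr_eqI:
  assumes "a \<in> carrier R" "s \<in> S" "b \<in> carrier R" "t \<in> S" "t \<otimes> a = s \<otimes> b"
  shows "fr a s = fr b t"
  using assms fr_eq_iff S_one by force

lemma carrier_Q: "carrier Q = {fr a s | a s. a \<in> carrier R \<and> s \<in> S}"
  by (auto simp: ring_of_fractions_def quotient_def fr_def)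

lemma fr_carrier [simp]: "\<lbrakk>a \<in> carrier R; s \<in> S\<rbrakk> \<Longrightarrow> fr a s \<in> carrier Q"
  using carrier_Q by blast

lemma frE:
  assumes "F \<in> carrier Q"
  obtains a s where "F = fr a s" "a \<in> carrier R" "s \<in> S"
  using assms carrier_Q by blast

text \<open>The product in \<open>ring_of_fractions\<close> is a double union over representatives.
  Congruence in the first factor collapses the outer union, congruence in the second the inner one;
  the witness \<open>u\<close> of the old relation serves for the new one.\<close>

lemma mult_fr [simp]:
  assumes "a \<in> carrier R" "s \<in> S" "b \<in> carrier R" "t \<in> S"
  shows "fr a s \<otimes>\<^bsub>Q\<^esub> fr b t = fr (a \<otimes> b) (s \<otimes> t)"
proof -
  have "(\<lambda>(a, s). \<Union>(b, t)\<in>fr b t. fr (a \<otimes> b) (s \<otimes> t)) respects frac_rel R S"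
    if "b \<in> carrier R" "t \<in> S" for b t
  proof (rule congruentI, clarify)
    fix a s a' s' assume "((a, s), (a', s')) \<in> frac_rel R S"
    then obtain u where *: "a \<in> carrier R" "s \<in> S" "a' \<in> carrier R" "s' \<in> S" "u \<in> S"
      "u \<otimes> (s' \<otimes> a) = u \<otimes> (s \<otimes> a')"
      by (auto simp: frac_rel_def)
    have "fr (a \<otimes> b) (s \<otimes> t) = fr (a' \<otimes> b) (s' \<otimes> t)" if bt: "b \<in> carrier R" "t \<in> S" for b t
    proof -
      have "u \<otimes> (s' \<otimes> t \<otimes> (a \<otimes> b)) = (t \<otimes> b) \<otimes> (u \<otimes> (s' \<otimes> a))"
        using bt *(1-5) by (simp add: m_ac)
      also have "\<dots> = u \<otimes> (s \<otimes> t \<otimes> (a' \<otimes> b))"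
        unfolding *(6) using bt *(1-5) by (simp add: m_ac)
      finally show ?thesis
        using * bt by (subst fr_eq_iff) auto
    qed
    moreover have "fr b t \<subseteq> carrier R \<times> S"
      by (auto simp: fr_def frac_rel_def)
    ultimately show "(\<Union>(b, t)\<in>fr b t. fr (a \<otimes> b) (s \<otimes> t)) = (\<Union>(b, t)\<in>fr b t. fr (a' \<otimes> b) (s' \<otimes> t))"
      by (intro SUP_cong) auto
  qed
  from UN_equiv_class[OF equiv_frac_rel this[OF assms(3,4)], of "(a,s)"]
  have 1: "fr a s \<otimes>\<^bsub>Q\<^esub> fr b t = (\<Union>(b, t)\<in>fr b t. fr (a \<otimes> b) (s \<otimes> t))"
    using assms by (simp add: ring_of_fractions_def fr_def)
  have "(\<lambda>(b, t). fr (a \<otimes> b) (s \<otimes> t)) respects frac_rel R S"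
  proof (rule congruentI, clarify)
    fix b t b' t' assume "((b, t), (b', t')) \<in> frac_rel R S"
    then obtain u where *: "b \<in> carrier R" "t \<in> S" "b' \<in> carrier R" "t' \<in> S" "u \<in> S"
      "u \<otimes> (t' \<otimes> b) = u \<otimes> (t \<otimes> b')"
      by (auto simp: frac_rel_def)
    have "u \<otimes> (s \<otimes> t' \<otimes> (a \<otimes> b)) = (s \<otimes> a) \<otimes> (u \<otimes> (t' \<otimes> b))"
      using assms *(1-5) by (simp add: m_ac)
    also have "\<dots> = u \<otimes> (s \<otimes> t \<otimes> (a \<otimes> b'))"
      unfolding *(6) using assms *(1-5) by (simp add: m_ac)
    finally show "fr (a \<otimes> b) (s \<otimes> t) = fr (a \<otimes> b') (s \<otimes> t')"
      using * assms by (subst fr_eq_iff) auto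
  qed
  from UN_equiv_class[OF equiv_frac_rel this, of "(b,t)"] show ?thesis
    unfolding 1 using assms by (simp add: fr_def)
qed

text \<open>The unions collapse as for products. One computation, \<open>cong1\<close>, suffices:
  the second summand is reduced to the first by commutativity.\<close>

lemma add_fr [simp]:
  assumes "a \<in> carrier R" "s \<in> S" "b \<in> carrier R" "t \<in> S"
  shows "fr a s \<oplus>\<^bsub>Q\<^esub> fr b t = fr ((t \<otimes> a) \<oplus> (s \<otimes> b)) (s \<otimes> t)"
proof -
  have cong1: "fr ((t \<otimes> a) \<oplus> (s \<otimes> b)) (s \<otimes> t) = fr ((t \<otimes> a') \<oplus> (s' \<otimes> b)) (s' \<otimes> t)"
    if *: "a \<in> carrier R" "s \<in> S" "a' \<in> carrier R" "s' \<in> S" "u \<in> S"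
      "u \<otimes> (s' \<otimes> a) = u \<otimes> (s \<otimes> a')" and bt: "b \<in> carrier R" "t \<in> S" for a s a' s' b t u
  proof -
    have "u \<otimes> (s' \<otimes> t \<otimes> ((t \<otimes> a) \<oplus> (s \<otimes> b))) = (t \<otimes> t) \<otimes> (u \<otimes> (s' \<otimes> a)) \<oplus> u \<otimes> s' \<otimes> t \<otimes> s \<otimes> b"
      using bt *(1-5) by (simp add: m_ac r_distr)
    also have "\<dots> = u \<otimes> (s \<otimes> t \<otimes> ((t \<otimes> a') \<oplus> (s' \<otimes> b)))"
      unfolding *(6) using bt *(1-5) by (simp add: m_ac r_distr)
    finally show ?thesis
      using * bt by (subst fr_eq_iff) auto
  qed
  have "(\<lambda>(a, s). \<Union>(b, t)\<in>fr b t. fr ((t \<otimes> a) \<oplus> (s \<otimes> b)) (s \<otimes> t)) respects frac_rel R S"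
    if "b \<in> carrier R" "t \<in> S" for b t
  proof (rule congruentI, clarify)
    fix a s a' s' assume "((a, s), (a', s')) \<in> frac_rel R S"
    then obtain u where *: "a \<in> carrier R" "s \<in> S" "a' \<in> carrier R" "s' \<in> S" "u \<in> S"
      "u \<otimes> (s' \<otimes> a) = u \<otimes> (s \<otimes> a')"
      by (auto simp: frac_rel_def)
    moreover have "fr b t \<subseteq> carrier R \<times> S"
      by (auto simp: fr_def frac_rel_def)
    ultimately show "(\<Union>(b, t)\<in>fr b t. fr ((t \<otimes> a) \<oplus> (s \<otimes> b)) (s \<otimes> t)) =
        (\<Union>(b, t)\<in>fr b t. fr ((t \<otimes> a') \<oplus> (s' \<otimes> b)) (s' \<otimes> t))"
      using cong1[OF *] by (intro SUP_cong) auto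
  qed
  from UN_equiv_class[OF equiv_frac_rel this[OF assms(3,4)], of "(a,s)"]
  have 1: "fr a s \<oplus>\<^bsub>Q\<^esub> fr b t = (\<Union>(b, t)\<in>fr b t. fr ((t \<otimes> a) \<oplus> (s \<otimes> b)) (s \<otimes> t))"
    using assms by (simp add: ring_of_fractions_def fr_def)
  have "(\<lambda>(b, t). fr ((t \<otimes> a) \<oplus> (s \<otimes> b)) (s \<otimes> t)) respects frac_rel R S"
  proof (rule congruentI, clarify)
    fix b t b' t' assume "((b, t), (b', t')) \<in> frac_rel R S"
    then obtain u where *: "b \<in> carrier R" "t \<in> S" "b' \<in> carrier R" "t' \<in> S" "u \<in> S"
      "u \<otimes> (t' \<otimes> b) = u \<otimes> (t \<otimes> b')"
      by (auto simp: frac_rel_def)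
    from cong1[OF * assms(1,2)] show "fr ((t \<otimes> a) \<oplus> (s \<otimes> b)) (s \<otimes> t) = fr ((t' \<otimes> a) \<oplus> (s \<otimes> b')) (s \<otimes> t')"
      using assms * by (simp add: m_comm a_comm)
  qed
  from UN_equiv_class[OF equiv_frac_rel this, of "(b,t)"] show ?thesis
    unfolding 1 using assms by (simp add: fr_def)
qed

lemma one_Q: "\<one>\<^bsub>Q\<^esub> = fr \<one> \<one>" and zero_Q: "\<zero>\<^bsub>Q\<^esub> = fr \<zero> \<one>"
  by (simp_all add: ring_of_fractions_def fr_def)

lemma fr_zero: "s \<in> S \<Longrightarrow> fr \<zero> s = \<zero>\<^bsub>Q\<^esub>"
  unfolding zero_Q by (rule fr_eqI) auto

lemma fr_reduce: "\<lbrakk>a \<in> carrier R; s \<in> S; u \<in> S\<rbrakk> \<Longrightarrow> fr (u \<otimes> a) (u \<otimes> s) = fr a s"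
  by (rule fr_eqI) (simp_all add: m_ac)

lemma cring_Q: "cring Q"
proof (rule cringI)
  show "abelian_group Q"
  proof (rule abelian_groupI)
    fix x y assume xyz: "x \<in> carrier Q" "y \<in> carrier Q"
    obtain a s where "x = fr a s" "a \<in> carrier R" "s \<in> S"
      using frE[OF xyz(1)] .
    moreover obtain b t where "y = fr b t" "b \<in> carrier R" "t \<in> S"
      using frE[OF xyz(2)] .
    ultimately show "x \<oplus>\<^bsub>Q\<^esub> y \<in> carrier Q" "x \<oplus>\<^bsub>Q\<^esub> y = y \<oplus>\<^bsub>Q\<^esub> x"
      by (simp_all add: a_comm m_comm)
  next
    fix x y z assume xyz: "x \<in> carrier Q" "y \<in> carrier Q" "z \<in> carrier Q"
    obtain a s where x: "x = fr a s" "a \<in> carrier R" "s \<in> S"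
      using frE[OF xyz(1)] .
    obtain b t where y: "y = fr b t" "b \<in> carrier R" "t \<in> S"
      using frE[OF xyz(2)] .
    obtain c r where z: "z = fr c r" "c \<in> carrier R" "r \<in> S"
      using frE[OF xyz(3)] .
    note * = x y z
    have "r \<otimes> (t \<otimes> a \<oplus> s \<otimes> b) \<oplus> s \<otimes> t \<otimes> c = t \<otimes> r \<otimes> a \<oplus> s \<otimes> (r \<otimes> b \<oplus> t \<otimes> c)"
      using * by (simp add: r_distr m_ac a_assoc)
    then show "x \<oplus>\<^bsub>Q\<^esub> y \<oplus>\<^bsub>Q\<^esub> z = x \<oplus>\<^bsub>Q\<^esub> (y \<oplus>\<^bsub>Q\<^esub> z)"
      using * by (simp add: m_assoc)
  next
    fix x assume "x \<in> carrier Q"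
    then show "\<zero>\<^bsub>Q\<^esub> \<oplus>\<^bsub>Q\<^esub> x = x"
      unfolding zero_Q by (auto elim!: frE intro!: fr_eqI)
  next
    fix x assume "x \<in> carrier Q"
    then obtain a s where x: "x = fr a s" "a \<in> carrier R" "s \<in> S" by (rule frE)
    then have "fr (\<ominus> a) s \<oplus>\<^bsub>Q\<^esub> x = fr (s \<otimes> \<ominus> a \<oplus> s \<otimes> a) (s \<otimes> s)" by simp
    also have "s \<otimes> \<ominus> a \<oplus> s \<otimes> a = \<zero>"
      using x by (simp add: r_minus l_neg)
    finally show "\<exists>y\<in>carrier Q. y \<oplus>\<^bsub>Q\<^esub> x = \<zero>\<^bsub>Q\<^esub>"
      using x fr_zero by (intro bexI[of _ "fr (\<ominus> a) s"]) auto
  qed (simp add: zero_Q)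
  show "comm_monoid Q"
  proof (rule comm_monoidI)
    fix x y assume xyz: "x \<in> carrier Q" "y \<in> carrier Q"
    obtain a s where "x = fr a s" "a \<in> carrier R" "s \<in> S"
      using frE[OF xyz(1)] .
    moreover obtain b t where "y = fr b t" "b \<in> carrier R" "t \<in> S"
      using frE[OF xyz(2)] .
    ultimately show "x \<otimes>\<^bsub>Q\<^esub> y \<in> carrier Q" "x \<otimes>\<^bsub>Q\<^esub> y = y \<otimes>\<^bsub>Q\<^esub> x"
      by (simp_all add: m_comm)
  next
    fix x y z assume xyz: "x \<in> carrier Q" "y \<in> carrier Q" "z \<in> carrier Q"
    show "x \<otimes>\<^bsub>Q\<^esub> y \<otimes>\<^bsub>Q\<^esub> z = x \<otimes>\<^bsub>Q\<^esub> (y \<otimes>\<^bsub>Q\<^esub> z)"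
      using xyz by (auto elim!: frE simp: m_assoc)
  next
    fix x assume "x \<in> carrier Q"
    then show "\<one>\<^bsub>Q\<^esub> \<otimes>\<^bsub>Q\<^esub> x = x"
      unfolding one_Q by (auto elim!: frE)
  qed (simp add: one_Q)
next
  fix x y z assume xyz: "x \<in> carrier Q" "y \<in> carrier Q" "z \<in> carrier Q"
  show "(x \<oplus>\<^bsub>Q\<^esub> y) \<otimes>\<^bsub>Q\<^esub> z = x \<otimes>\<^bsub>Q\<^esub> z \<oplus>\<^bsub>Q\<^esub> y \<otimes>\<^bsub>Q\<^esub> z"
  proof -
    obtain a s where x: "x = fr a s" "a \<in> carrier R" "s \<in> S"
      using frE[OF xyz(1)] .
    obtain b t where y: "y = fr b t" "b \<in> carrier R" "t \<in> S"
      using frE[OF xyz(2)] .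
    obtain c r where z: "z = fr c r" "c \<in> carrier R" "r \<in> S"
      using frE[OF xyz(3)] .
    note * = x y z
    have "t \<otimes> r \<otimes> (a \<otimes> c) \<oplus> s \<otimes> r \<otimes> (b \<otimes> c) = r \<otimes> ((t \<otimes> a \<oplus> s \<otimes> b) \<otimes> c)"
      "s \<otimes> r \<otimes> (t \<otimes> r) = r \<otimes> (s \<otimes> t \<otimes> r)"
      using * by (simp_all add: r_distr l_distr m_ac)
    then show ?thesis
      using * by (simp add: fr_reduce)
  qed
qed

lemma fr_cancel: "\<lbrakk>a \<in> carrier R; s \<in> S\<rbrakk> \<Longrightarrow> fr s \<one> \<otimes>\<^bsub>Q\<^esub> fr a s = fr a \<one>"
  by (simp, rule fr_eqI) (simp_all add: m_ac)

section \<open>Contraction and extension of ideals\<close>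

definition contraction :: "('a \<times> 'a) set set \<Rightarrow> 'a set" where
  "contraction J = {a \<in> carrier R. fr a \<one> \<in> J}"

text \<open>Denominators are units of the ring of fractions, so membership of a fraction depends on
  its numerator alone.\<close>

lemma mem_iff_contraction:
  assumes "ideal J Q" "a \<in> carrier R" "s \<in> S"
  shows "fr a s \<in> J \<longleftrightarrow> a \<in> contraction J"
proof -
  interpret J: ideal J Q by fact
  have "fr a s \<in> J" if "fr a \<one> \<in> J"
    using J.I_l_closed[OF that, of "fr \<one> s"] assms by simp
  moreover have "fr a \<one> \<in> J" if "fr a s \<in> J"
    using J.I_l_closed[OF that, of "fr s \<one>"] assms fr_cancel by simp
  ultimately show ?thesis
    using assms unfolding contraction_def by auto
qed

text \<open>An ideal of fractions is recovered from its contraction; this transports strict chains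
  of primes and generating sets between the two rings.\<close>

lemma contraction_subset_iff:
  assumes "ideal J Q" "ideal J' Q"
  shows "contraction J \<subseteq> contraction J' \<longleftrightarrow> J \<subseteq> J'"
proof
  assume "contraction J \<subseteq> contraction J'"
  then show "J \<subseteq> J'"
    using assms mem_iff_contraction ideal.Icarr[OF assms(1)] by (blast elim: frE)
qed (auto simp: contraction_def)

lemma contraction_ideal:
  assumes "ideal J Q"
  shows "ideal (contraction J) R"
proof -
  interpret J: ideal J Q by fact
  have a: "a \<oplus> b \<in> contraction J" if "a \<in> contraction J" "b \<in> contraction J" for a b
    using that additive_subgroup.a_closed[OF J.is_additive_subgroup, of "fr a \<one>" "fr b \<one>"] by (auto simp: contraction_def)
  have m: "x \<otimes> a \<in> contraction J" if "a \<in> contraction J" "x \<in> carrier R" for a x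
    using that J.I_l_closed[of "fr a \<one>" "fr x \<one>"] by (auto simp: contraction_def)
  have "subgroup (contraction J) (add_monoid R)"
  proof (rule subgroup.intro)
    fix x assume x: "x \<in> contraction J"
    then have c: "x \<in> carrier R" by (auto simp: contraction_def)
    with x have "\<ominus> \<one> \<otimes> x \<in> contraction J" by (intro m) auto
    with c have "\<ominus> x \<in> contraction J" by (simp add: l_minus)
    with c show "inv\<^bsub>add_monoid R\<^esub> x \<in> contraction J" by (simp add: a_inv_def)
  next
    show "\<one>\<^bsub>add_monoid R\<^esub> \<in> contraction J"
      using additive_subgroup.zero_closed[OF J.is_additive_subgroup] unfolding zero_Q
      by (simp add: contraction_def)
  qed (auto simp: a, auto simp: contraction_def)
  then show ?thesis
    using m by (intro idealI[OF ring_axioms]) (auto simp: contraction_def m_comm)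
qed

lemma contraction_prime:
  assumes "primeideal J Q"
  shows "primeideal (contraction J) R"
proof -
  interpret J: primeideal J Q by fact
  have "\<one>\<^bsub>Q\<^esub> \<notin> J"
    using J.I_notcarr J.one_imp_carrier by blast
  then have "\<one> \<notin> contraction J"
    by (auto simp: one_Q contraction_def)
  then show ?thesis
    using contraction_ideal[OF J.is_ideal] J.I_prime[of "fr _ \<one>" "fr _ \<one>"]
    by (intro primeidealI[OF _ is_cring]) (auto simp: contraction_def)
qed

text \<open>Two fractions have a common denominator, so the fractions with numerator in
  \<open>I\<close> are already closed under addition.\<close>

definition extension :: "'a set \<Rightarrow> ('a \<times> 'a) set set" where
  "extension I = {fr a s | a s. a \<in> I \<and> s \<in> S}"

lemma extension_ideal:
  assumes "ideal I R"
  shows "ideal (extension I) Q"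
proof -
  interpret Q: cring Q by (rule cring_Q)
  interpret I: ideal I R by fact
  have a: "x \<oplus>\<^bsub>Q\<^esub> y \<in> extension I" if "x \<in> extension I" "y \<in> extension I" for x y
  proof -
    from that obtain a s b t where *: "x = fr a s" "y = fr b t" "a \<in> I" "s \<in> S" "b \<in> I" "t \<in> S"
      by (auto simp: extension_def)
    then have "x \<oplus>\<^bsub>Q\<^esub> y = fr ((t \<otimes> a) \<oplus> (s \<otimes> b)) (s \<otimes> t)"
      by (simp add: I.Icarr)
    moreover have "(t \<otimes> a) \<oplus> (s \<otimes> b) \<in> I"
      using * by (intro additive_subgroup.a_closed[OF I.is_additive_subgroup] I.I_l_closed) auto
    ultimately show ?thesis
      using S_mult[of s t] * unfolding extension_def by blast
  qed
  have m: "x \<otimes>\<^bsub>Q\<^esub> y \<in> extension I" if xy: "y \<in> extension I" "x \<in> carrier Q" for x y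
  proof -
    obtain a s where "x = fr a s" "a \<in> carrier R" "s \<in> S"
      using frE[OF xy(2)] .
    moreover obtain b t where "y = fr b t" "b \<in> I" "t \<in> S"
      using xy(1) by (auto simp: extension_def)
    ultimately have "x \<otimes>\<^bsub>Q\<^esub> y = fr (a \<otimes> b) (s \<otimes> t)" "a \<otimes> b \<in> I" "s \<otimes> t \<in> S"
      by (simp_all add: I.Icarr I.I_l_closed)
    then show ?thesis
      unfolding extension_def by blast
  qed
  have sub: "extension I \<subseteq> carrier Q"
    using I.Icarr by (auto simp: extension_def)
  have "subgroup (extension I) (add_monoid Q)"
  proof (rule subgroup.intro)
    fix x assume x: "x \<in> extension I"
    then have c: "x \<in> carrier Q" using sub by auto
    with x have "\<ominus>\<^bsub>Q\<^esub> \<one>\<^bsub>Q\<^esub> \<otimes>\<^bsub>Q\<^esub> x \<in> extension I" by (intro m) auto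
    with c have "\<ominus>\<^bsub>Q\<^esub> x \<in> extension I" by (simp add: Q.l_minus)
    with c show "inv\<^bsub>add_monoid Q\<^esub> x \<in> extension I" by (simp add: a_inv_def)
  next
    show "\<one>\<^bsub>add_monoid Q\<^esub> \<in> extension I"
      using additive_subgroup.zero_closed[OF I.is_additive_subgroup] S_one
      unfolding extension_def zero_Q by (simp, blast)
  qed (use a sub in auto)
  moreover have "y \<otimes>\<^bsub>Q\<^esub> x \<in> extension I" if "y \<in> extension I" "x \<in> carrier Q" for x y
    using m[OF that] Q.m_comm[of y x] that sub by auto
  ultimately show ?thesis
    using m by (intro idealI[OF Q.ring_axioms])
qed

text \<open>The factor \<open>u\<close> reflects that fractions are equal only up to multiplication
  by an element of \<open>S\<close>; for a prime disjoint from \<open>S\<close> it can be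
  cancelled.\<close>

lemma mem_extension_iff:
  assumes "ideal I R" "a \<in> carrier R" "s \<in> S"
  shows "fr a s \<in> extension I \<longleftrightarrow> (\<exists>u\<in>S. u \<otimes> a \<in> I)"
proof
  interpret I: ideal I R by fact
  assume "fr a s \<in> extension I"
  then obtain b t where "fr a s = fr b t" "b \<in> I" "t \<in> S"
    by (auto simp: extension_def)
  moreover from this obtain u where u: "u \<in> S" "u \<otimes> (t \<otimes> a) = u \<otimes> (s \<otimes> b)"
    using assms I.Icarr fr_eq_iff by metis
  ultimately have "(u \<otimes> t) \<otimes> a \<in> I"
    using assms I.Icarr I.I_l_closed by (simp add: m_assoc)
  then show "\<exists>u\<in>S. u \<otimes> a \<in> I"
    using u \<open>t \<in> S\<close> S_mult by blast
next
  assume "\<exists>u\<in>S. u \<otimes> a \<in> I"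
  then obtain u where "u \<in> S" "u \<otimes> a \<in> I" by blast
  moreover have "fr a s = fr (u \<otimes> a) (u \<otimes> s)"
    using assms \<open>u \<in> S\<close> by (intro fr_eqI) (auto simp: m_ac)
  ultimately show "fr a s \<in> extension I"
    using \<open>u \<in> S\<close> \<open>s \<in> S\<close> S_mult unfolding extension_def by blast
qed

lemma extension_prime:
  assumes "primeideal I R" "I \<inter> S = {}"
  shows "primeideal (extension I) Q" "contraction (extension I) = I"
proof -
  interpret I: primeideal I R by fact
  have iff: "fr a s \<in> extension I \<longleftrightarrow> a \<in> I" if as: "a \<in> carrier R" "s \<in> S" for a s
  proof -
    have "(\<exists>u\<in>S. u \<otimes> a \<in> I) \<longleftrightarrow> a \<in> I"
    proof
      assume "\<exists>u\<in>S. u \<otimes> a \<in> I"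
      then obtain u where "u \<in> S" "u \<otimes> a \<in> I" by blast
      then show "a \<in> I" using I.I_prime[of u a] as assms(2) by auto
    next
      assume "a \<in> I"
      then show "\<exists>u\<in>S. u \<otimes> a \<in> I" using as by (intro bexI[of _ \<one>]) auto
    qed
    then show ?thesis by (simp only: mem_extension_iff[OF I.is_ideal as])
  qed
  show "primeideal (extension I) Q"
  proof (rule primeidealI[OF extension_ideal[OF I.is_ideal] cring_Q])
    have "fr \<one> \<one> \<notin> extension I"
      using iff[OF one_closed S_one] assms(2) S_one by blast
    then show "carrier Q \<noteq> extension I"
      using fr_carrier[OF one_closed S_one] by blast
    fix x y assume xy: "x \<in> carrier Q" "y \<in> carrier Q" "x \<otimes>\<^bsub>Q\<^esub> y \<in> extension I"
    obtain a s where x: "x = fr a s" "a \<in> carrier R" "s \<in> S"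
      using frE[OF xy(1)] .
    obtain b t where y: "y = fr b t" "b \<in> carrier R" "t \<in> S"
      using frE[OF xy(2)] .
    show "x \<in> extension I \<or> y \<in> extension I"
      using xy(3) x y I.I_prime[of a b] S_mult[of s t] iff[of a s] iff[of b t] iff[of "a \<otimes> b" "s \<otimes> t"]
      by (simp only: mult_fr) blast
  qed
  show "contraction (extension I) = I"
    using I.Icarr by (auto simp: contraction_def iff)
qed

text \<open>A finite generating set of the contraction, read as fractions with denominator one,
  generates the ideal.\<close>

lemma noetherian_Q:
  assumes "noetherian_ring R"
  shows "noetherian_ring Q"
proof -
  interpret Q: cring Q by (rule cring_Q)
  show ?thesis
  proof (rule Q.noetherian_ringI)
    fix J assume J: "ideal J Q"
    interpret J: ideal J Q by fact
    obtain A where A: "A \<subseteq> carrier R" "finite A" "contraction J = Idl A"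
      using noetherian_ring.finetely_gen[OF assms contraction_ideal[OF J]] by blast
    let ?B = "(\<lambda>a. fr a \<one>) ` A"
    have B: "?B \<subseteq> carrier Q" using A by auto
    have "?B \<subseteq> J"
      using A genideal_self[OF A(1)] by (auto simp: contraction_def)
    then have "Idl\<^bsub>Q\<^esub> ?B \<subseteq> J"
      by (rule Q.genideal_minimal[OF J])
    moreover have "contraction J \<subseteq> contraction (Idl\<^bsub>Q\<^esub> ?B)"
      unfolding A(3) using A(1) Q.genideal_self[OF B]
      by (intro genideal_minimal contraction_ideal Q.genideal_ideal[OF B]) (auto simp: contraction_def)
    then have "J \<subseteq> Idl\<^bsub>Q\<^esub> ?B"
      using contraction_subset_iff J Q.genideal_ideal[OF B] by blast
    ultimately show "\<exists>B\<subseteq>carrier Q. finite B \<and> J = Idl\<^bsub>Q\<^esub> B"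
      using A B by (intro exI[of _ ?B]) auto
  qed
qed

end

section \<open>Depth and dimension of a localization\<close>

text \<open>An ideal maximal among those containing \<open>I\<close> and avoiding \<open>T\<close>
  is prime. Zorn's lemma provides it, since in a Noetherian ring the union of a chain of ideals is a
  member of the chain.\<close>

lemma (in cring) prime_ideal_disjoint:
  assumes "noetherian_ring R" "ideal I R" "T \<subseteq> carrier R" "\<one> \<in> T"
    and T_mult: "\<And>s t. \<lbrakk>s \<in> T; t \<in> T\<rbrakk> \<Longrightarrow> s \<otimes> t \<in> T" and "I \<inter> T = {}"
  obtains M where "primeideal M R" "I \<subseteq> M" "M \<inter> T = {}"
proof -
  define \<A> where "\<A> = {J. ideal J R \<and> I \<subseteq> J \<and> J \<inter> T = {}}"
  have "\<exists>M\<in>\<A>. \<forall>X\<in>\<A>. M \<subseteq> X \<longrightarrow> X = M"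
  proof (rule subset_Zorn_nonempty)
    show "\<A> \<noteq> {}" using assms(2,6) by (auto simp: \<A>_def)
    fix C assume C: "C \<noteq> {}" "subset.chain \<A> C"
    then have "subset.chain {I. ideal I R} C"
      unfolding pred_on.chain_def \<A>_def by blast
    from noetherian_ring.ideal_chain_is_trivial[OF assms(1) C(1) this] C(2)
    show "\<Union>C \<in> \<A>" unfolding pred_on.chain_def by blast
  qed
  then obtain M where M_in: "M \<in> \<A>" and M_max: "\<forall>X\<in>\<A>. M \<subseteq> X \<longrightarrow> X = M"
    by blast
  then have M: "ideal M R" "I \<subseteq> M" "M \<inter> T = {}"
    by (auto simp: \<A>_def)
  have max: "X = M" if "ideal X R" "M \<subseteq> X" "X \<inter> T = {}" for X
    using M_max M(2) that by (auto simp: \<A>_def)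
  interpret M: ideal M R by fact
  note add_M = additive_subgroup.a_closed[OF M.is_additive_subgroup]
  \<comment> \<open>By maximality, \<open>M\<close> and an element \<open>x\<close> outside it
    generate an ideal that meets \<open>T\<close>.\<close>
  have meets: "\<exists>m\<in>M. \<exists>r\<in>carrier R. m \<oplus> r \<otimes> x \<in> T" if x: "x \<in> carrier R" "x \<notin> M" for x
  proof -
    have ideal: "ideal (M <+> PIdl x) R"
      by (rule add_ideals[OF M.is_ideal cgenideal_ideal[OF x(1)]])
    have sub: "M \<subseteq> M <+> PIdl x"
    proof
      fix m assume m: "m \<in> M"
      have "\<zero> \<in> PIdl x"
        using additive_subgroup.zero_closed ideal.axioms(1) cgenideal_ideal[OF x(1)] by blast
      then show "m \<in> M <+> PIdl x"
        using m M.Icarr[OF m] unfolding set_add_def' by (intro CollectI UN_I[of m] UN_I[of \<zero>]) auto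
    qed
    have "x \<in> M <+> PIdl x"
      using cgenideal_self[OF x(1)] x(1) additive_subgroup.zero_closed[OF M.is_additive_subgroup]
      unfolding set_add_def' by (intro UN_I[of \<zero>] UN_I[of x]) auto
    then have "(M <+> PIdl x) \<inter> T \<noteq> {}"
      using max[OF ideal sub] x(2) by auto
    then show ?thesis
      unfolding set_add_def' cgenideal_def by blast
  qed
  have "primeideal M R"
  proof (rule primeidealI[OF M(1) is_cring])
    show "carrier R \<noteq> M" using assms(4) M(3) one_closed by blast
    fix x y assume xy: "x \<in> carrier R" "y \<in> carrier R" "x \<otimes> y \<in> M"
    show "x \<in> M \<or> y \<in> M"
    proof (rule ccontr)
      assume "\<not> (x \<in> M \<or> y \<in> M)"
      then obtain m r m' r' where *: "m \<in> M" "r \<in> carrier R" "m \<oplus> r \<otimes> x \<in> T"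
        "m' \<in> M" "r' \<in> carrier R" "m' \<oplus> r' \<otimes> y \<in> T"
        using meets[OF xy(1)] meets[OF xy(2)] by blast
      note [simp] = xy(1,2) *(2,5) M.Icarr[OF *(1)] M.Icarr[OF *(4)]
      \<comment> \<open>Every term of the expanded product has a factor in \<open>M\<close>, while
        the product itself lies in \<open>T\<close>.\<close>
      have "(m \<oplus> r \<otimes> x) \<otimes> (m' \<oplus> r' \<otimes> y) = (m' \<oplus> r' \<otimes> y) \<otimes> m \<oplus> ((r \<otimes> x) \<otimes> m' \<oplus> (r \<otimes> r') \<otimes> (x \<otimes> y))"
        by (simp add: l_distr r_distr m_ac a_ac)
      also have "\<dots> \<in> M"
        by (intro add_M M.I_l_closed * xy) simp_all
      finally show False using T_mult[OF *(3,6)] M(3) by blast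
    qed
  qed
  then show thesis using M that by blast
qed

text \<open>
  A prime disjoint from the multiplicative set of all \<open>s \<otimes> a [^] i\<close> with \<open>s \<notin> q\<close> lies below \<open>q\<close>
  and avoids \<open>a\<close>; it exists because \<open>a\<close> is a non-zero-divisor modulo \<open>I\<close>.
\<close>

lemma (in cring) prime_below_avoiding:
  assumes "noetherian_ring R" "primeideal q R" "ideal I R" "I \<subseteq> q" "a \<in> q"
    and nzd: "\<And>b. \<lbrakk>b \<in> carrier R; a \<otimes> b \<in> I\<rbrakk> \<Longrightarrow> b \<in> I"
  obtains q' where "primeideal q' R" "I \<subseteq> q'" "q' \<subset> q"
proof -
  interpret q: primeideal q R by fact
  define T where "T = {s \<otimes> a [^] i | s i. s \<in> carrier R - q \<and> (i::nat) \<in> UNIV}"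
  have a: "a \<in> carrier R" using q.Icarr assms(5) by blast
  have one: "\<one> \<notin> q" using q.one_imp_carrier q.I_notcarr by blast
  \<comment> \<open>Cancelling \<open>a\<close> one factor at a time moves \<open>s\<close> itself
    into \<open>I\<close>, hence into \<open>q\<close>; so \<open>I\<close> and \<open>T\<close> do
    not meet.\<close>
  have pow: "s \<in> I" if "s \<in> carrier R" "s \<otimes> a [^] i \<in> I" for s and i :: nat
    using that
  proof (induction i)
    case (Suc i)
    have "s \<otimes> a [^] Suc i = a \<otimes> (s \<otimes> a [^] i)"
      using a Suc.prems(1) by (simp add: m_ac)
    then show ?case using Suc nzd[of "s \<otimes> a [^] i"] a by simp
  qed simp
  have "I \<inter> T = {}" using pow assms(4) unfolding T_def by blast
  moreover have "T \<subseteq> carrier R" using a unfolding T_def by auto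
  moreover have "\<one> \<in> T" using one unfolding T_def
    by (auto intro!: exI[of _ \<one>] exI[of _ "0::nat"])
  moreover have "s \<otimes> t \<in> T" if "s \<in> T" "t \<in> T" for s t
  proof -
    from that obtain u v and i j :: nat where *: "s = u \<otimes> a [^] i" "t = v \<otimes> a [^] j"
      "u \<in> carrier R" "u \<notin> q" "v \<in> carrier R" "v \<notin> q" unfolding T_def by blast
    then have "s \<otimes> t = (u \<otimes> v) \<otimes> a [^] (i + j)"
      using a by (simp add: m_ac nat_pow_mult[symmetric])
    then show ?thesis using * q.I_prime[of u v] unfolding T_def by blast
  qed
  ultimately obtain M where M: "primeideal M R" "I \<subseteq> M" "M \<inter> T = {}"
    using prime_ideal_disjoint[OF assms(1,3), of T] by metis
  interpret M: primeideal M R by fact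
  have "x \<in> T" if "x \<in> carrier R - q" for x
    using that unfolding T_def by (auto intro!: exI[of _ x] exI[of _ "0::nat"])
  then have "M \<subseteq> q" using M(3) M.Icarr by blast
  moreover have "a \<in> T"
    using one a unfolding T_def by (auto intro!: exI[of _ \<one>] exI[of _ "1::nat"])
  then have "a \<notin> M" using M(3) by blast
  ultimately show thesis using M assms(5) that by blast
qed

text \<open>The chain is built downwards: on top a prime over the ideal of the whole sequence, and
  below each prime a strictly smaller one over the shorter initial ideal, which exists because the
  dropped element is regular modulo that ideal. This bounds depth by dimension.\<close>

lemma (in cring) regular_sequence_prime_chain:
  assumes "noetherian_ring R" "regular_sequence R xs"
  obtains C where "\<And>i. i \<le> length xs \<Longrightarrow> primeideal (C i) R"
    and "\<And>i. i < length xs \<Longrightarrow> C i \<subset> C (Suc i)"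
proof -
  define n where "n = length xs"
  have xs: "set xs \<subseteq> carrier R" "Idl (set xs) \<noteq> carrier R"
    and reg: "\<And>i a. \<lbrakk>i < n; a \<in> carrier R; xs ! i \<otimes> a \<in> Idl (set (take i xs))\<rbrakk>
                 \<Longrightarrow> a \<in> Idl (set (take i xs))"
    using assms(2) unfolding regular_sequence_def n_def by auto
  have take_sub: "set (take i xs) \<subseteq> carrier R" for i
    using xs(1) set_take_subset by (rule subset_trans[rotated])
  \<comment> \<open>After \<open>k\<close> steps the members with indices from \<open>n - k\<close>
    to \<open>n\<close> are in place.\<close>
  have "\<exists>C. (\<forall>i. n - k \<le> i \<and> i \<le> n \<longrightarrow> primeideal (C i) R \<and> Idl (set (take i xs)) \<subseteq> C i) \<and>
           (\<forall>i. n - k \<le> i \<and> i < n \<longrightarrow> C i \<subset> C (Suc i))" if "k \<le> n" for k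
    using that
  proof (induction k)
    case 0
    have I: "ideal (Idl (set xs)) R" by (rule genideal_ideal[OF xs(1)])
    then have "\<one> \<notin> Idl (set xs)" using xs(2) ideal.one_imp_carrier by blast
    then obtain M where "primeideal M R" "Idl (set xs) \<subseteq> M"
      using prime_ideal_disjoint[OF assms(1) I, of "{\<one>}"] by auto
    then show ?case by (intro exI[of _ "\<lambda>_. M"]) (auto simp: n_def)
  next
    case (Suc k)
    then obtain C where
      "\<forall>i. n - k \<le> i \<and> i \<le> n \<longrightarrow> primeideal (C i) R \<and> Idl (set (take i xs)) \<subseteq> C i"
      "\<forall>i. n - k \<le> i \<and> i < n \<longrightarrow> C i \<subset> C (Suc i)"
      by fastforce
    then have C: "\<And>i. \<lbrakk>n - k \<le> i; i \<le> n\<rbrakk> \<Longrightarrow> primeideal (C i) R \<and> Idl (set (take i xs)) \<subseteq> C i"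
      "\<And>i. \<lbrakk>n - k \<le> i; i < n\<rbrakk> \<Longrightarrow> C i \<subset> C (Suc i)"
      by blast+
    define j where "j = n - Suc k"
    have j: "j < n" "Suc j = n - k" using Suc.prems by (auto simp: j_def)
    have CS: "primeideal (C (Suc j)) R" "Idl (set (take (Suc j) xs)) \<subseteq> C (Suc j)"
      using C(1)[of "Suc j"] j by auto
    have take_Suc: "set (take (Suc j) xs) = insert (xs ! j) (set (take j xs))"
      using j(1) by (simp add: n_def take_Suc_conv_app_nth)
    have sub: "Idl (set (take j xs)) \<subseteq> Idl (set (take (Suc j) xs))"
      by (rule genideal_minimal[OF genideal_ideal[OF take_sub]])
        (use genideal_self[OF take_sub, of "Suc j"] take_Suc in blast)
    have mem: "xs ! j \<in> C (Suc j)"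
      using genideal_self[OF take_sub, of "Suc j"] take_Suc CS(2) by blast
    obtain q where q: "primeideal q R" "Idl (set (take j xs)) \<subseteq> q" "q \<subset> C (Suc j)"
    proof (rule prime_below_avoiding[OF assms(1) CS(1) genideal_ideal[OF take_sub, of j] _ mem])
      show "Idl (set (take j xs)) \<subseteq> C (Suc j)" using sub CS(2) by blast
      show "b \<in> Idl (set (take j xs))"
        if "b \<in> carrier R" "xs ! j \<otimes> b \<in> Idl (set (take j xs))" for b
        by (rule reg[OF j(1) that])
    qed blast
    have "n - Suc k \<le> i \<longleftrightarrow> i = j \<or> n - k \<le> i" for i
      using j unfolding j_def by linarith
    moreover have "\<not> n - k \<le> j" using j by linarith
    ultimately show ?case
      using C q j by (intro exI[of _ "C(j := q)"]) auto
  qed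
  from this[of n] obtain C where
    "\<forall>i\<le>n. primeideal (C i) R" "\<forall>i<n. C i \<subset> C (Suc i)" by auto
  then show thesis using that unfolding n_def by blast
qed

lemma depth_le_krull_dim:
  assumes "cring R" "noetherian_ring R"
  shows "depth R I \<le> krull_dim R"
  unfolding depth_def
proof (rule Sup_least, clarify)
  interpret cring R by fact
  fix xs assume "regular_sequence R xs"
  then obtain C where "\<And>i. i \<le> length xs \<Longrightarrow> primeideal (C i) R"
    "\<And>i. i < length xs \<Longrightarrow> C i \<subset> C (Suc i)"
    using regular_sequence_prime_chain[OF assms(2)] by blast
  then show "enat (length xs) \<le> krull_dim R"
    unfolding krull_dim_def by (intro Sup_upper) blast
qed

lemma (in cring) Idl_empty: "Idl {} = {\<zero>}"
proof
  show "Idl {} \<subseteq> {\<zero>}" by (rule genideal_minimal[OF zeroideal]) simp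
  show "{\<zero>} \<subseteq> Idl {}"
    using additive_subgroup.zero_closed[OF ideal.axioms(1)[OF genideal_ideal[of "{}"]]] by simp
qed

lemma (in cring) mem_Idl_singleton:
  assumes "a \<in> carrier R"
  shows "b \<in> Idl {a} \<longleftrightarrow> (\<exists>c\<in>carrier R. b = a \<otimes> c)"
  unfolding cgenideal_eq_genideal[OF assms, symmetric] cgenideal_def
  using assms m_comm by auto

section \<open>Localization at a maximal ideal\<close>

locale localization_maximal = cring R for R (structure) +
  fixes m
  assumes noetherian: "noetherian_ring R" and max: "maximalideal m R"
begin

lemma prime_m: "primeideal m R"
  by (rule maximalideal_prime[OF max])

sublocale fractions R "carrier R - m"
proof -
  interpret m: primeideal m R by (rule prime_m)
  have "\<one> \<notin> m" using m.one_imp_carrier m.I_notcarr by blast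
  then show "fractions R (carrier R - m)"
    using m.I_prime by unfold_locales auto
qed

lemma Q_eq: "Q = localization_at R m"
  by (simp add: localization_at_def)

text \<open>A fraction with numerator outside \<open>m\<close> is a unit, so a proper ideal has all
  its numerators in \<open>m\<close>. Hence the localization is local.\<close>

lemma proper_ideal_sub:
  assumes J: "ideal J Q" "J \<noteq> carrier Q"
  shows "J \<subseteq> extension m"
proof
  fix F assume F: "F \<in> J"
  obtain a s where as: "F = fr a s" "a \<in> carrier R" "s \<in> carrier R - m"
    using frE[OF ideal.Icarr[OF J(1) F]] .
  have aJ: "a \<in> contraction J" using F as mem_iff_contraction[OF J(1)] by blast
  have "a \<in> m"
  proof (rule ccontr)
    assume "a \<notin> m"
    then have a: "a \<in> carrier R - m" using as by blast
    then have "fr a a \<in> J" using mem_iff_contraction[OF J(1) as(2) a] aJ by blast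
    moreover have "fr a a = \<one>\<^bsub>Q\<^esub>"
      unfolding one_Q using as(2) a S_one by (intro fr_eqI) simp_all
    ultimately show False using J ideal.one_imp_carrier by metis
  qed
  then show "F \<in> extension m" unfolding extension_def using as by blast
qed

lemma maximal_ideals_Q: "{I. maximalideal I Q} = {extension m}"
proof -
  interpret m: primeideal m R by (rule prime_m)
  have ext: "primeideal (extension m) Q" by (rule extension_prime[OF prime_m]) blast
  interpret e: primeideal "extension m" Q by (rule ext)
  have "maximalideal (extension m) Q"
  proof (rule maximalidealI[OF e.is_ideal])
    show "carrier Q \<noteq> extension m" by (rule e.I_notcarr)
    show "J = extension m \<or> J = carrier Q" if "ideal J Q" "extension m \<subseteq> J" "J \<subseteq> carrier Q" for J
      using that proper_ideal_sub by blast
  qed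
  moreover have "I = extension m" if "maximalideal I Q" for I
  proof -
    interpret I: maximalideal I Q by fact
    have "I \<subseteq> extension m" using proper_ideal_sub I.is_ideal I.I_notcarr by blast
    then show ?thesis
      using I.I_maximal[OF e.is_ideal] e.I_notcarr e.Icarr by blast
  qed
  ultimately show ?thesis by blast
qed

lemma mem_extension_m:
  assumes "a \<in> carrier R"
  shows "fr a \<one> \<in> extension m \<longleftrightarrow> a \<in> m"
proof -
  have "contraction (extension m) = m" by (rule extension_prime[OF prime_m]) blast
  then show ?thesis using assms unfolding contraction_def by blast
qed

text \<open>Contraction keeps primes prime and strict inclusions strict, so a chain that is too long
  would already occur in \<open>R\<close>.\<close>

lemma krull_dim_Q_le:
  assumes "\<And>C. (\<And>i. i \<le> Suc d \<Longrightarrow> primeideal (C i) R) \<Longrightarrow> (\<And>i. i < Suc d \<Longrightarrow> C i \<subset> C (Suc i)) \<Longrightarrow> False"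
  shows "krull_dim Q \<le> enat d"
  unfolding krull_dim_def
proof (rule Sup_least, clarify)
  fix e C assume C: "\<forall>i\<le>e. primeideal (C i) Q" "\<forall>i<e. C i \<subset> C (Suc i)"
  show "enat e \<le> enat d"
  proof (rule ccontr)
    assume "\<not> enat e \<le> enat d"
    then have e: "Suc d \<le> e" by simp
    show False
    proof (rule assms[of "\<lambda>i. contraction (C i)"])
      show "primeideal (contraction (C i)) R" if "i \<le> Suc d" for i
        using that C e by (intro contraction_prime) simp
      show "contraction (C i) \<subset> contraction (C (Suc i))" if "i < Suc d" for i
        using that C e contraction_subset_iff[of "C i" "C (Suc i)"]
          contraction_subset_iff[of "C (Suc i)" "C i"] primeideal.axioms(1)[of "C i"]
          primeideal.axioms(1)[of "C (Suc i)"] by (meson Suc_leI less_le_not_le less_imp_le_nat order.strict_trans2)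
    qed
  qed
qed

lemma fr_eq_zero:
  assumes "a \<in> carrier R" "s \<in> carrier R - m"
  shows "fr a s = \<zero>\<^bsub>Q\<^esub> \<longleftrightarrow> (\<exists>u\<in>carrier R - m. u \<otimes> a = \<zero>)"
proof -
  have "fr a s = \<zero>\<^bsub>Q\<^esub> \<longleftrightarrow> (\<exists>u\<in>carrier R - m. u \<otimes> (\<one> \<otimes> a) = u \<otimes> (s \<otimes> \<zero>))"
    unfolding zero_Q using assms S_one by (intro fr_eq_iff) auto
  also have "\<dots> \<longleftrightarrow> (\<exists>u\<in>carrier R - m. u \<otimes> a = \<zero>)"
    using assms by (intro bex_cong) auto
  finally show ?thesis .
qed

text \<open>The elements \<open>f\<close>, \<open>g\<close> give a regular sequence in the
  localization, so its depth is at least two; without chains of four primes the dimension is at most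
  two, and depth never exceeds dimension. The assumption \<open>reg\<close> says that
  \<open>g\<close> is a non-zero-divisor modulo \<open>f\<close>.\<close>

theorem cohen_macaulay_localI:
  assumes fg: "f \<in> m" "g \<in> m"
    and nzd: "\<And>a. \<lbrakk>a \<in> carrier R; f \<otimes> a = \<zero>\<rbrakk> \<Longrightarrow> a = \<zero>"
    and reg: "\<And>a b. \<lbrakk>a \<in> carrier R; b \<in> carrier R; f \<otimes> a = g \<otimes> b\<rbrakk> \<Longrightarrow> \<exists>c\<in>carrier R. b = f \<otimes> c"
    and dim: "\<And>C. (\<And>i. i \<le> 3 \<Longrightarrow> primeideal (C i) R) \<Longrightarrow> (\<And>i. i < 3 \<Longrightarrow> C i \<subset> C (Suc i)) \<Longrightarrow> False"
  shows "cohen_macaulay_local (localization_at R m)"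
proof -
  interpret m: primeideal m R by (rule prime_m)
  interpret Q: cring Q by (rule cring_Q)
  interpret e: primeideal "extension m" Q by (rule extension_prime[OF prime_m]) blast
  have f: "f \<in> carrier R" and g: "g \<in> carrier R" using fg m.Icarr by blast+
  have F: "fr f \<one> \<in> carrier Q" and G: "fr g \<one> \<in> carrier Q" using f g S_one by auto
  have mem: "fr f \<one> \<in> extension m" "fr g \<one> \<in> extension m"
    using mem_extension_m f g fg by blast+
  have r0: "x = \<zero>\<^bsub>Q\<^esub>" if x: "x \<in> carrier Q" "fr f \<one> \<otimes>\<^bsub>Q\<^esub> x = \<zero>\<^bsub>Q\<^esub>" for x
  proof -
    obtain a s where as: "x = fr a s" "a \<in> carrier R" "s \<in> carrier R - m" using frE[OF x(1)] .
    then have "fr (f \<otimes> a) s = \<zero>\<^bsub>Q\<^esub>" using x(2) f S_one by simp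
    then obtain u where u: "u \<in> carrier R - m" "u \<otimes> (f \<otimes> a) = \<zero>"
      using fr_eq_zero as f by auto
    have uc: "u \<in> carrier R" using u by blast
    have "f \<otimes> (u \<otimes> a) = \<zero>" using m_lcomm[OF f uc as(2)] u(2) by (simp only:)
    then have "u \<otimes> a = \<zero>" using nzd[OF m_closed[OF uc as(2)]] by blast
    then show ?thesis using as u fr_eq_zero by blast
  qed
  have r1: "\<exists>c\<in>carrier Q. x = fr f \<one> \<otimes>\<^bsub>Q\<^esub> c"
    if x: "x \<in> carrier Q" "y \<in> carrier Q" "fr g \<one> \<otimes>\<^bsub>Q\<^esub> x = fr f \<one> \<otimes>\<^bsub>Q\<^esub> y" for x y
  proof -
    obtain a s where as: "x = fr a s" "a \<in> carrier R" "s \<in> carrier R - m" using frE[OF x(1)] .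
    obtain b t where bt: "y = fr b t" "b \<in> carrier R" "t \<in> carrier R - m" using frE[OF x(2)] .
    have [simp]: "s \<in> carrier R" "t \<in> carrier R" using as bt by auto
    have "fr (g \<otimes> a) s = fr (f \<otimes> b) t" using x(3) as bt f g S_one by simp
    then obtain u where u: "u \<in> carrier R - m" "u \<otimes> (t \<otimes> (g \<otimes> a)) = u \<otimes> (s \<otimes> (f \<otimes> b))"
      using fr_eq_iff as bt f g by auto
    have [simp]: "u \<in> carrier R" using u by auto
    \<comment> \<open>Clearing all denominators turns the relation between fractions into one to
      which \<open>reg\<close> applies.\<close>
    have "f \<otimes> (u \<otimes> (s \<otimes> b)) = u \<otimes> (s \<otimes> (f \<otimes> b))" using f bt by (simp add: m_ac)
    also have "\<dots> = g \<otimes> (u \<otimes> (t \<otimes> a))" unfolding u(2)[symmetric] using g as by (simp add: m_ac)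
    finally obtain c where c: "c \<in> carrier R" "u \<otimes> (t \<otimes> a) = f \<otimes> c"
      using reg[of "u \<otimes> (s \<otimes> b)" "u \<otimes> (t \<otimes> a)"] as bt by auto
    have ut: "u \<otimes> t \<in> carrier R - m" "u \<otimes> t \<otimes> s \<in> carrier R - m"
      using u as bt S_mult by blast+
    have "x = fr (f \<otimes> c) (u \<otimes> t \<otimes> s)"
      unfolding c(2)[symmetric] using as ut fr_reduce[of a s "u \<otimes> t"] by (simp add: m_assoc)
    also have "\<dots> = fr f \<one> \<otimes>\<^bsub>Q\<^esub> fr c (u \<otimes> t \<otimes> s)"
      using f c ut S_one by simp
    finally show ?thesis using fr_carrier[OF c(1) ut(2)] by blast
  qed
  have sub: "{fr f \<one>, fr g \<one>} \<subseteq> carrier Q" using F G by blast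
  have "regular_sequence Q [fr f \<one>, fr g \<one>]"
    unfolding regular_sequence_def
  proof (intro conjI allI impI ballI)
    show "set [fr f \<one>, fr g \<one>] \<subseteq> carrier Q" using sub by simp
    have "Idl\<^bsub>Q\<^esub> {fr f \<one>, fr g \<one>} \<subseteq> extension m"
      using mem by (intro Q.genideal_minimal[OF e.is_ideal]) blast
    then show "Idl\<^bsub>Q\<^esub> set [fr f \<one>, fr g \<one>] \<noteq> carrier Q"
      using e.I_notcarr e.Icarr by auto
    fix i x assume i: "i < length [fr f \<one>, fr g \<one>]" and x: "x \<in> carrier Q"
      "[fr f \<one>, fr g \<one>] ! i \<otimes>\<^bsub>Q\<^esub> x \<in> Idl\<^bsub>Q\<^esub> set (take i [fr f \<one>, fr g \<one>])"
    consider "i = 0" | "i = 1" using i by fastforce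
    then show "x \<in> Idl\<^bsub>Q\<^esub> set (take i [fr f \<one>, fr g \<one>])"
    proof cases
      case 1
      then show ?thesis using x r0 by (simp add: Q.Idl_empty)
    next
      case 2
      then show ?thesis using x r1 F by (auto simp: Q.mem_Idl_singleton)
    qed
  qed
  then have "enat 2 \<le> depth Q (extension m)"
    unfolding depth_def using mem by (intro Sup_upper CollectI exI[of _ "[fr f \<one>, fr g \<one>]"]) auto
  moreover have "krull_dim Q \<le> enat 2"
  proof (rule krull_dim_Q_le)
    fix C assume C: "\<And>i. i \<le> Suc 2 \<Longrightarrow> primeideal (C i) R" "\<And>i. i < Suc 2 \<Longrightarrow> C i \<subset> C (Suc i)"
    show False by (rule dim[of C]) (rule C, simp)+
  qed
  moreover have "depth Q (extension m) \<le> krull_dim Q"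
    by (rule depth_le_krull_dim[OF cring_Q noetherian_Q[OF noetherian]])
  ultimately have "depth Q (extension m) = krull_dim Q"
    by (meson order.antisym order.trans)
  then show ?thesis
    unfolding cohen_macaulay_local_def Q_eq[symmetric]
    using maximal_ideals_Q cring_Q noetherian_Q[OF noetherian] by blast
qed

text \<open>
  The hypotheses say that \<open>z\<close> is annihilated by the maximal ideal modulo the non-zero-divisor \<open>a\<close>.
  For any other non-zero-divisor \<open>x\<close>, the element \<open>w\<close> with \<open>x z = a w\<close> is then annihilated modulo \<open>x\<close>,
  so no regular sequence has a second element.
\<close>

theorem not_cohen_macaulay_localI:
  assumes p: "primeideal p\<^sub>0 R" "primeideal p\<^sub>1 R" "p\<^sub>0 \<subset> p\<^sub>1" "p\<^sub>1 \<subset> m"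
    and az: "a \<in> carrier R" "z \<in> carrier R"
    and nzd: "\<And>b. \<lbrakk>b \<in> carrier R; a \<otimes> b = \<zero>\<rbrakk> \<Longrightarrow> b = \<zero>"
    and socle: "\<And>c. c \<in> m \<Longrightarrow> \<exists>b\<in>carrier R. c \<otimes> z = a \<otimes> b"
    and notin: "\<And>s b. \<lbrakk>s \<in> carrier R - m; b \<in> carrier R\<rbrakk> \<Longrightarrow> s \<otimes> z \<noteq> a \<otimes> b"
  shows "\<not> cohen_macaulay_local (localization_at R m)"
proof
  assume "cohen_macaulay_local (localization_at R m)"
  then have CM: "depth Q (extension m) = krull_dim Q"
    unfolding cohen_macaulay_local_def Q_eq[symmetric] maximal_ideals_Q by auto
  interpret m: primeideal m R by (rule prime_m)
  interpret Q: cring Q by (rule cring_Q)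
  interpret e: primeideal "extension m" Q by (rule extension_prime[OF prime_m]) blast
  have disj: "p\<^sub>0 \<inter> (carrier R - m) = {}" "p\<^sub>1 \<inter> (carrier R - m) = {}" "m \<inter> (carrier R - m) = {}"
    using p by blast+
  note ext = extension_prime[OF p(1) disj(1)] extension_prime[OF p(2) disj(2)]
    extension_prime[OF prime_m disj(3)]
  define C where "C = (\<lambda>i::nat. if i = 0 then extension p\<^sub>0 else if i = 1 then extension p\<^sub>1 else extension m)"
  have strict: "extension I \<subset> extension J"
    if "primeideal (extension I) Q" "primeideal (extension J) Q"
      "contraction (extension I) = I" "contraction (extension J) = J" "I \<subset> J" for I J
    using that contraction_subset_iff[of "extension I" "extension J"]
      contraction_subset_iff[of "extension J" "extension I"] primeideal.axioms(1) by blast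
  \<comment> \<open>A chain of three primes gives dimension at least two, so equality with the depth
    supplies a regular sequence of at least two terms.\<close>
  have "enat 2 \<le> krull_dim Q"
    unfolding krull_dim_def
  proof (intro Sup_upper CollectI exI[of _ 2] exI[of _ C] conjI allI impI refl)
    show "primeideal (C i) Q" for i using ext by (simp add: C_def)
    show "C i \<subset> C (Suc i)" if "i < 2" for i
    proof -
      consider "i = 0" | "i = 1" using \<open>i < 2\<close> by linarith
      then show ?thesis
        using strict[OF ext(1,3,2,4) p(3)] strict[OF ext(3,5,4,6) p(4)] by cases (simp_all add: C_def)
    qed
  qed
  then have "1 < depth Q (extension m)"
    unfolding CM using less_le_trans[of 1 "enat 2"] by (simp add: one_enat_def)
  then obtain xs where xs: "set xs \<subseteq> extension m" "regular_sequence Q xs" "1 < length xs"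
    unfolding depth_def less_Sup_iff by (auto simp: one_enat_def)
  define x where "x = xs ! 0"
  define y where "y = xs ! 1"
  have "x \<in> set xs" "y \<in> set xs"
    using xs(3) nth_mem[of 0 xs] nth_mem[of 1 xs] unfolding x_def y_def by linarith+
  then have xy: "x \<in> extension m" "y \<in> extension m"
    using xs(1) by blast+
  then have xyc: "x \<in> carrier Q" "y \<in> carrier Q" using e.Icarr by blast+
  have take: "set (take 0 xs) = {}" "set (take 1 xs) = {x}"
    using xs(3) by (cases xs; auto simp: x_def)+
  have reg: "c \<in> Idl\<^bsub>Q\<^esub> set (take i xs)"
    if "i < length xs" "c \<in> carrier Q" "xs ! i \<otimes>\<^bsub>Q\<^esub> c \<in> Idl\<^bsub>Q\<^esub> set (take i xs)" for i c
    using xs(2) that unfolding regular_sequence_def by blast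
  have rx: "c = \<zero>\<^bsub>Q\<^esub>" if "c \<in> carrier Q" "x \<otimes>\<^bsub>Q\<^esub> c = \<zero>\<^bsub>Q\<^esub>" for c
    using reg[of 0 c] xs(3) that unfolding take x_def[symmetric] Q.Idl_empty
    by (cases xs) auto
  have ry: "\<exists>d\<in>carrier Q. c = x \<otimes>\<^bsub>Q\<^esub> d"
    if "c \<in> carrier Q" "d \<in> carrier Q" "y \<otimes>\<^bsub>Q\<^esub> c = x \<otimes>\<^bsub>Q\<^esub> d" for c d
    using reg[of 1 c] xs(3) that unfolding take y_def[symmetric] Q.mem_Idl_singleton[OF xyc(1)]
    by blast
  define \<alpha> where "\<alpha> = fr a \<one>"
  define \<zeta> where "\<zeta> = fr z \<one>"
  have c: "\<alpha> \<in> carrier Q" "\<zeta> \<in> carrier Q" unfolding \<alpha>_def \<zeta>_def using az S_one by auto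
  have nzdQ: "b = \<zero>\<^bsub>Q\<^esub>" if b: "b \<in> carrier Q" "\<alpha> \<otimes>\<^bsub>Q\<^esub> b = \<zero>\<^bsub>Q\<^esub>" for b
  proof -
    obtain d s where ds: "b = fr d s" "d \<in> carrier R" "s \<in> carrier R - m" using frE[OF b(1)] .
    then have "fr (a \<otimes> d) s = \<zero>\<^bsub>Q\<^esub>" using b(2) az S_one by (simp add: \<alpha>_def)
    then obtain u where u: "u \<in> carrier R - m" "u \<otimes> (a \<otimes> d) = \<zero>"
      using fr_eq_zero ds az by auto
    have uc: "u \<in> carrier R" using u by blast
    have "a \<otimes> (u \<otimes> d) = \<zero>" using m_lcomm[OF az(1) uc ds(2)] u(2) by (simp only:)
    then have "u \<otimes> d = \<zero>" using nzd[OF m_closed[OF uc ds(2)]] by blast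
    then show ?thesis using ds u fr_eq_zero by blast
  qed
  have cancel: "b = b'" if "b \<in> carrier Q" "b' \<in> carrier Q" "w \<in> carrier Q" "w \<otimes>\<^bsub>Q\<^esub> b = w \<otimes>\<^bsub>Q\<^esub> b'"
    "\<And>c. c \<in> carrier Q \<Longrightarrow> w \<otimes>\<^bsub>Q\<^esub> c = \<zero>\<^bsub>Q\<^esub> \<Longrightarrow> c = \<zero>\<^bsub>Q\<^esub>" for b b' w
  proof -
    have "w \<otimes>\<^bsub>Q\<^esub> (b \<ominus>\<^bsub>Q\<^esub> b') = \<zero>\<^bsub>Q\<^esub>"
      using that(1-4) by (simp add: Q.minus_eq Q.r_distr Q.r_minus Q.r_neg)
    then have "b \<ominus>\<^bsub>Q\<^esub> b' = \<zero>\<^bsub>Q\<^esub>" using that by simp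
    then show ?thesis using that by simp
  qed
  have socleQ: "\<exists>b\<in>carrier Q. c \<otimes>\<^bsub>Q\<^esub> \<zeta> = \<alpha> \<otimes>\<^bsub>Q\<^esub> b" if cm: "c \<in> extension m" for c
  proof -
    obtain d s where ds: "c = fr d s" "d \<in> m" "s \<in> carrier R - m"
      using cm unfolding extension_def by blast
    obtain b where b: "b \<in> carrier R" "d \<otimes> z = a \<otimes> b" using socle[OF ds(2)] by blast
    have "c \<otimes>\<^bsub>Q\<^esub> \<zeta> = \<alpha> \<otimes>\<^bsub>Q\<^esub> fr b s"
      using ds m.Icarr[OF ds(2)] b az S_one by (simp add: \<alpha>_def \<zeta>_def)
    then show ?thesis using fr_carrier[OF b(1) ds(3)] by blast
  qed
  have notinQ: "\<zeta> \<noteq> \<alpha> \<otimes>\<^bsub>Q\<^esub> b" if b: "b \<in> carrier Q" for b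
  proof
    assume eq: "\<zeta> = \<alpha> \<otimes>\<^bsub>Q\<^esub> b"
    obtain d s where ds: "b = fr d s" "d \<in> carrier R" "s \<in> carrier R - m" using frE[OF b] .
    then have sR: "s \<in> carrier R" by blast
    have "fr z \<one> = fr (a \<otimes> d) s" using eq ds az S_one by (simp add: \<alpha>_def \<zeta>_def)
    then obtain u where u: "u \<in> carrier R - m" "u \<otimes> (s \<otimes> z) = u \<otimes> (\<one> \<otimes> (a \<otimes> d))"
      using fr_eq_iff[of z \<one> "a \<otimes> d" s] ds az S_one by auto
    then have "(u \<otimes> s) \<otimes> z = a \<otimes> (u \<otimes> d)" using ds az sR by (simp add: m_ac)
    then show False using notin[OF S_mult[OF u(1) ds(3)]] u ds by auto
  qed
  \<comment> \<open>Computing the product of \<open>x\<close>, \<open>y\<close> and \<zeta> in two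
    orders and cancelling \<alpha> shows that \<open>y * w\<close> is a multiple of
    \<open>x\<close>, so \<open>w\<close> is one as well; cancelling \<open>x\<close> makes \<zeta>
    a multiple of \<alpha>.\<close>
  obtain w where w: "w \<in> carrier Q" "x \<otimes>\<^bsub>Q\<^esub> \<zeta> = \<alpha> \<otimes>\<^bsub>Q\<^esub> w" using socleQ xy by blast
  obtain v where v: "v \<in> carrier Q" "y \<otimes>\<^bsub>Q\<^esub> \<zeta> = \<alpha> \<otimes>\<^bsub>Q\<^esub> v" using socleQ xy by blast
  have "\<alpha> \<otimes>\<^bsub>Q\<^esub> (y \<otimes>\<^bsub>Q\<^esub> w) = y \<otimes>\<^bsub>Q\<^esub> (x \<otimes>\<^bsub>Q\<^esub> \<zeta>)"
    unfolding w(2) using c w xyc by (intro Q.m_lcomm)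
  also have "\<dots> = x \<otimes>\<^bsub>Q\<^esub> (y \<otimes>\<^bsub>Q\<^esub> \<zeta>)" using c xyc by (intro Q.m_lcomm)
  also have "\<dots> = \<alpha> \<otimes>\<^bsub>Q\<^esub> (x \<otimes>\<^bsub>Q\<^esub> v)" unfolding v(2) using c v xyc by (intro Q.m_lcomm)
  finally have "y \<otimes>\<^bsub>Q\<^esub> w = x \<otimes>\<^bsub>Q\<^esub> v"
    using cancel[of "y \<otimes>\<^bsub>Q\<^esub> w" "x \<otimes>\<^bsub>Q\<^esub> v" \<alpha>] nzdQ c w v xyc by blast
  then obtain d where d: "d \<in> carrier Q" "w = x \<otimes>\<^bsub>Q\<^esub> d" using ry w v by blast
  have "x \<otimes>\<^bsub>Q\<^esub> \<zeta> = x \<otimes>\<^bsub>Q\<^esub> (\<alpha> \<otimes>\<^bsub>Q\<^esub> d)"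
    unfolding w(2) d(2) using c d xyc by (intro Q.m_lcomm)
  then have "\<zeta> = \<alpha> \<otimes>\<^bsub>Q\<^esub> d" using cancel[of \<zeta> "\<alpha> \<otimes>\<^bsub>Q\<^esub> d" x] rx c d xyc by blast
  then show False using notinQ d by blast
qed

end

section \<open>Polynomial rings in two variables\<close>

definition ideal_set :: "'a::comm_ring_1 set \<Rightarrow> bool" where
  "ideal_set J \<longleftrightarrow> 0 \<in> J \<and> (\<forall>a\<in>J. \<forall>b\<in>J. a + b \<in> J) \<and> (\<forall>r. \<forall>a\<in>J. r * a \<in> J)"

lemma ideal_setD:
  assumes "ideal_set J"
  shows "0 \<in> J" "a \<in> J \<Longrightarrow> b \<in> J \<Longrightarrow> a + b \<in> J" "a \<in> J \<Longrightarrow> r * a \<in> J"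
    "a \<in> J \<Longrightarrow> a * r \<in> J" "a \<in> J \<Longrightarrow> b \<in> J \<Longrightarrow> a - b \<in> J"
proof -
  show 1: "0 \<in> J" and 2: "a \<in> J \<Longrightarrow> b \<in> J \<Longrightarrow> a + b \<in> J" and 3: "a \<in> J \<Longrightarrow> r * a \<in> J" for a b r
    using assms by (auto simp: ideal_set_def)
  show "a \<in> J \<Longrightarrow> a * r \<in> J" using 3[of a r] by (simp only: mult.commute)
  show "a \<in> J \<Longrightarrow> b \<in> J \<Longrightarrow> a - b \<in> J" using 2[of a "- 1 * b"] 3[of b "-1"] by simp
qed

lemma ideal_set_Int: "ideal_set I \<Longrightarrow> ideal_set J \<Longrightarrow> ideal_set (I \<inter> J)"
  by (auto simp: ideal_set_def)

text \<open>Generation by \<open>B\<close> is expressed by minimality: every ideal containing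
  \<open>B\<close> contains \<open>J\<close>. This avoids linear combinations and can be applied
  directly to ideals of leading coefficients.\<close>

definition noetherian_type :: "'a::comm_ring_1 itself \<Rightarrow> bool" where
  "noetherian_type _ \<longleftrightarrow> (\<forall>J::'a set. ideal_set J \<longrightarrow>
     (\<exists>B\<subseteq>J. finite B \<and> (\<forall>J'. ideal_set J' \<longrightarrow> B \<subseteq> J' \<longrightarrow> J \<subseteq> J')))"

lemma noetherian_typeE:
  assumes "noetherian_type TYPE('a::comm_ring_1)" "ideal_set (J::'a set)"
  obtains B where "B \<subseteq> J" "finite B" "\<And>J'. ideal_set J' \<Longrightarrow> B \<subseteq> J' \<Longrightarrow> J \<subseteq> J'"
proof -
  have "\<exists>B\<subseteq>J. finite B \<and> (\<forall>J'. ideal_set J' \<longrightarrow> B \<subseteq> J' \<longrightarrow> J \<subseteq> J')"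
    using spec[OF assms(1)[unfolded noetherian_type_def], of J] assms(2) by (rule mp)
  then obtain B where "B \<subseteq> J" "finite B" "\<forall>J'. ideal_set J' \<longrightarrow> B \<subseteq> J' \<longrightarrow> J \<subseteq> J'"
    by (elim exE conjE)
  then show thesis by (intro that[of B]) simp_all
qed

lemma noetherian_type_field: "noetherian_type TYPE('k::field)"
  unfolding noetherian_type_def
proof (intro allI impI)
  fix J :: "'k set" assume J: "ideal_set J"
  show "\<exists>B\<subseteq>J. finite B \<and> (\<forall>J'. ideal_set J' \<longrightarrow> B \<subseteq> J' \<longrightarrow> J \<subseteq> J')"
  proof (cases "J \<subseteq> {0}")
    case True
    then show ?thesis by (intro exI[of _ "{}"]) (auto simp: ideal_set_def)
  next
    case False
    then obtain a where a: "a \<in> J" "a \<noteq> 0" by blast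
    have "x \<in> J'" if "ideal_set J'" "a \<in> J'" for x J'
      using ideal_setD(3)[OF that, of "x / a"] a by simp
    then show ?thesis using a by (intro exI[of _ "{a}"]) auto
  qed
qed

definition leading_coeffs :: "nat \<Rightarrow> 'a::comm_ring_1 poly set \<Rightarrow> 'a set" where
  "leading_coeffs n J = {coeff p n | p. p \<in> J \<and> degree p \<le> n}"

lemma leading_coeffs_ideal:
  assumes "ideal_set J"
  shows "ideal_set (leading_coeffs n J)"
  unfolding ideal_set_def
proof (intro conjI ballI allI)
  show "0 \<in> leading_coeffs n J"
    unfolding leading_coeffs_def using ideal_setD(1)[OF assms] by force
  fix a assume "a \<in> leading_coeffs n J"
  then obtain p where p: "a = coeff p n" "p \<in> J" "degree p \<le> n"
    unfolding leading_coeffs_def by blast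
  show "r * a \<in> leading_coeffs n J" for r
  proof -
    have "smult r p \<in> J" using ideal_setD(3)[OF assms p(2), of "[:r:]"] by simp
    moreover have "degree (smult r p) \<le> n" using degree_smult_le[of r p] p(3) by simp
    ultimately show ?thesis
      unfolding leading_coeffs_def p(1) coeff_smult[symmetric] by blast
  qed
  fix b assume "b \<in> leading_coeffs n J"
  then obtain q where q: "b = coeff q n" "q \<in> J" "degree q \<le> n"
    unfolding leading_coeffs_def by blast
  have "p + q \<in> J" "degree (p + q) \<le> n"
    using ideal_setD(2)[OF assms p(2) q(2)] degree_add_le[OF p(3) q(3)] by blast+
  then show "a + b \<in> leading_coeffs n J"
    unfolding leading_coeffs_def p(1) q(1) coeff_add[symmetric] by blast
qed

lemma leading_coeffs_mono:
  assumes "ideal_set J" "m \<le> n"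
  shows "leading_coeffs m J \<subseteq> leading_coeffs n J"
  using assms(2)
proof (induction n rule: dec_induct)
  case (step n)
  have "leading_coeffs n J \<subseteq> leading_coeffs (Suc n) J"
    unfolding leading_coeffs_def
  proof clarify
    fix p assume p: "p \<in> J" "degree p \<le> n"
    then show "\<exists>q. coeff p n = coeff q (Suc n) \<and> q \<in> J \<and> degree q \<le> Suc n"
      using ideal_setD(3)[OF assms(1) p(1), of "[:0, 1:]"] degree_pCons_le[of 0 p]
      by (intro exI[of _ "pCons 0 p"]) auto
  qed
  with step.IH show ?case by blast
qed simp

text \<open>The ideals of leading coefficients increase with the degree; as their union is finitely
  generated, they are constant from some \<open>n0\<close> on. Lifts of generators in the degrees up
  to \<open>n0\<close> generate \<open>J\<close>: leading terms are cancelled by induction on the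
  degree.\<close>

theorem hilbert_basis:
  assumes noeth: "noetherian_type TYPE('a::comm_ring_1)"
  shows "noetherian_type TYPE('a poly)"
  unfolding noetherian_type_def
proof (intro allI impI)
  fix J :: "'a poly set" assume J: "ideal_set J"
  let ?L = "\<lambda>n. leading_coeffs n J"
  have "ideal_set (\<Union>n. ?L n)"
    unfolding ideal_set_def
  proof (intro conjI ballI allI)
    show "0 \<in> (\<Union>n. ?L n)" using ideal_setD(1)[OF leading_coeffs_ideal[OF J]] by blast
    show "r * a \<in> (\<Union>n. ?L n)" if "a \<in> (\<Union>n. ?L n)" for a r
      using that ideal_setD(3)[OF leading_coeffs_ideal[OF J]] by blast
    fix a b assume "a \<in> (\<Union>n. ?L n)" "b \<in> (\<Union>n. ?L n)"
    then obtain m n where "a \<in> ?L m" "b \<in> ?L n" by blast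
    then have "a \<in> ?L (max m n)" "b \<in> ?L (max m n)"
      using leading_coeffs_mono[OF J] max.cobounded1 max.cobounded2 by blast+
    then show "a + b \<in> (\<Union>n. ?L n)" using ideal_setD(2)[OF leading_coeffs_ideal[OF J]] by blast
  qed
  from noetherian_typeE[OF noeth this] obtain B where B: "B \<subseteq> (\<Union>n. ?L n)" "finite B"
    "\<And>J'. ideal_set J' \<Longrightarrow> B \<subseteq> J' \<Longrightarrow> (\<Union>n. ?L n) \<subseteq> J'" by blast
  have "\<exists>n0. B \<subseteq> ?L n0"
    using B(2,1)
  proof (induction B)
    case (insert b B)
    then obtain m n where "B \<subseteq> ?L m" "b \<in> ?L n" by auto
    then have "insert b B \<subseteq> ?L (max m n)"
      using leading_coeffs_mono[OF J, of m "max m n"] leading_coeffs_mono[OF J, of n "max m n"] by auto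
    then show ?case by blast
  qed auto
  then obtain n0 where "B \<subseteq> ?L n0" by blast
  then have stable: "?L n \<subseteq> ?L n0" for n
    using B(3)[OF leading_coeffs_ideal[OF J]] by blast
  have "\<exists>G\<subseteq>J. finite G \<and> (\<forall>J'. ideal_set J' \<longrightarrow> G \<subseteq> J' \<longrightarrow> ?L n \<subseteq> leading_coeffs n J')" for n
  proof -
    obtain C where C: "C \<subseteq> ?L n" "finite C" "\<And>J'. ideal_set J' \<Longrightarrow> C \<subseteq> J' \<Longrightarrow> ?L n \<subseteq> J'"
      using noetherian_typeE[OF noeth leading_coeffs_ideal[OF J]] by blast
    then have "\<forall>c\<in>C. \<exists>p. c = coeff p n \<and> p \<in> J \<and> degree p \<le> n"
      unfolding leading_coeffs_def by blast
    then obtain l where l: "\<And>c. c \<in> C \<Longrightarrow> c = coeff (l c) n \<and> l c \<in> J \<and> degree (l c) \<le> n"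
      by metis
    have "?L n \<subseteq> leading_coeffs n J'" if J': "ideal_set J'" "l ` C \<subseteq> J'" for J'
    proof (rule C(3)[OF leading_coeffs_ideal[OF J'(1)]])
      show "C \<subseteq> leading_coeffs n J'"
        using l J'(2) unfolding leading_coeffs_def by blast
    qed
    then show ?thesis using C l by (intro exI[of _ "l ` C"]) auto
  qed
  then obtain G where G: "\<And>n. G n \<subseteq> J" "\<And>n. finite (G n)"
    "\<And>n J'. ideal_set J' \<Longrightarrow> G n \<subseteq> J' \<Longrightarrow> ?L n \<subseteq> leading_coeffs n J'" by metis
  have "J \<subseteq> J'" if J': "ideal_set J'" "(\<Union>n\<le>n0. G n) \<subseteq> J'" for J'
  proof -
    \<comment> \<open>Intersecting with \<open>J\<close> keeps the cancelling polynomial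
      \<open>q\<close> in both ideals, so \<open>p - q\<close> stays in \<open>J\<close> and the
      induction applies.\<close>
    have K: "ideal_set (J \<inter> J')" by (rule ideal_set_Int[OF J J'(1)])
    have sub: "?L n \<subseteq> leading_coeffs n (J \<inter> J')" for n
    proof (cases "n \<le> n0")
      case True
      then show ?thesis using G(3)[OF K, of n] G(1) J'(2) by blast
    next
      case False
      have "?L n \<subseteq> ?L n0" by (rule stable)
      also have "\<dots> \<subseteq> leading_coeffs n0 (J \<inter> J')" using G(3)[OF K, of n0] G(1) J'(2) by blast
      also have "\<dots> \<subseteq> leading_coeffs n (J \<inter> J')" using False by (intro leading_coeffs_mono[OF K]) simp
      finally show ?thesis .
    qed
    have "p \<in> J \<Longrightarrow> degree p \<le> n \<Longrightarrow> p \<in> J'" for p n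
    proof (induction n arbitrary: p rule: less_induct)
      case (less n)
      have "coeff p n \<in> ?L n" unfolding leading_coeffs_def using less.prems by blast
      then obtain q where q: "q \<in> J" "q \<in> J'" "degree q \<le> n" "coeff q n = coeff p n"
        using sub unfolding leading_coeffs_def by force
      have pq: "p - q \<in> J" using ideal_setD(5)[OF J] less.prems q by blast
      have "p - q \<in> J'"
      proof (cases "p - q = 0")
        case True
        then show ?thesis using ideal_setD(1)[OF J'(1)] by simp
      next
        case False
        have "degree (p - q) \<le> n" using less.prems q by (intro degree_diff_le)
        moreover have "degree (p - q) \<noteq> n" using False q(4)
          by (metis cancel_comm_monoid_add_class.diff_cancel coeff_diff leading_coeff_0_iff)
        ultimately show ?thesis using less.IH[of "degree (p - q)" "p - q"] pq by simp
      qed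
      then show "p \<in> J'" using ideal_setD(2)[OF J'(1) _ q(2), of "p - q"] by simp
    qed
    then show ?thesis by blast
  qed
  then show "\<exists>B\<subseteq>J. finite B \<and> (\<forall>J'. ideal_set J' \<longrightarrow> B \<subseteq> J' \<longrightarrow> J \<subseteq> J')"
    using G by (intro exI[of _ "\<Union>n\<le>n0. G n"]) auto
qed

definition submodule_set :: "('x \<Rightarrow> 'a::comm_ring_1) set \<Rightarrow> bool" where
  "submodule_set N \<longleftrightarrow> 0 \<in> N \<and> (\<forall>F\<in>N. \<forall>G\<in>N. F + G \<in> N) \<and> (\<forall>r. \<forall>F\<in>N. (\<lambda>x. r * F x) \<in> N)"

lemma submodule_setD:
  assumes "submodule_set N"
  shows "0 \<in> N" "F \<in> N \<Longrightarrow> G \<in> N \<Longrightarrow> F + G \<in> N" "F \<in> N \<Longrightarrow> (\<lambda>x. r * F x) \<in> N"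
    "F \<in> N \<Longrightarrow> G \<in> N \<Longrightarrow> F - G \<in> N"
proof -
  show 1: "0 \<in> N" "F \<in> N \<Longrightarrow> G \<in> N \<Longrightarrow> F + G \<in> N" "F \<in> N \<Longrightarrow> (\<lambda>x. r * F x) \<in> N" for F G r
    using assms by (auto simp: submodule_set_def)
  show "F \<in> N \<Longrightarrow> G \<in> N \<Longrightarrow> F - G \<in> N"
    using 1(2)[of F "\<lambda>x. - 1 * G x"] 1(3)[of G "-1"] by (simp add: plus_fun_def fun_diff_def)
qed

lemma submodule_set_eval:
  assumes "submodule_set N"
  shows "ideal_set ((\<lambda>F. F x) ` N)"
  unfolding ideal_set_def
proof (intro conjI ballI allI)
  show "0 \<in> (\<lambda>F. F x) ` N" using submodule_setD(1)[OF assms] by (intro image_eqI[of _ _ 0]) auto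
  fix a assume "a \<in> (\<lambda>F. F x) ` N"
  then obtain F where F: "F \<in> N" "a = F x" by blast
  show "r * a \<in> (\<lambda>F. F x) ` N" for r
    using submodule_setD(3)[OF assms F(1)] F(2) by (intro image_eqI[of _ _ "\<lambda>x. r * F x"]) auto
  fix b assume "b \<in> (\<lambda>F. F x) ` N"
  then obtain G where G: "G \<in> N" "b = G x" by blast
  show "a + b \<in> (\<lambda>F. F x) ` N"
    using submodule_setD(2)[OF assms F(1) G(1)] F(2) G(2) by (intro image_eqI[of _ _ "F + G"]) auto
qed

text \<open>Functions supported on \<open>S\<close> form a free module of finite rank. At a point
  \<open>y\<close> the submodule decomposes into its elements vanishing at \<open>y\<close> and its
  ideal of values at \<open>y\<close>; generators of the former and preimages of generators of the
  latter suffice.\<close>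

lemma finitely_generated_submodule:
  fixes N :: "('x \<Rightarrow> 'a::comm_ring_1) set"
  assumes noeth: "noetherian_type TYPE('a)"
    and "finite S" "submodule_set N" "\<And>F x. F \<in> N \<Longrightarrow> x \<notin> S \<Longrightarrow> F x = 0"
  shows "\<exists>B\<subseteq>N. finite B \<and> (\<forall>N'. submodule_set N' \<longrightarrow> B \<subseteq> N' \<longrightarrow> N \<subseteq> N')"
  using assms(2-)
proof (induction S arbitrary: N)
  case empty
  then have "N \<subseteq> {0}" by (auto simp: fun_eq_iff)
  then show ?case using submodule_setD(1) by (intro exI[of _ "{}"]) blast
next
  case (insert y S)
  define K where "K = {F \<in> N. F y = 0}"
  have "submodule_set K"
    using insert.prems(1) by (auto simp: K_def submodule_set_def)
  moreover have "F x = 0" if "F \<in> K" "x \<notin> S" for F x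
    using that insert.prems(2)[of F x] by (cases "x = y") (auto simp: K_def)
  ultimately obtain B where B: "B \<subseteq> K" "finite B" "\<And>N'. submodule_set N' \<Longrightarrow> B \<subseteq> N' \<Longrightarrow> K \<subseteq> N'"
    using insert.IH[of K] by blast
  obtain C where C: "C \<subseteq> (\<lambda>F. F y) ` N" "finite C"
      "\<And>J'. ideal_set J' \<Longrightarrow> C \<subseteq> J' \<Longrightarrow> (\<lambda>F. F y) ` N \<subseteq> J'"
    using noetherian_typeE[OF noeth submodule_set_eval[OF insert.prems(1)]] by blast
  obtain D where D: "D \<subseteq> N" "finite D" "C = (\<lambda>F. F y) ` D"
    using finite_subset_image[OF C(2,1)] by blast
  have "N \<subseteq> N'" if N': "submodule_set N'" "B \<union> D \<subseteq> N'" for N'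
  proof
    fix F assume F: "F \<in> N"
    have M: "submodule_set (N \<inter> N')" using N'(1) insert.prems(1) by (auto simp: submodule_set_def)
    have "(\<lambda>F. F y) ` N \<subseteq> (\<lambda>F. F y) ` (N \<inter> N')"
      using C(3)[OF submodule_set_eval[OF M]] D N' by blast
    then obtain G where G: "G \<in> N" "G \<in> N'" "F y = G y" using F by blast
    have "F - G \<in> K" using submodule_setD(4)[OF insert.prems(1) F G(1)] G(3) by (simp add: K_def)
    then have "F - G \<in> N'" using B(3)[OF N'(1)] N'(2) by blast
    then show "F \<in> N'" using submodule_setD(2)[OF N'(1) _ G(2), of "F - G"] by simp
  qed
  then show ?case using B D by (intro exI[of _ "B \<union> D"]) (auto simp: K_def)
qed

section \<open>Linear systems and algebraic dependence of three elements\<close>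

lemma nontrivial_solution:
  fixes M :: "'i \<Rightarrow> 'j \<Rightarrow> 'k::field"
  assumes "finite J" "finite I" "card J < card I"
  shows "\<exists>c. (\<exists>i\<in>I. c i \<noteq> 0) \<and> (\<forall>j\<in>J. (\<Sum>i\<in>I. c i * M i j) = 0)"
  using assms
proof (induction J arbitrary: I M)
  case empty
  then have "I \<noteq> {}" by auto
  then show ?case by (intro exI[of _ "\<lambda>_. 1"]) auto
next
  case (insert y J)
  show ?case
  proof (cases "\<forall>i\<in>I. M i y = 0")
    case True
    obtain c where "\<exists>i\<in>I. c i \<noteq> 0" "\<forall>j\<in>J. (\<Sum>i\<in>I. c i * M i j) = 0"
      using insert.IH[of I M] insert.prems insert.hyps by auto
    with True show ?thesis by (intro exI[of _ c]) auto
  next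
    case False
    then obtain p where p: "p \<in> I" "M p y \<noteq> 0" by blast
    \<comment> \<open>Gaussian elimination with pivot \<open>p\<close>: the modified coefficients
      vanish in column \<open>y\<close>, and \<open>d p\<close> below is chosen to undo the
      modification.\<close>
    define M' where "M' i j = M i j - M i y / M p y * M p j" for i j
    have "card J < card (I - {p})" using insert p by (simp add: card_Diff_singleton)
    then obtain c where c: "\<exists>i\<in>I - {p}. c i \<noteq> 0" "\<forall>j\<in>J. (\<Sum>i\<in>I - {p}. c i * M' i j) = 0"
      using insert.IH[of "I - {p}" M'] insert.prems by auto
    define d where "d = c(p := - (\<Sum>i\<in>I - {p}. c i * (M i y / M p y)))"
    have split: "(\<Sum>i\<in>I. d i * M i j) = (\<Sum>i\<in>I - {p}. c i * M' i j)" for j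
    proof -
      have "(\<Sum>i\<in>I. d i * M i j) = d p * M p j + (\<Sum>i\<in>I - {p}. d i * M i j)"
        using insert.prems p by (simp add: sum.remove)
      also have "(\<Sum>i\<in>I - {p}. d i * M i j) = (\<Sum>i\<in>I - {p}. c i * M i j)"
        by (rule sum.cong) (auto simp: d_def)
      finally show ?thesis
        by (simp add: d_def M'_def sum_distrib_right sum_subtractf right_diff_distrib mult.assoc)
    qed
    have "(\<Sum>i\<in>I. d i * M i y) = 0" unfolding split using p by (simp add: M'_def)
    moreover have "\<exists>i\<in>I. d i \<noteq> 0" using c(1) by (auto simp: d_def)
    ultimately show ?thesis using c(2) split by (intro exI[of _ d]) auto
  qed
qed

text \<open>A single bound for both variables, so that the coefficients to be killed fill a
  square.\<close>

definition bidegree_le :: "nat \<Rightarrow> 'a::comm_ring_1 poly poly \<Rightarrow> bool" where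
  "bidegree_le C p \<longleftrightarrow> (\<forall>i j. coeff (coeff p j) i \<noteq> 0 \<longrightarrow> i \<le> C \<and> j \<le> C)"

lemma coeff_coeff_mult:
  "coeff (coeff (p * q) j) i = (\<Sum>l\<le>j. \<Sum>m\<le>i. coeff (coeff p l) m * coeff (coeff q (j - l)) (i - m))"
  by (simp add: coeff_mult coeff_sum)

lemma bidegree_le_mult:
  assumes "bidegree_le C p" "bidegree_le D q"
  shows "bidegree_le (C + D) (p * q)"
  unfolding bidegree_le_def
proof (intro allI impI)
  fix i j assume "coeff (coeff (p * q) j) i \<noteq> 0"
  then obtain l where l: "l \<le> j" "(\<Sum>m\<le>i. coeff (coeff p l) m * coeff (coeff q (j - l)) (i - m)) \<noteq> 0"
    unfolding coeff_coeff_mult by (meson atMost_iff sum.not_neutral_contains_not_neutral)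
  then obtain m where m: "m \<le> i" "coeff (coeff p l) m * coeff (coeff q (j - l)) (i - m) \<noteq> 0"
    by (meson atMost_iff sum.not_neutral_contains_not_neutral)
  then have "coeff (coeff p l) m \<noteq> 0" "coeff (coeff q (j - l)) (i - m) \<noteq> 0" by auto
  then show "i \<le> C + D \<and> j \<le> C + D"
    using assms l(1) m(1) unfolding bidegree_le_def by fastforce
qed

lemma bidegree_le_power:
  assumes "bidegree_le C p"
  shows "bidegree_le (n * C) (p ^ n)"
proof (induction n)
  case 0
  show ?case by (auto simp: bidegree_le_def coeff_1 split: if_splits)
next
  case (Suc n)
  then show ?case using bidegree_le_mult[OF assms] by simp
qed

lemma bidegree_le_mono: "bidegree_le C p \<Longrightarrow> C \<le> D \<Longrightarrow> bidegree_le D p"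
  unfolding bidegree_le_def by (meson order.trans)

lemma ex_bidegree_le: "\<exists>C. bidegree_le C p"
proof (intro exI)
  define S where "S = (\<lambda>j. degree (coeff p j)) ` {..degree p}"
  have "i \<le> degree p + Max S \<and> j \<le> degree p + Max S" if "coeff (coeff p j) i \<noteq> 0" for i j
  proof -
    have "coeff p j \<noteq> 0" using that by auto
    then have j: "j \<le> degree p" by (rule le_degree)
    have "i \<le> degree (coeff p j)" using that by (rule le_degree)
    also have "\<dots> \<le> Max S" unfolding S_def using j by (intro Max_ge) auto
    finally show ?thesis using j by simp
  qed
  then show "bidegree_le (degree p + Max S) p" unfolding bidegree_le_def by blast
qed

text \<open>The number of monomials in \<open>F\<close>, \<open>G\<close>, \<open>H\<close> with
  exponents up to \<open>D\<close> grows like the cube of \<open>D\<close>, the number of their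
  coefficients at the points of \<open>E\<close> like the square. So there is a relation whose
  scalar coefficients are common to all points. This is the source of the bound two for the
  dimension.\<close>

lemma algebraic_dependence:
  fixes F G H :: "'x \<Rightarrow> 'k::field poly poly"
  assumes "finite E"
  shows "\<exists>D c. (\<exists>i\<le>D. \<exists>j\<le>D. \<exists>l\<le>D. c i j l \<noteq> 0) \<and>
    (\<forall>x\<in>E. (\<Sum>i\<le>D. \<Sum>j\<le>D. \<Sum>l\<le>D. [:[:c i j l:]:] * (F x ^ i * G x ^ j * H x ^ l)) = 0)"
proof -
  have "\<exists>C. \<forall>x. x \<in> E \<longrightarrow> bidegree_le C (F x) \<and> bidegree_le C (G x) \<and> bidegree_le C (H x)"
    using assms
  proof (induction E)
    case (insert y E)
    then obtain C where C: "\<And>x. x \<in> E \<Longrightarrow> bidegree_le C (F x) \<and> bidegree_le C (G x) \<and> bidegree_le C (H x)"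
      by blast
    obtain C1 C2 C3 where C': "bidegree_le C1 (F y)" "bidegree_le C2 (G y)" "bidegree_le C3 (H y)"
      using ex_bidegree_le by metis
    show ?case
    proof (intro exI[of _ "C + C1 + C2 + C3"] allI impI)
      fix x assume "x \<in> insert y E"
      then show "bidegree_le (C + C1 + C2 + C3) (F x) \<and> bidegree_le (C + C1 + C2 + C3) (G x) \<and>
          bidegree_le (C + C1 + C2 + C3) (H x)"
        using C' C[of x] by (auto elim!: bidegree_le_mono)
    qed
  qed simp
  then obtain C where C: "\<And>x. x \<in> E \<Longrightarrow> bidegree_le C (F x) \<and> bidegree_le C (G x) \<and> bidegree_le C (H x)"
    by blast
  define M where "M = 3 * C"
  \<comment> \<open>With this choice |E| (D M + 1)^2 is at most |E| (M + 1)^2 (D + 1)^2 = D (D +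
    1)^2, which is less than (D + 1)^3.\<close>
  define D where "D = card E * (M + 1)\<^sup>2"
  define I where "I = {..D} \<times> {..D} \<times> {..D}"
  define J where "J = E \<times> {..D * M} \<times> {..D * M}"
  define P where "P = (\<lambda>(i, j, l) x. F x ^ i * G x ^ j * H x ^ l)"
  have "card J = card E * (D * M + 1)\<^sup>2"
    by (simp only: J_def card_cartesian_product card_atMost power2_eq_square Suc_eq_plus1)
  also have "\<dots> \<le> card E * ((M + 1) * (D + 1))\<^sup>2"
    by (intro mult_left_mono power_mono) (auto simp: algebra_simps)
  also have "\<dots> = D * (D + 1)\<^sup>2"
    by (simp only: power_mult_distrib mult.assoc[symmetric] D_def[symmetric])
  also have "\<dots> < (D + 1) ^ 3" by (simp add: power2_eq_square power3_eq_cube)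
  also have "\<dots> = card I" by (simp add: I_def power3_eq_cube)
  finally have "card J < card I" .
  moreover have "finite J" "finite I" using assms by (auto simp: I_def J_def)
  ultimately obtain c where c: "\<exists>t\<in>I. c t \<noteq> 0"
    "\<forall>y\<in>J. (\<Sum>t\<in>I. c t * (case y of (x, a, b) \<Rightarrow> coeff (coeff (P t x) b) a)) = 0"
    using nontrivial_solution[of J I "\<lambda>t (x, a, b). coeff (coeff (P t x) b) a"] by blast
  have "(\<Sum>i\<le>D. \<Sum>j\<le>D. \<Sum>l\<le>D. [:[:c (i, j, l):]:] * (F x ^ i * G x ^ j * H x ^ l)) = 0" if x: "x \<in> E" for x
  proof -
    have "(\<Sum>t\<in>I. [:[:c t:]:] * P t x) = 0"
    proof (intro poly_eqI)
      fix b a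
      have eq: "coeff (coeff (\<Sum>t\<in>I. [:[:c t:]:] * P t x) b) a = (\<Sum>t\<in>I. c t * coeff (coeff (P t x) b) a)"
        by (simp add: coeff_sum)
      show "coeff (coeff (\<Sum>t\<in>I. [:[:c t:]:] * P t x) b) a = coeff (coeff 0 b) a"
      proof (cases "a \<le> D * M \<and> b \<le> D * M")
        case True
        then show ?thesis using c(2) x unfolding eq by (force simp: J_def)
      next
        case False
        have "coeff (coeff (P t x) b) a = 0" if t: "t \<in> I" for t
        proof -
          obtain i j l where ijl: "t = (i, j, l)" "i \<le> D" "j \<le> D" "l \<le> D" using t by (auto simp: I_def)
          have "bidegree_le (i * C + j * C + l * C) (P t x)"
            unfolding P_def ijl(1) using C[OF x] by (auto intro!: bidegree_le_mult bidegree_le_power)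
          moreover have "i * C + j * C + l * C \<le> D * C + D * C + D * C"
            using ijl by (intro add_mono mult_right_mono) auto
          then have "i * C + j * C + l * C \<le> D * M" unfolding M_def by simp
          ultimately have "bidegree_le (D * M) (P t x)" by (rule bidegree_le_mono)
          then show ?thesis using False unfolding bidegree_le_def by blast
        qed
        then show ?thesis unfolding eq by simp
      qed
    qed
    then show ?thesis by (simp add: I_def P_def sum.cartesian_product case_prod_unfold)
  qed
  moreover have "\<exists>i\<le>D. \<exists>j\<le>D. \<exists>l\<le>D. c (i, j, l) \<noteq> 0" using c(1) by (auto simp: I_def)
  ultimately show ?thesis by (intro exI[of _ D] exI[of _ "\<lambda>i j l. c (i, j, l)"]) auto
qed

text \<open>
  Pseudo-division by an element of least degree in the second variable shows that, if no nonzero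
  polynomial in the first variable lay in the ideal, then \<open>1 + x * h\<close>, where \<open>h\<close> is the leading
  coefficient of that element, would divide a power of \<open>h\<close>.
\<close>

lemma zariski_two_variables:
  fixes J :: "'k::field poly poly set"
  assumes J: "ideal_set J" and one: "1 \<notin> J"
    and inverse: "\<And>c. c \<notin> J \<Longrightarrow> \<exists>b. c * b - 1 \<in> J"
  shows "\<exists>f. f \<noteq> 0 \<and> [:f:] \<in> J"
proof (rule ccontr)
  assume no: "\<not> ?thesis"
  define s :: "'k poly" where "s = [:0, 1:]"
  have "s \<noteq> 0" by (simp add: s_def)
  then have "[:s:] \<notin> J" using no by blast
  then obtain b where b: "[:s:] * b - 1 \<in> J" using inverse by blast
  have "[:s:] * b - 1 \<noteq> 0"
  proof
    assume "[:s:] * b - 1 = 0"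
    then have "coeff ([:s:] * b) 0 = 1" by simp
    then have "s * coeff b 0 = 1" by simp
    then have "coeff (s * coeff b 0) 0 = 1" by simp
    then show False by (simp add: s_def)
  qed
  with b have ex: "\<exists>n p. p \<in> J \<and> p \<noteq> 0 \<and> degree p = n" by blast
  define n where "n = (LEAST n. \<exists>p. p \<in> J \<and> p \<noteq> 0 \<and> degree p = n)"
  obtain p where p: "p \<in> J" "p \<noteq> 0" "degree p = n" using LeastI_ex[OF ex] unfolding n_def by blast
  have minimal: "r = 0" if "r \<in> J" "degree r < n" for r
    using not_less_Least[of "degree r" "\<lambda>n. \<exists>p. p \<in> J \<and> p \<noteq> 0 \<and> degree p = n"] that
    unfolding n_def by blast
  have "n \<noteq> 0"
  proof
    assume "n = 0"
    then obtain f where "p = [:f:]" using p(3) by (auto elim: degree_eq_zeroE)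
    then show False using p no by auto
  qed
  define h where "h = lead_coeff p"
  have h: "h \<noteq> 0" using p leading_coeff_neq_0 unfolding h_def by blast
  \<comment> \<open>The polynomial \<open>1 + s * h\<close> is coprime to \<open>h\<close> and of
    positive degree, so it cannot divide a power of \<open>h\<close>.\<close>
  define c where "c = 1 + s * h"
  have deg_c: "degree c = Suc (degree h)"
  proof -
    have "degree (s * h) = Suc (degree h)" using h by (simp add: s_def)
    then show ?thesis unfolding c_def using degree_add_eq_right[of 1 "s * h"] by simp
  qed
  then have "c \<noteq> 0" by auto
  then have "[:c:] \<notin> J" using no by blast
  then obtain b where b: "[:c:] * b - 1 \<in> J" using inverse by blast
  obtain q r where qr: "pseudo_divmod b p = (q, r)" by fastforce
  define e where "e = Suc (degree b) - degree p"
  from pseudo_divmod[OF p(2) qr] have div: "smult (h ^ e) b = p * q + r" "r = 0 \<or> degree r < degree p"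
    by (simp_all add: h_def e_def)
  \<comment> \<open>Modulo \<open>J\<close> the element \<open>p\<close> is zero and
    \<open>b\<close> is an inverse of \<open>[:c:]\<close>, so pseudo-division makes
    \<open>[:c:] * r\<close> congruent to \<open>[:h ^ e:]\<close>. The difference has degree below
    \<open>n\<close> in the outer variable and is therefore zero.\<close>
  have "\<alpha> * r - \<beta> = \<beta> * (\<alpha> * b - 1) - (\<alpha> * q) * p" if "r = \<beta> * b - p * q" for \<alpha> \<beta>
    unfolding that by (simp add: algebra_simps)
  moreover have "r = [:h ^ e:] * b - p * q" using div(1) by simp
  ultimately have "[:c:] * r - [:h ^ e:] = [:h ^ e:] * ([:c:] * b - 1) - ([:c:] * q) * p"
    by blast
  also have "\<dots> \<in> J"
    by (rule ideal_setD(5)[OF J], rule ideal_setD(3)[OF J b], rule ideal_setD(3)[OF J p(1)])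
  finally have "[:c:] * r - [:h ^ e:] \<in> J" .
  moreover have "degree ([:c:] * r - [:h ^ e:]) < n"
  proof -
    have "degree ([:c:] * r) < n" using div(2) p(3) \<open>n \<noteq> 0\<close> degree_smult_le[of c r] by auto
    then show ?thesis using \<open>n \<noteq> 0\<close> by (intro degree_diff_less) auto
  qed
  ultimately have "[:c:] * r = [:h ^ e:]" using minimal by fastforce
  then have "coeff ([:c:] * r) 0 = h ^ e" by simp
  then have "c dvd h ^ e" by (auto intro: dvdI[of _ _ "coeff r 0"])
  moreover have "c dvd h ^ n \<Longrightarrow> is_unit c" for n
  proof (induction n)
    case (Suc n)
    \<comment> \<open>Modulo \<open>c\<close> the product \<open>s * h\<close> is -1, so
      \<open>h\<close> is invertible and its exponent can be lowered.\<close>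
    have "h ^ n = c * h ^ n - s * h ^ Suc n" by (simp add: c_def algebra_simps)
    moreover have "c dvd c * h ^ n - s * h ^ Suc n"
      by (rule dvd_diff[OF dvd_triv_left dvd_mult[OF Suc.prems]])
    ultimately show ?case using Suc.IH by (simp only:)
  qed simp
  ultimately have "is_unit c" by blast
  then show False using deg_c by (auto simp: is_unit_poly_iff)
qed

text \<open>Divisibility by \<open>[:f:]\<close> means divisibility of all coefficients. The outer
  variable merely shifts them, and a \<open>g\<close> with constant coefficient -1 is invertible as
  a power series, so the coefficients of \<open>b\<close> are recovered one by one from those of
  \<open>g * b\<close>.\<close>

lemma const_dvd_of_dvd_mult:
  fixes g b :: "'k::field poly poly"
  assumes "[:f:] dvd g * b" and g: "g = [:0, 1:] \<or> coeff g 0 = - 1"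
  shows "[:f:] dvd b"
proof -
  have dvd: "f dvd coeff (g * b) n" for n using assms(1) by (simp add: const_poly_dvd_iff)
  have "f dvd coeff b n" for n
  proof (cases "g = [:0, 1:]")
    case True
    then show ?thesis using dvd[of "Suc n"] by simp
  next
    case False
    with g have g0: "coeff g 0 = - 1" by blast
    show ?thesis
    proof (induction n rule: less_induct)
      case (less n)
      have "coeff (g * b) n = coeff g 0 * coeff b n + (\<Sum>l\<in>{..n} - {0}. coeff g l * coeff b (n - l))"
        unfolding coeff_mult by (subst sum.remove[of _ 0]) auto
      then have "coeff b n = (\<Sum>l\<in>{..n} - {0}. coeff g l * coeff b (n - l)) - coeff (g * b) n"
        using g0 by simp
      also have "f dvd \<dots>"
        using less by (intro dvd_diff dvd dvd_sum dvd_mult) auto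
      finally show ?case .
    qed
  qed
  then show ?thesis by (simp add: const_poly_dvd_iff)
qed

section \<open>Rings of graded functions\<close>

text \<open>
  A polynomial \<open>\<Sum> c\<^sub>i\<^sub>j s\<^sup>i u\<^sup>j\<close> is an element of type \<open>'k poly poly\<close> whose outer variable is \<open>u\<close>, so that
  \<open>c\<^sub>i\<^sub>j\<close> is \<open>coeff (coeff p j) i\<close>, \<open>s\<close> is \<open>[:[:0, 1:]:]\<close> and \<open>u\<close> is \<open>[:0, 1:]\<close>.
\<close>

definition graded_functions :: "'x set \<Rightarrow> (nat \<Rightarrow> nat \<Rightarrow> ('x \<Rightarrow> 'k::field) set) \<Rightarrow> ('x \<Rightarrow> 'k poly poly) set" where
  "graded_functions E V = {F. (\<forall>x. x \<notin> E \<longrightarrow> F x = 0) \<and>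
     (\<forall>i j. (\<lambda>x. coeff (coeff (F x) j) i) \<in> V i j)}"

text \<open>What the ring-theoretic argument uses about the quotient by the vanishing ideal,
  isolated from points and forms. \<open>V_Suc1\<close> and \<open>V_Suc2\<close> stand for
  multiplication by the two linear forms normalized to one, \<open>V_const\<close> makes the part of
  degree zero the base field, and stability bounds the degrees in which the spaces still grow. The
  isomorphism \<open>h\<close> is explicit because the elements of the quotient are cosets.\<close>

locale bigraded_ring = cring A for A (structure) +
  fixes E :: "'x set" and V :: "nat \<Rightarrow> nat \<Rightarrow> ('x \<Rightarrow> 'k::field) set"
    and h :: "'a \<Rightarrow> 'x \<Rightarrow> 'k poly poly" and K :: nat
  assumes finite_E: "finite E" and E_nonempty: "E \<noteq> {}"
    and V_off: "\<lbrakk>\<phi> \<in> V i j; x \<notin> E\<rbrakk> \<Longrightarrow> \<phi> x = 0"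
    and V_add: "\<lbrakk>\<phi> \<in> V i j; \<psi> \<in> V i j\<rbrakk> \<Longrightarrow> (\<lambda>x. \<phi> x + \<psi> x) \<in> V i j"
    and V_scale: "\<phi> \<in> V i j \<Longrightarrow> (\<lambda>x. c * \<phi> x) \<in> V i j"
    and V_one: "(\<lambda>x. if x \<in> E then 1 else 0) \<in> V 0 0"
    and V_const: "\<phi> \<in> V 0 0 \<Longrightarrow> \<exists>c. \<phi> = (\<lambda>x. if x \<in> E then c else 0)"
    and V_mult: "\<lbrakk>\<phi> \<in> V i j; \<psi> \<in> V k l\<rbrakk> \<Longrightarrow> (\<lambda>x. \<phi> x * \<psi> x) \<in> V (i + k) (j + l)"
    and V_Suc1: "V i j \<subseteq> V (Suc i) j" and V_Suc2: "V i j \<subseteq> V i (Suc j)"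
    and V_stable1: "K \<le> i \<Longrightarrow> V (Suc i) j \<subseteq> V i j"
    and V_stable2: "K \<le> j \<Longrightarrow> V i (Suc j) \<subseteq> V i j"
    and h_bij: "bij_betw h (carrier A) (graded_functions E V)"
    and h_mult: "\<lbrakk>a \<in> carrier A; b \<in> carrier A\<rbrakk> \<Longrightarrow> h (a \<otimes> b) = h a * h b"
    and h_add: "\<lbrakk>a \<in> carrier A; b \<in> carrier A\<rbrakk> \<Longrightarrow> h (a \<oplus> b) = h a + h b"
    and h_one: "h \<one> = (\<lambda>x. if x \<in> E then 1 else 0)"
begin

abbreviation S where "S \<equiv> graded_functions E V"

definition cst :: "'k poly poly \<Rightarrow> 'x \<Rightarrow> 'k poly poly" where
  "cst c = (\<lambda>x. if x \<in> E then c else 0)"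

lemma h_in [simp]: "a \<in> carrier A \<Longrightarrow> h a \<in> S"
  using h_bij by (auto simp: bij_betw_def)

lemma h_surj: "F \<in> S \<Longrightarrow> \<exists>a\<in>carrier A. F = h a"
  using h_bij unfolding bij_betw_def by blast

lemma h_inj: "\<lbrakk>a \<in> carrier A; b \<in> carrier A; h a = h b\<rbrakk> \<Longrightarrow> a = b"
  using h_bij by (auto simp: bij_betw_def inj_on_def)

lemma h_zero: "h \<zero> = 0"
  using h_add[of \<zero> \<zero>] by simp

lemma h_cst_one: "h \<one> = cst 1"
  by (simp add: h_one cst_def)

lemma S_off: "F \<in> S \<Longrightarrow> x \<notin> E \<Longrightarrow> F x = 0"
  by (simp add: graded_functions_def)

lemma S_mult: "F \<in> S \<Longrightarrow> G \<in> S \<Longrightarrow> F * G \<in> S"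
  using h_surj h_mult h_in m_closed by metis

lemma S_add: "F \<in> S \<Longrightarrow> G \<in> S \<Longrightarrow> F + G \<in> S"
  using h_surj h_add h_in a_closed by metis

lemma V_mono: "i \<le> k \<Longrightarrow> j \<le> l \<Longrightarrow> V i j \<subseteq> V k l"
proof -
  assume "i \<le> k" "j \<le> l"
  have "V i j \<subseteq> V k j" using \<open>i \<le> k\<close> by (induction rule: dec_induct) (use V_Suc1 in auto)
  also have "\<dots> \<subseteq> V k l" using \<open>j \<le> l\<close> by (induction rule: dec_induct) (use V_Suc2 in auto)
  finally show ?thesis .
qed

lemma V_zero: "(\<lambda>x. 0) \<in> V i j"
proof -
  have "(\<lambda>x. if x \<in> E then 1 else 0) \<in> V i j" using V_one V_mono[of 0 i 0 j] by auto
  from V_scale[OF this, of 0] show ?thesis by simp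
qed

lemma V_sum: "(\<And>t. t \<in> T \<Longrightarrow> \<phi> t \<in> V i j) \<Longrightarrow> (\<lambda>x. \<Sum>t\<in>T. \<phi> t x) \<in> V i j"
proof (induction T rule: infinite_finite_induct)
  case (insert t T)
  then show ?case using V_add[of "\<phi> t" i j "\<lambda>x. \<Sum>t\<in>T. \<phi> t x"] by simp
qed (use V_zero in simp_all)

lemma V_sub: "\<phi> \<in> V i j \<Longrightarrow> \<psi> \<in> V i j \<Longrightarrow> (\<lambda>x. \<phi> x - \<psi> x) \<in> V i j"
  using V_add[of \<phi> i j "\<lambda>x. -1 * \<psi> x"] V_scale[of \<psi> i j "-1"] by simp

lemma S_coeff: "F \<in> S \<Longrightarrow> (\<lambda>x. coeff (coeff (F x) j) i) \<in> V i j"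
  by (simp add: graded_functions_def)

lemma S_I: "(\<And>x. x \<notin> E \<Longrightarrow> F x = 0) \<Longrightarrow> (\<And>i j. (\<lambda>x. coeff (coeff (F x) j) i) \<in> V i j) \<Longrightarrow> F \<in> S"
  by (simp add: graded_functions_def)

lemma cst_in [simp]: "cst c \<in> S"
proof (rule S_I)
  fix i j
  have "(\<lambda>x. if x \<in> E then 1 else 0) \<in> V i j" using V_one V_mono[of 0 i 0 j] by auto
  from V_scale[OF this, of "coeff (coeff c j) i"]
  show "(\<lambda>x. coeff (coeff (cst c x) j) i) \<in> V i j"
    by (rule back_subst[of "\<lambda>f. f \<in> V i j"]) (auto simp: cst_def)
qed (simp add: cst_def)

lemma cst_mult: "F \<in> S \<Longrightarrow> cst c * F = (\<lambda>x. c * F x)"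
  by (auto simp: cst_def fun_eq_iff S_off)

lemma S_scale: "F \<in> S \<Longrightarrow> (\<lambda>x. c * F x) \<in> S"
  using S_mult[of "cst c" F] cst_mult by simp

lemma S_zero [simp]: "0 \<in> S"
  using h_in[OF zero_closed] h_zero by simp

lemma S_sub: "F \<in> S \<Longrightarrow> G \<in> S \<Longrightarrow> F - G \<in> S"
  using S_add[of F "\<lambda>x. -1 * G x"] S_scale[of G "-1"] by (simp add: plus_fun_def fun_diff_def)

lemma S_sum: "(\<And>t. t \<in> T \<Longrightarrow> F t \<in> S) \<Longrightarrow> (\<Sum>t\<in>T. F t) \<in> S"
  by (induction T rule: infinite_finite_induct) (auto intro: S_add)

lemma S_mult_power: "F \<in> S \<Longrightarrow> X \<in> S \<Longrightarrow> F * X ^ n \<in> S"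
proof (induction n)
  case (Suc n)
  then show ?case using S_mult[of "F * X ^ n" X] by (simp only: power_Suc2 mult.assoc)
qed simp

lemma mem_image_iff: "ideal J A \<Longrightarrow> a \<in> carrier A \<Longrightarrow> h a \<in> h ` J \<longleftrightarrow> a \<in> J"
  using h_inj ideal.Icarr by (metis image_iff)

lemma ideal_image:
  assumes "ideal J A"
  shows "h ` J \<subseteq> S" "0 \<in> h ` J" "F \<in> h ` J \<Longrightarrow> G \<in> h ` J \<Longrightarrow> F + G \<in> h ` J"
    "F \<in> h ` J \<Longrightarrow> G \<in> S \<Longrightarrow> G * F \<in> h ` J" "F \<in> h ` J \<Longrightarrow> (\<lambda>x. c * F x) \<in> h ` J"
    "F \<in> h ` J \<Longrightarrow> G \<in> h ` J \<Longrightarrow> F - G \<in> h ` J"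
proof -
  interpret J: ideal J A by fact
  show 1: "h ` J \<subseteq> S" using J.Icarr by auto
  show "0 \<in> h ` J"
    using additive_subgroup.zero_closed[OF J.is_additive_subgroup] h_zero by (metis image_eqI)
  show add: "F + G \<in> h ` J" if FG: "F \<in> h ` J" "G \<in> h ` J" for F G
  proof -
    obtain a b where ab: "F = h a" "a \<in> J" "G = h b" "b \<in> J" using FG by blast
    then have "F + G = h (a \<oplus> b)" using h_add J.Icarr by simp
    then show ?thesis using additive_subgroup.a_closed[OF J.is_additive_subgroup ab(2,4)] by blast
  qed
  show mult: "G * F \<in> h ` J" if FG: "F \<in> h ` J" "G \<in> S" for F G
  proof -
    obtain a where a: "F = h a" "a \<in> J" using FG by blast
    obtain b where b: "G = h b" "b \<in> carrier A" using h_surj[OF FG(2)] by blast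
    have "G * F = h (b \<otimes> a)" using a b h_mult J.Icarr by simp
    then show ?thesis using J.I_l_closed[OF a(2) b(2)] by blast
  qed
  show scale: "(\<lambda>x. c * F x) \<in> h ` J" if "F \<in> h ` J" for F c
  proof -
    have "cst c * F = (\<lambda>x. c * F x)" using that 1 by (intro cst_mult) blast
    then show ?thesis using mult[OF that cst_in, of c] by (simp only:)
  qed
  show "F - G \<in> h ` J" if "F \<in> h ` J" "G \<in> h ` J" for F G
    using add[OF that(1) scale[OF that(2), of "-1"]] by (simp add: plus_fun_def fun_diff_def)
qed

lemma prime_image:
  assumes "primeideal J A"
  shows "cst 1 \<notin> h ` J" "F \<in> S \<Longrightarrow> G \<in> S \<Longrightarrow> F * G \<in> h ` J \<Longrightarrow> F \<in> h ` J \<or> G \<in> h ` J"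
proof -
  interpret J: primeideal J A by fact
  have "\<one> \<notin> J" using J.one_imp_carrier J.I_notcarr by blast
  then show "cst 1 \<notin> h ` J" using mem_image_iff[OF J.is_ideal one_closed] h_cst_one by simp
  assume FG: "F \<in> S" "G \<in> S" "F * G \<in> h ` J"
  obtain a b where ab: "F = h a" "a \<in> carrier A" "G = h b" "b \<in> carrier A"
    using h_surj FG by metis
  then have "a \<otimes> b \<in> J" using FG(3) mem_image_iff[OF J.is_ideal, of "a \<otimes> b"] h_mult by simp
  then show "F \<in> h ` J \<or> G \<in> h ` J" using J.I_prime ab by blast
qed

text \<open>Through \<open>cst\<close> the ring contains k[s,u], so images of ideals are submodules
  of a free module of finite rank over a Noetherian ring; module generators also generate the
  ideal.\<close>

lemma noetherian: "noetherian_ring A"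
proof (rule noetherian_ringI)
  fix J assume J: "ideal J A"
  have sub: "submodule_set (h ` I)" if "ideal I A" for I
    using ideal_image[OF that] by (simp add: submodule_set_def)
  have noeth: "noetherian_type TYPE('k poly poly)"
    by (intro hilbert_basis noetherian_type_field)
  have off: "F x = 0" if "F \<in> h ` J" "x \<notin> E" for F x
    using S_off[OF _ that(2)] ideal_image(1)[OF J] that(1) by blast
  obtain B where B: "B \<subseteq> h ` J" "finite B" "\<forall>N'. submodule_set N' \<longrightarrow> B \<subseteq> N' \<longrightarrow> h ` J \<subseteq> N'"
    using finitely_generated_submodule[where N = "h ` J", OF noeth finite_E sub[OF J]] off by blast
  obtain C where C: "C \<subseteq> J" "finite C" "B = h ` C" using finite_subset_image[OF B(2,1)] by blast
  have Cc: "C \<subseteq> carrier A" using C(1) ideal.Icarr[OF J] by blast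
  have I: "ideal (Idl C) A" by (rule genideal_ideal[OF Cc])
  have "h ` J \<subseteq> h ` (Idl C)"
    using B(3)[rule_format, OF sub[OF I]] genideal_self[OF Cc] C(3) by blast
  then have "J \<subseteq> Idl C" using mem_image_iff[OF I] ideal.Icarr[OF J] by blast
  moreover have "Idl C \<subseteq> J" by (rule genideal_minimal[OF J C(1)])
  ultimately show "\<exists>C\<subseteq>carrier A. finite C \<and> J = Idl C" using Cc C(2) by blast
qed

text \<open>Since the first \<open>i0\<close> coefficients vanish, \<open>X ^ i0\<close> can be
  cancelled modulo the prime \<open>q\<close>, which does not contain \<open>X\<close>. In what
  remains all terms after \<open>P i0\<close> are multiples of \<open>X\<close>, an element of the
  larger prime.\<close>

lemma lowest_coefficient_mem:
  assumes q: "primeideal q A" and q': "primeideal q' A" and qq': "q \<subseteq> q'"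
    and X: "X \<in> h ` q'" "X \<notin> h ` q"
  shows "\<lbrakk>\<And>i. P i \<in> S; (\<Sum>i\<le>D. P i * X ^ i) \<in> h ` q; \<forall>i<i0. P i = 0; i0 \<le> D\<rbrakk> \<Longrightarrow> P i0 \<in> h ` q'"
proof (induction i0 arbitrary: P D)
  case 0
  note iq' = ideal_image[OF primeideal.axioms(1)[OF q']]
  have XS: "X \<in> S" using X iq'(1) by blast
  note pow = S_mult_power[OF _ XS]
  show ?case
  proof (cases D)
    case 0
    then show ?thesis using "0.prems"(2) qq' by auto
  next
    case (Suc D')
    define Z where "Z = (\<Sum>i\<le>D'. P (Suc i) * X ^ i)"
    have "Z \<in> S" unfolding Z_def using "0.prems"(1) by (intro S_sum pow) auto
    then have "Z * X \<in> h ` q'" using iq'(4)[OF X(1)] by blast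
    moreover have eq: "(\<Sum>i\<le>D. P i * X ^ i) = P 0 + Z * X"
      unfolding Suc Z_def
      by (simp add: sum.atMost_Suc_shift sum_distrib_right mult.assoc power_Suc2 del: power_Suc sum.atMost_Suc)
    have "P 0 + Z * X \<in> h ` q'" using "0.prems"(2)[unfolded eq] qq' by blast
    ultimately show ?thesis using iq'(6)[of "P 0 + Z * X" "Z * X"] by (simp only: add_diff_cancel_right')
  qed
next
  case (Suc i0)
  note iq' = ideal_image[OF primeideal.axioms(1)[OF q']]
  have XS: "X \<in> S" using X iq'(1) by blast
  note pow = S_mult_power[OF _ XS]
  obtain D' where D': "D = Suc D'" using Suc.prems(4) by (cases D) auto
  define Z where "Z = (\<Sum>i\<le>D'. P (Suc i) * X ^ i)"
  have ZS: "Z \<in> S" unfolding Z_def using Suc.prems(1) by (intro S_sum pow) auto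
  have eq: "(\<Sum>i\<le>D. P i * X ^ i) = P 0 + Z * X"
    unfolding D' Z_def
    by (simp add: sum.atMost_Suc_shift sum_distrib_right mult.assoc power_Suc2 del: power_Suc sum.atMost_Suc)
  have "P 0 = 0" using Suc.prems(3) by blast
  then have "Z * X \<in> h ` q" using Suc.prems(2)[unfolded eq] by (simp only: add_0_left)
  then have "Z \<in> h ` q" using prime_image(2)[OF q ZS XS] X(2) by blast
  moreover have "\<forall>i<i0. P (Suc i) = 0" using Suc.prems(3) by blast
  moreover have "i0 \<le> D'" using Suc.prems(4) D' by linarith
  ultimately show ?case
    using Suc.IH[of "\<lambda>i. P (Suc i)" D', OF Suc.prems(1)] unfolding Z_def by blast
qed

text \<open>
  Elements of successive differences of a chain of four primes would be algebraically dependent;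
  the lexicographically smallest monomial of the relation then gives a unit in the largest prime.
\<close>

lemma no_long_prime_chain:
  assumes prime: "\<And>i. i \<le> 3 \<Longrightarrow> primeideal (C i) A" and chain: "\<And>i. i < 3 \<Longrightarrow> C i \<subset> C (Suc i)"
  shows False
proof -
  have p: "primeideal (C 0) A" "primeideal (C 1) A" "primeideal (C 2) A" "primeideal (C 3) A"
    by (rule prime; simp)+
  have ch: "C 0 \<subset> C 1" "C 1 \<subset> C 2" "C 2 \<subset> C 3"
    using chain[of 0] chain[of 1] chain[of 2] by (simp_all add: numeral_2_eq_2 numeral_3_eq_3)
  have ex: "\<exists>F. F \<in> h ` q' \<and> F \<notin> h ` q" if "primeideal q A" "primeideal q' A" "q \<subset> q'" for q q'
  proof -
    obtain a where "a \<in> q'" "a \<notin> q" using \<open>q \<subset> q'\<close> by blast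
    then show ?thesis
      using mem_image_iff[OF primeideal.axioms(1)[OF that(1)]] ideal.Icarr[OF primeideal.axioms(1)[OF that(2)]]
      by blast
  qed
  obtain X Y Z where X: "X \<in> h ` C 1" "X \<notin> h ` C 0" and Y: "Y \<in> h ` C 2" "Y \<notin> h ` C 1"
    and Z: "Z \<in> h ` C 3" "Z \<notin> h ` C 2"
    using ex[OF p(1,2) ch(1)] ex[OF p(2,3) ch(2)] ex[OF p(3,4) ch(3)] by blast
  obtain D c where c: "\<exists>i\<le>D. \<exists>j\<le>D. \<exists>l\<le>D. c i j l \<noteq> 0"
    "\<forall>x\<in>E. (\<Sum>i\<le>D. \<Sum>j\<le>D. \<Sum>l\<le>D. [:[:c i j l:]:] * (X x ^ i * Y x ^ j * Z x ^ l)) = 0"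
    using algebraic_dependence[OF finite_E, of X Y Z] by blast
  have XS: "X \<in> S" "Y \<in> S" "Z \<in> S"
    using X Y Z ideal_image(1)[OF primeideal.axioms(1)] p by blast+
  note pow = S_mult_power
  define \<kappa> where "\<kappa> i j l = cst [:[:c i j l:]:]" for i j l
  define R where "R i j = (\<Sum>l\<le>D. \<kappa> i j l * Z ^ l)" for i j
  define P where "P i = (\<Sum>j\<le>D. R i j * Y ^ j)" for i
  have \<kappa>S: "\<kappa> i j l \<in> S" for i j l by (simp add: \<kappa>_def)
  have RS: "R i j \<in> S" for i j unfolding R_def using \<kappa>S XS by (intro S_sum pow)
  have PS: "P i \<in> S" for i unfolding P_def using RS XS by (intro S_sum pow)
  have eval_sum: "(\<Sum>i\<in>T. f i) x = (\<Sum>i\<in>T. f i x)" for T :: "nat set" and f :: "nat \<Rightarrow> 'x \<Rightarrow> 'k poly poly" and x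
    by (induction T rule: infinite_finite_induct) auto
  have eval_power: "(F ^ n) x = F x ^ n" for F :: "'x \<Rightarrow> 'k poly poly" and n x
    by (induction n) auto
  have rel: "(\<Sum>i\<le>D. P i * X ^ i) = 0"
  proof
    fix x
    show "(\<Sum>i\<le>D. P i * X ^ i) x = 0 x"
    proof (cases "x \<in> E")
      case True
      have "(\<Sum>i\<le>D. P i * X ^ i) x = (\<Sum>i\<le>D. \<Sum>j\<le>D. \<Sum>l\<le>D. [:[:c i j l:]:] * (X x ^ i * Y x ^ j * Z x ^ l))"
        using True by (simp add: P_def R_def \<kappa>_def cst_def eval_sum eval_power sum_distrib_right sum_distrib_left mult_ac
            del: pCons_0_0 mult_pCons_left)
      then show ?thesis using c(2) True by simp
    next
      case False
      have "P i x = 0" for i using S_off[OF PS False] .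
      then show ?thesis by (simp add: eval_sum)
    qed
  qed
  define i0 where "i0 = (LEAST i. i \<le> D \<and> (\<exists>j\<le>D. \<exists>l\<le>D. c i j l \<noteq> 0))"
  have i0: "i0 \<le> D" "\<exists>j\<le>D. \<exists>l\<le>D. c i0 j l \<noteq> 0"
    using LeastI_ex[of "\<lambda>i. i \<le> D \<and> (\<exists>j\<le>D. \<exists>l\<le>D. c i j l \<noteq> 0)"] c(1) unfolding i0_def by blast+
  have i0_less: "c i j l = 0" if "i < i0" "j \<le> D" "l \<le> D" for i j l
    using not_less_Least[of i "\<lambda>i. i \<le> D \<and> (\<exists>j\<le>D. \<exists>l\<le>D. c i j l \<noteq> 0)"] that i0(1) unfolding i0_def[symmetric]
    by (meson less_imp_le order.trans)
  define j0 where "j0 = (LEAST j. j \<le> D \<and> (\<exists>l\<le>D. c i0 j l \<noteq> 0))"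
  have j0: "j0 \<le> D" "\<exists>l\<le>D. c i0 j0 l \<noteq> 0"
    using LeastI_ex[of "\<lambda>j. j \<le> D \<and> (\<exists>l\<le>D. c i0 j l \<noteq> 0)"] i0 unfolding j0_def by blast+
  have j0_less: "c i0 j l = 0" if "j < j0" "l \<le> D" for j l
    using not_less_Least[of j "\<lambda>j. j \<le> D \<and> (\<exists>l\<le>D. c i0 j l \<noteq> 0)"] that j0(1) unfolding j0_def[symmetric]
    by (meson less_imp_le order.trans)
  define l0 where "l0 = (LEAST l. l \<le> D \<and> c i0 j0 l \<noteq> 0)"
  have l0: "l0 \<le> D" "c i0 j0 l0 \<noteq> 0"
    using LeastI_ex[of "\<lambda>l. l \<le> D \<and> c i0 j0 l \<noteq> 0"] j0 unfolding l0_def by blast+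
  have l0_less: "c i0 j0 l = 0" if "l < l0" for l
    using not_less_Least[of l "\<lambda>l. l \<le> D \<and> c i0 j0 l \<noteq> 0"] that l0(1) unfolding l0_def[symmetric]
    by (meson less_imp_le order.trans)
  have cst0: "cst 0 = 0" by (simp add: cst_def fun_eq_iff)
  \<comment> \<open>Each application strips one of \<open>X\<close>, \<open>Y\<close>,
    \<open>Z\<close> and moves up one prime; after three of them a nonzero scalar lies in
    \<open>C 3\<close>.\<close>
  have "P i0 \<in> h ` C 1"
  proof (rule lowest_coefficient_mem[OF p(1,2) _ X, of P D])
    show "(\<Sum>i\<le>D. P i * X ^ i) \<in> h ` C 0"
      unfolding rel by (rule ideal_image(2)[OF primeideal.axioms(1)[OF p(1)]])
    show "\<forall>i<i0. P i = 0"
      using i0_less by (simp add: P_def R_def \<kappa>_def cst0)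
  qed (use PS i0 ch in auto)
  then have "R i0 j0 \<in> h ` C 2"
    unfolding P_def
  proof (rule lowest_coefficient_mem[OF p(2,3) _ Y, of "R i0" D, rotated 2])
    show "\<forall>j<j0. R i0 j = 0"
      using j0_less by (simp add: R_def \<kappa>_def cst0)
  qed (use RS j0 ch in auto)
  then have "\<kappa> i0 j0 l0 \<in> h ` C 3"
    unfolding R_def
  proof (rule lowest_coefficient_mem[OF p(3,4) _ Z, of "\<kappa> i0 j0" D, rotated 2])
    show "\<forall>l<l0. \<kappa> i0 j0 l = 0"
      using l0_less by (simp add: \<kappa>_def cst0)
  qed (use \<kappa>S l0 ch in auto)
  then have "(\<lambda>x. [:[:inverse (c i0 j0 l0):]:] * \<kappa> i0 j0 l0 x) \<in> h ` C 3"
    by (rule ideal_image(5)[OF primeideal.axioms(1)[OF p(4)]])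
  moreover have "(\<lambda>x. [:[:inverse (c i0 j0 l0):]:] * \<kappa> i0 j0 l0 x) = cst 1"
    using l0(2) by (auto simp: \<kappa>_def cst_def fun_eq_iff one_pCons)
  ultimately show False using prime_image(1)[OF p(4)] by simp
qed

end

section \<open>The Cohen-Macaulay property at the maximal ideals\<close>

context bigraded_ring
begin

text \<open>The constant term of \<open>f\<close> is a unit, so each coefficient of \<open>F\<close>
  is computed from one of the product and from lower coefficients of \<open>F\<close>, which lie in
  smaller spaces.\<close>

lemma div_const:
  assumes f: "coeff f 0 \<noteq> 0" and off: "\<And>x. x \<notin> E \<Longrightarrow> F x = 0" and fF: "(\<lambda>x. [:f:] * F x) \<in> S"
  shows "F \<in> S"
proof (rule S_I[OF off])
  fix i j
  show "(\<lambda>x. coeff (coeff (F x) j) i) \<in> V i j"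
  proof (induction i rule: less_induct)
    case (less i)
    define T where "T = {..i} - {0}"
    have "coeff (coeff (F x) j) i = inverse (coeff f 0) *
        (coeff (coeff ([:f:] * F x) j) i - (\<Sum>m\<in>T. coeff f m * coeff (coeff (F x) j) (i - m)))" for x
    proof -
      have "coeff (coeff ([:f:] * F x) j) i = (\<Sum>m\<le>i. coeff f m * coeff (coeff (F x) j) (i - m))"
        by (simp add: coeff_mult)
      also have "\<dots> = coeff f 0 * coeff (coeff (F x) j) i + (\<Sum>m\<in>T. coeff f m * coeff (coeff (F x) j) (i - m))"
        unfolding T_def by (subst sum.remove[of _ 0]) auto
      finally show ?thesis using f by (simp add: field_simps)
    qed
    moreover have "(\<lambda>x. inverse (coeff f 0) *
        (coeff (coeff ([:f:] * F x) j) i - (\<Sum>m\<in>T. coeff f m * coeff (coeff (F x) j) (i - m)))) \<in> V i j"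
    proof (intro V_scale V_sub V_sum)
      show "(\<lambda>x. coeff (coeff ([:f:] * F x) j) i) \<in> V i j" by (rule S_coeff[OF fF])
      fix m assume m: "m \<in> T"
      then have "(\<lambda>x. coeff (coeff (F x) j) (i - m)) \<in> V (i - m) j"
        by (intro less) (auto simp: T_def)
      then show "(\<lambda>x. coeff (coeff (F x) j) (i - m)) \<in> V i j"
        using V_mono[of "i - m" i j j] by auto
    qed
    ultimately show ?case by (simp only:)
  qed
qed

text \<open>The same recursion in the outer variable, where \<open>g\<close> begins with the unit
  -1.\<close>

lemma div_unit:
  assumes g: "coeff g 0 = - 1" and off: "\<And>x. x \<notin> E \<Longrightarrow> F x = 0" and gF: "(\<lambda>x. g * F x) \<in> S"
  shows "F \<in> S"
proof (rule S_I[OF off])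
  fix i j
  show "(\<lambda>x. coeff (coeff (F x) j) i) \<in> V i j"
  proof (induction j arbitrary: i rule: less_induct)
    case (less j)
    define T where "T = {..j} - {0}"
    have "coeff (coeff (F x) j) i = (\<Sum>l\<in>T. \<Sum>m\<le>i. coeff (coeff g l) m * coeff (coeff (F x) (j - l)) (i - m)) -
        coeff (coeff (g * F x) j) i" for x
    proof -
      have "coeff (g * F x) j = coeff g 0 * coeff (F x) j + (\<Sum>l\<in>T. coeff g l * coeff (F x) (j - l))"
        unfolding T_def coeff_mult by (subst sum.remove[of _ 0]) auto
      then have "coeff (F x) j = (\<Sum>l\<in>T. coeff g l * coeff (F x) (j - l)) - coeff (g * F x) j"
        using g by simp
      then have "coeff (coeff (F x) j) i = coeff ((\<Sum>l\<in>T. coeff g l * coeff (F x) (j - l)) - coeff (g * F x) j) i"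
        by simp
      then show ?thesis by (simp only: coeff_diff coeff_sum coeff_mult)
    qed
    moreover have "(\<lambda>x. (\<Sum>l\<in>T. \<Sum>m\<le>i. coeff (coeff g l) m * coeff (coeff (F x) (j - l)) (i - m)) -
        coeff (coeff (g * F x) j) i) \<in> V i j"
    proof (intro V_scale V_sub V_sum)
      show "(\<lambda>x. coeff (coeff (g * F x) j) i) \<in> V i j" by (rule S_coeff[OF gF])
      fix l m assume l: "l \<in> T" and m: "m \<in> {..i}"
      then have "(\<lambda>x. coeff (coeff (F x) (j - l)) (i - m)) \<in> V (i - m) (j - l)"
        by (intro less) (auto simp: T_def)
      then show "(\<lambda>x. coeff (coeff (F x) (j - l)) (i - m)) \<in> V i j"
        using V_mono[of "i - m" i "j - l" j] by auto
    qed
    ultimately show ?case by (simp only:)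
  qed
qed

text \<open>Multiplication by \<open>s\<close> or \<open>u\<close> shifts coefficients by one degree
  in the respective direction, so the two memberships place each coefficient in the two spaces of
  the saturation condition.\<close>

lemma div_variables:
  assumes sat: "\<And>i j. V (Suc i) j \<inter> V i (Suc j) \<subseteq> V i j" and off: "\<And>x. x \<notin> E \<Longrightarrow> F x = 0"
    and sF: "(\<lambda>x. [:[:0, 1:]:] * F x) \<in> S" and uF: "(\<lambda>x. [:0, 1:] * F x) \<in> S"
  shows "F \<in> S"
proof (rule S_I[OF off])
  fix i j
  have "(\<lambda>x. coeff (coeff (F x) j) i) \<in> V (Suc i) j" using S_coeff[OF sF, of j "Suc i"] by simp
  moreover have "(\<lambda>x. coeff (coeff (F x) j) i) \<in> V i (Suc j)" using S_coeff[OF uF, of "Suc j" i] by simp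
  ultimately show "(\<lambda>x. coeff (coeff (F x) j) i) \<in> V i j" using sat by blast
qed

text \<open>
  A maximal ideal contains the kernel of evaluation at some point, so it is the preimage of a maximal
  ideal of the polynomial ring in two variables.
\<close>

lemma maximal_ideal_elements:
  assumes "maximalideal m A"
  obtains f g where "f \<noteq> 0" "f = [:0, 1:] \<or> coeff f 0 \<noteq> 0" "g = [:0, 1:] \<or> coeff g 0 = - 1"
    "cst [:f:] \<in> h ` m" "cst g \<in> h ` m"
proof -
  interpret m: maximalideal m A by fact
  have prime: "primeideal m A" by (rule maximalideal_prime[OF assms])
  note im = ideal_image[OF m.is_ideal]
  have "\<exists>x\<in>E. \<forall>F\<in>S. F x = 0 \<longrightarrow> F \<in> h ` m"
  proof (rule ccontr)
    assume no: "\<not> ?thesis"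
    \<comment> \<open>If for each point some function outside \<open>m\<close> vanished there, the
      product of these functions would be zero and yet avoid the prime \<open>m\<close>.\<close>
    have "\<exists>F\<in>S. F \<notin> h ` m \<and> (\<forall>x\<in>T. F x = 0)" if "finite T" "T \<subseteq> E" for T
      using that
    proof (induction T)
      case empty
      then show ?case using prime_image(1)[OF prime] by auto
    next
      case (insert y T)
      then obtain F where F: "F \<in> S" "F \<notin> h ` m" "\<forall>x\<in>T. F x = 0" by blast
      obtain G where G: "G \<in> S" "G \<notin> h ` m" "G y = 0" using no insert.prems by blast
      have "F * G \<notin> h ` m" using prime_image(2)[OF prime F(1) G(1)] F(2) G(2) by blast
      moreover have "\<forall>x\<in>insert y T. (F * G) x = 0" using F(3) G(3) by auto
      ultimately show ?case using S_mult[OF F(1) G(1)] by blast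
    qed
    then obtain F where F: "F \<in> S" "F \<notin> h ` m" "\<forall>x\<in>E. F x = 0" using finite_E by blast
    have "F = 0"
    proof
      fix x show "F x = 0 x" using F(3) S_off[OF F(1), of x] by (cases "x \<in> E") auto
    qed
    then show False using F(2) im(2) by simp
  qed
  then obtain x where x: "x \<in> E" "\<And>F. F \<in> S \<Longrightarrow> F x = 0 \<Longrightarrow> F \<in> h ` m" by blast
  \<comment> \<open>As functions vanishing at \<open>x\<close> belong to \<open>m\<close>,
    membership in \<open>m\<close> depends only on the value at \<open>x\<close>; \<open>N\<close>
    is the maximal ideal of k[s,u] formed by these values.\<close>
  define N where "N = (\<lambda>F. F x) ` (h ` m)"
  have mem_cst: "cst c \<in> h ` m" if cN: "c \<in> N" for c
  proof -
    obtain F where F: "c = F x" "F \<in> h ` m" using cN unfolding N_def by (rule imageE)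
    have "F \<in> S" using F(2) im(1) by (rule rev_subsetD)
    then have "cst c - F \<in> S" by (rule S_sub[OF cst_in])
    moreover have "(cst c - F) x = 0" using x(1) F(1) by (simp add: cst_def)
    ultimately have "cst c - F \<in> h ` m" by (rule x(2))
    from im(3)[OF this F(2)] show ?thesis by simp
  qed
  have mem_N: "c \<in> N" if "cst c \<in> h ` m" for c
    unfolding N_def using that x(1) by (intro image_eqI[of _ _ "cst c"]) (auto simp: cst_def)
  have N: "ideal_set N"
    unfolding ideal_set_def
  proof (intro conjI ballI allI)
    show "0 \<in> N" unfolding N_def using im(2) by force
    fix a assume "a \<in> N"
    then obtain F where F: "a = F x" "F \<in> h ` m" unfolding N_def by (rule imageE)
    show "r * a \<in> N" for r
      unfolding N_def F(1) using im(5)[OF F(2), of r] by (intro image_eqI[of _ _ "\<lambda>x. r * F x"]) auto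
    fix b assume "b \<in> N"
    then obtain G where G: "b = G x" "G \<in> h ` m" unfolding N_def by (rule imageE)
    show "a + b \<in> N"
      unfolding N_def F(1) G(1) using im(3)[OF F(2) G(2)] by (intro image_eqI[of _ _ "F + G"]) auto
  qed
  have one: "1 \<notin> N" using mem_cst prime_image(1)[OF prime] by blast
  have inverse: "\<exists>b. c * b - 1 \<in> N" if c: "c \<notin> N" for c
  proof -
    obtain a where a: "a \<in> carrier A" "cst c = h a" using h_surj[OF cst_in] by blast
    have anm: "a \<notin> m" using c mem_N a(2) by (metis image_eqI)
    have I: "ideal (m <+> PIdl a) A" by (rule add_ideals[OF m.is_ideal cgenideal_ideal[OF a(1)]])
    have zero_P: "\<zero> \<in> PIdl a"
      using additive_subgroup.zero_closed ideal.axioms(1) cgenideal_ideal[OF a(1)] by blast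
    have "m \<subseteq> m <+> PIdl a"
    proof
      fix y assume y: "y \<in> m"
      then show "y \<in> m <+> PIdl a"
        using zero_P m.Icarr[OF y] unfolding set_add_def' by (intro UN_I[of y] UN_I[of \<zero>]) auto
    qed
    moreover have "a \<in> m <+> PIdl a"
      using cgenideal_self[OF a(1)] a(1) additive_subgroup.zero_closed[OF m.is_additive_subgroup]
      unfolding set_add_def' by (intro UN_I[of \<zero>] UN_I[of a]) auto
    ultimately have "m <+> PIdl a = carrier A"
      using m.I_maximal[OF I] anm ideal.Icarr[OF I] by blast
    then have "\<one> \<in> m <+> PIdl a" by simp
    then obtain y r where yr: "y \<in> m" "r \<in> carrier A" "\<one> = y \<oplus> r \<otimes> a"
      unfolding set_add_def' cgenideal_def by blast
    have "cst 1 = h (y \<oplus> r \<otimes> a)" unfolding yr(3)[symmetric] h_cst_one ..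
    also have "\<dots> = h y + h r * cst c" using yr a m.Icarr h_add h_mult by simp
    finally have "h y = cst 1 - h r * cst c" by simp
    then have "h y x = 1 - h r x * c" using x(1) by (simp add: cst_def)
    moreover have "h y x \<in> N" unfolding N_def using yr(1) by blast
    ultimately have "- 1 * (1 - h r x * c) \<in> N" using ideal_setD(3)[OF N, of "h y x" "- 1"] by (simp only:)
    moreover have "c * h r x - 1 = - 1 * (1 - h r x * c)" by (simp add: algebra_simps)
    ultimately have "c * h r x - 1 \<in> N" by (simp only:)
    then show ?thesis by blast
  qed
  have N_prime: "a \<in> N \<or> b \<in> N" if "a * b \<in> N" for a b
  proof (rule ccontr)
    assume "\<not> (a \<in> N \<or> b \<in> N)"
    then obtain c where c: "a * c - 1 \<in> N" and b: "b \<notin> N" using inverse by blast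
    have "b = c * (a * b) - b * (a * c - 1)" by (simp add: algebra_simps)
    also have "\<dots> \<in> N"
      by (rule ideal_setD(5)[OF N], rule ideal_setD(3)[OF N that], rule ideal_setD(3)[OF N c])
    finally show False using b by blast
  qed
  \<comment> \<open>In a polynomial of least degree a factor \<open>s\<close> can occur only if
    \<open>s\<close> itself lies in \<open>N\<close>: the cofactor has smaller degree and
    \<open>N\<close> is prime.\<close>
  define n where "n = (LEAST n. \<exists>f. f \<noteq> 0 \<and> [:f:] \<in> N \<and> degree f = n)"
  have ex: "\<exists>n f. f \<noteq> 0 \<and> [:f:] \<in> N \<and> degree f = n"
    using zariski_two_variables[OF N one inverse] by blast
  obtain f where f: "f \<noteq> 0" "[:f:] \<in> N" "degree f = n"
    using LeastI_ex[OF ex] unfolding n_def by blast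
  have minimal: "n \<le> degree f'" if "f' \<noteq> 0" "[:f':] \<in> N" for f'
    unfolding n_def using that by (intro Least_le) blast
  have "\<exists>f. f \<noteq> 0 \<and> [:f:] \<in> N \<and> (f = [:0, 1:] \<or> coeff f 0 \<noteq> 0)"
  proof (cases "coeff f 0 = 0")
    case True
    then obtain f' where f': "f = pCons 0 f'" by (cases f) auto
    have "[:f:] = [:[:0, 1:]:] * [:f':]" by (simp add: f')
    then have "[:[:0, 1:]:] \<in> N \<or> [:f':] \<in> N" using N_prime f(2) by metis
    moreover have "[:f':] \<notin> N" using minimal[of f'] f f' by auto
    ultimately have "[:[:0, 1:]:] \<in> N" by blast
    then show ?thesis by (intro exI[of _ "[:0, 1:]"]) simp
  qed (use f in blast)
  then obtain f where f: "f \<noteq> 0" "[:f:] \<in> N" "f = [:0, 1:] \<or> coeff f 0 \<noteq> 0" by blast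
  \<comment> \<open>If \<open>u\<close> is not in \<open>N\<close>, an inverse \<open>b\<close> of
    \<open>u\<close> modulo \<open>N\<close> yields \<open>u * b - 1\<close>; hence the constant
    coefficient -1.\<close>
  have "\<exists>g. g \<in> N \<and> (g = [:0, 1:] \<or> coeff g 0 = - 1)"
  proof (cases "[:0, 1:] \<in> N")
    case False
    then obtain b where "[:0, 1:] * b - 1 \<in> N" using inverse by blast
    moreover have "coeff ([:0, 1:] * b - 1) 0 = - 1" by simp
    ultimately show ?thesis by blast
  qed blast
  then obtain g where g: "g \<in> N" "g = [:0, 1:] \<or> coeff g 0 = - 1" by blast
  show thesis by (rule that[OF f(1,3) g(2) mem_cst[OF f(2)] mem_cst[OF g(1)]])
qed

text \<open>At every maximal ideal the pair from \<open>maximal_ideal_elements\<close> is a regular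
  sequence. Divisibility holds pointwise in k[s,u]; the point is that the pointwise quotient
  \<open>w\<close> has its coefficients in the spaces \<open>V\<close>.\<close>

theorem cohen_macaulayI:
  assumes sat: "\<And>i j. V (Suc i) j \<inter> V i (Suc j) \<subseteq> V i j"
  shows "cohen_macaulay A"
  unfolding cohen_macaulay_def
proof (intro conjI allI impI)
  show "cring A" by (rule is_cring)
  show "noetherian_ring A" by (rule noetherian)
  fix m assume m: "maximalideal m A"
  interpret m: maximalideal m A by (rule m)
  interpret lm: localization_maximal A m
    by (rule localization_maximal.intro[OF is_cring localization_maximal_axioms.intro[OF noetherian m]])
  obtain f g where fg: "f \<noteq> 0" "f = [:0, 1:] \<or> coeff f 0 \<noteq> 0" "g = [:0, 1:] \<or> coeff g 0 = - 1"
    "cst [:f:] \<in> h ` m" "cst g \<in> h ` m"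
    by (rule maximal_ideal_elements[OF m])
  obtain a b where ab: "a \<in> m" "h a = cst [:f:]" "b \<in> m" "h b = cst g" using fg(4,5) by auto
  then have c: "a \<in> carrier A" "b \<in> carrier A" using m.Icarr by blast+
  show "cohen_macaulay_local (localization_at A m)"
  proof (rule lm.cohen_macaulay_localI[OF ab(1,3)])
    fix y assume y: "y \<in> carrier A" "a \<otimes> y = \<zero>"
    then have "cst [:f:] * h y = 0" using h_mult[OF c(1) y(1)] ab h_zero by simp
    then have "(\<lambda>x. [:f:] * h y x) = 0" using cst_mult[OF h_in[OF y(1)], of "[:f:]"] by simp
    then have eq: "[:f:] * h y x = 0" for x by (metis zero_fun_apply)
    have "h y = 0"
    proof
      fix x show "h y x = 0 x" using eq[of x] fg(1) by simp
    qed
    then show "y = \<zero>" using h_inj[OF y(1) zero_closed] h_zero by simp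
  next
    fix y z assume y: "y \<in> carrier A" and z: "z \<in> carrier A" and eq: "a \<otimes> y = b \<otimes> z"
    have "cst [:f:] * h y = cst g * h z"
      using h_mult[OF c(1) y] h_mult[OF c(2) z] ab eq by simp
    then have eq': "[:f:] * h y x = g * h z x" for x
      using cst_mult[OF h_in[OF y], of "[:f:]"] cst_mult[OF h_in[OF z], of g] by (simp only: fun_eq_iff)
    have "\<exists>w. h z x = [:f:] * w" for x
    proof -
      have "[:f:] dvd g * h z x" using eq'[of x] by (metis dvd_triv_left)
      from const_dvd_of_dvd_mult[OF this fg(3)] show ?thesis by (elim dvdE) blast
    qed
    then obtain w where w: "\<And>x. h z x = [:f:] * w x" by metis
    have f0: "[:f:] \<noteq> 0" using fg(1) by simp
    have w': "h y x = g * w x" for x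
    proof -
      have "[:f:] * h y x = [:f:] * (g * w x)" using eq'[of x] unfolding w by (simp only: mult_ac)
      then show ?thesis using f0 mult_left_cancel by blast
    qed
    have off: "w x = 0" if "x \<notin> E" for x
      using S_off[OF h_in[OF z] that] w[of x] f0 by (metis mult_eq_0_iff)
    have "h z = (\<lambda>x. [:f:] * w x)" "h y = (\<lambda>x. g * w x)" using w w' by (intro ext; blast)+
    then have fw: "(\<lambda>x. [:f:] * w x) \<in> S" and gw: "(\<lambda>x. g * w x) \<in> S"
      using h_in[OF z] h_in[OF y] by (simp_all only:)
    \<comment> \<open>Saturation is called upon when \<open>f\<close> and \<open>g\<close> are the
      two variables; otherwise one of them has a unit as constant term, which permits the
      division.\<close>
    have "w \<in> S"
    proof (cases "coeff f 0 \<noteq> 0")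
      case True
      then show ?thesis by (rule div_const[OF _ off fw])
    next
      case False
      then have f1: "f = [:0, 1:]" using fg(2) by blast
      show ?thesis
      proof (cases "coeff g 0 = - 1")
        case True
        then show ?thesis by (rule div_unit[OF _ off gw])
      next
        case False
        then have g1: "g = [:0, 1:]" using fg(3) by blast
        show ?thesis by (rule div_variables[OF sat off fw[unfolded f1] gw[unfolded g1]])
      qed
    qed
    then obtain v where v: "v \<in> carrier A" "w = h v" using h_surj by blast
    have "h z = (\<lambda>x. [:f:] * h v x)" using w unfolding v(2) by (intro ext; blast)
    also have "\<dots> = h (a \<otimes> v)"
      unfolding h_mult[OF c(1) v(1)] ab(2) cst_mult[OF h_in[OF v(1)]] ..
    finally have "h z = h (a \<otimes> v)" .
    then have "z = a \<otimes> v" using h_inj z v(1) c(1) by blast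
    then show "\<exists>v\<in>carrier A. z = a \<otimes> v" using v(1) by blast
  next
    fix C assume "\<And>i. i \<le> 3 \<Longrightarrow> primeideal (C i) A" "\<And>i. i < 3 \<Longrightarrow> C i \<subset> C (Suc i)"
    then show False by (rule no_long_prime_chain)
  qed
qed

text \<open>Applied to the identity, to \<open>u = 0\<close> and to \<open>s = u = 0\<close> at one
  point, this gives the chain of three primes below.\<close>

lemma prime_kernel:
  fixes \<rho> :: "'k poly poly \<Rightarrow> 'c::idom"
  assumes x: "x \<in> E" and \<rho>: "\<And>p q. \<rho> (p + q) = \<rho> p + \<rho> q" "\<And>p q. \<rho> (p * q) = \<rho> p * \<rho> q" "\<rho> 1 = 1"
  shows "primeideal {a \<in> carrier A. \<rho> (h a x) = 0} A" (is "primeideal ?P A")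
proof -
  have \<rho>0: "\<rho> 0 = 0"
    using \<rho>(1)[of 0 0, unfolded add_0_left] by (metis add_cancel_left_left)
  have add: "a \<oplus> b \<in> ?P" if "a \<in> ?P" "b \<in> ?P" for a b using that \<rho> h_add by auto
  have mult: "b \<otimes> a \<in> ?P" if "a \<in> ?P" "b \<in> carrier A" for a b using that \<rho> h_mult by auto
  have "subgroup ?P (add_monoid A)"
  proof (rule subgroup.intro)
    fix a assume a: "a \<in> ?P"
    have "\<ominus> \<one> \<otimes> a \<in> ?P" using a by (intro mult) auto
    then show "inv\<^bsub>add_monoid A\<^esub> a \<in> ?P" using a by (simp add: a_inv_def[symmetric] l_minus)
  qed (use add h_zero \<rho>0 in auto)
  then have "ideal ?P A"
    using mult by (intro idealI[OF ring_axioms]) (auto simp: m_comm)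
  moreover have "\<one> \<notin> ?P" using x \<rho>(3) by (simp add: h_one)
  ultimately show ?thesis
    using \<rho> h_mult by (intro primeidealI[OF _ is_cring]) auto
qed

text \<open>
  Among the functions witnessing that \<open>s, u\<close> is not a regular sequence, one of largest total degree
  is annihilated modulo \<open>s\<close> by the irrelevant maximal ideal.
\<close>

theorem not_cohen_macaulayI:
  assumes nonsat: "\<not> V (Suc i) j \<inter> V i (Suc j) \<subseteq> V i j"
  shows "\<not> cohen_macaulay A"
proof -
  define B where "B = (\<lambda>(i, j, \<phi>). \<phi> \<in> V (Suc i) j \<and> \<phi> \<in> V i (Suc j) \<and> \<phi> \<notin> V i j)"
  obtain \<phi>' where "B (i, j, \<phi>')" using nonsat unfolding B_def by blast
  \<comment> \<open>From \<open>K\<close> on the spaces do not grow in either direction, so both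
    degrees of a violation are below \<open>K\<close> and a largest total degree exists.\<close>
  moreover have "\<forall>y. B y \<longrightarrow> (\<lambda>(i, j, \<phi>). i + j) y < 2 * K"
  proof (intro allI impI)
    fix y assume "B y"
    then obtain i j \<phi> where y: "y = (i, j, \<phi>)" "\<phi> \<in> V (Suc i) j" "\<phi> \<in> V i (Suc j)" "\<phi> \<notin> V i j"
      unfolding B_def by (cases y) auto
    then have "i < K" "j < K" using V_stable1[of i j] V_stable2[of j i] by (meson not_le subsetD)+
    then show "(\<lambda>(i, j, \<phi>). i + j) y < 2 * K" by (simp add: y)
  qed
  ultimately obtain y where "B y" "\<forall>z. B z \<longrightarrow> (\<lambda>(i, j, \<phi>). i + j) z \<le> (\<lambda>(i, j, \<phi>). i + j) y"
    using ex_has_greatest_nat[of B "(i, j, \<phi>')" "\<lambda>(i, j, \<phi>). i + j" "2 * K"] by (meson less_imp_le)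
  then obtain i d \<phi> where \<phi>: "\<phi> \<in> V (Suc i) d" "\<phi> \<in> V i (Suc d)" "\<phi> \<notin> V i d"
    and max: "\<And>i' d' \<psi>. \<psi> \<in> V (Suc i') d' \<Longrightarrow> \<psi> \<in> V i' (Suc d') \<Longrightarrow> i + d < i' + d' \<Longrightarrow> \<psi> \<in> V i' d'"
    unfolding B_def by (cases y) (auto, meson not_le)
  obtain x where x: "x \<in> E" using E_nonempty by blast
  define p0 where "p0 = {a \<in> carrier A. h a x = 0}"
  define p1 where "p1 = {a \<in> carrier A. poly (h a x) 0 = 0}"
  define m where "m = {a \<in> carrier A. poly (poly (h a x) 0) 0 = 0}"
  have p0: "primeideal p0 A" unfolding p0_def using prime_kernel[OF x, of "\<lambda>p. p"] by simp
  have p1: "primeideal p1 A" unfolding p1_def using prime_kernel[OF x, of "\<lambda>p. poly p 0"] by simp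
  have pm: "primeideal m A" unfolding m_def using prime_kernel[OF x, of "\<lambda>p. poly (poly p 0) 0"] by simp
  note pm_ideal = primeideal.axioms(1)[OF pm]
  obtain s where s: "s \<in> carrier A" "cst [:[:0, 1:]:] = h s" using h_surj[OF cst_in] by blast
  obtain u where u: "u \<in> carrier A" "cst [:0, 1:] = h u" using h_surj[OF cst_in] by blast
  have hx: "h s x = [:[:0, 1:]:]" "h u x = [:0, 1:]"
    unfolding s(2)[symmetric] u(2)[symmetric] using x by (simp_all add: cst_def)
  have "p0 \<subseteq> p1" by (auto simp: p0_def p1_def)
  moreover have "u \<in> p1" "u \<notin> p0" using u(1) hx(2) by (simp_all add: p0_def p1_def)
  ultimately have p01: "p0 \<subset> p1" by blast
  have "p1 \<subseteq> m"
  proof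
    fix a assume "a \<in> p1"
    then show "a \<in> m" by (simp add: p1_def m_def)
  qed
  moreover have "s \<in> m" "s \<notin> p1" using s(1) hx(1) by (simp_all add: p1_def m_def)
  ultimately have p1m: "p1 \<subset> m" by blast
  have coeff00: "\<exists>c. \<forall>y\<in>E. coeff (coeff (h a y) 0) 0 = c" if a: "a \<in> carrier A" for a
  proof -
    obtain c where "(\<lambda>x. coeff (coeff (h a x) 0) 0) = (\<lambda>x. if x \<in> E then c else 0)"
      using V_const[OF S_coeff[OF h_in[OF a], of 0 0]] by blast
    then have "coeff (coeff (h a y) 0) 0 = (if y \<in> E then c else 0)" for y by (rule fun_cong)
    then show ?thesis by (intro exI[of _ c]) simp
  qed
  have m_iff: "a \<in> m \<longleftrightarrow> (\<forall>y\<in>E. coeff (coeff (h a y) 0) 0 = 0)" if a: "a \<in> carrier A" for a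
  proof -
    obtain c where c: "\<forall>y\<in>E. coeff (coeff (h a y) 0) 0 = c" using coeff00[OF a] by blast
    have "a \<in> m \<longleftrightarrow> c = 0" using c x a by (simp add: m_def poly_0_coeff_0)
    also have "\<dots> \<longleftrightarrow> (\<forall>y\<in>E. coeff (coeff (h a y) 0) 0 = 0)" using c x by auto
    finally show ?thesis .
  qed
  \<comment> \<open>An element outside \<open>m\<close> has a nonzero constant coefficient, the same
    at all points; after scaling it differs from one by an element of \<open>m\<close>.\<close>
  have max_m: "maximalideal m A"
  proof (rule maximalidealI[OF pm_ideal])
    show "carrier A \<noteq> m" using primeideal.I_notcarr[OF pm] .
    fix J assume J: "ideal J A" "m \<subseteq> J" "J \<subseteq> carrier A"
    show "J = m \<or> J = carrier A"
    proof (cases "J = m")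
      case False
      then obtain a where a: "a \<in> J" "a \<notin> m" using J by blast
      then have ac: "a \<in> carrier A" using J by blast
      define c where "c = coeff (coeff (h a x) 0) 0"
      have c: "c \<noteq> 0" using a(2) ac by (simp add: c_def m_def poly_0_coeff_0)
      obtain b where b: "b \<in> carrier A" "cst [:[:inverse c:]:] = h b" using h_surj[OF cst_in] by blast
      have ba: "b \<otimes> a \<in> J" using ideal.I_l_closed[OF J(1) a(1) b(1)] .
      have bac: "b \<otimes> a \<in> carrier A" using b ac by simp
      have hb: "h b x = [:[:inverse c:]:]" unfolding b(2)[symmetric] using x by (simp add: cst_def)
      have "h (\<one> \<ominus> b \<otimes> a) + h (b \<otimes> a) = h \<one>"
        using h_add[of "\<one> \<ominus> b \<otimes> a" "b \<otimes> a"] bac by (simp add: minus_eq a_assoc l_neg)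
      then have "h (\<one> \<ominus> b \<otimes> a) x + h (b \<otimes> a) x = 1"
        using x by (simp add: fun_eq_iff h_one)
      moreover have "h (b \<otimes> a) x = [:[:inverse c:]:] * h a x" using h_mult[OF b(1) ac] hb by simp
      ultimately have "h (\<one> \<ominus> b \<otimes> a) x = 1 - [:[:inverse c:]:] * h a x" by (simp add: algebra_simps)
      then have "\<one> \<ominus> b \<otimes> a \<in> m"
        using c bac unfolding m_def by (simp add: poly_0_coeff_0 c_def)
      then have "(\<one> \<ominus> b \<otimes> a) \<oplus> b \<otimes> a \<in> J"
        using J(2) ba additive_subgroup.a_closed[OF ideal.axioms(1)[OF J(1)]] by blast
      then have "\<one> \<in> J" using bac by (simp add: minus_eq a_assoc l_neg)
      then show ?thesis using ideal.one_imp_carrier[OF J(1)] by blast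
    qed blast
  qed
  interpret lm: localization_maximal A m
    by (rule localization_maximal.intro[OF is_cring localization_maximal_axioms.intro[OF noetherian max_m]])
  \<comment> \<open>This is \<phi>(x) s^k u^d. It belongs to the ring for \<open>k = Suc i\<close>
    but not for \<open>k = i\<close>, so \<open>Z (Suc i)\<close> is divisible by \<open>s\<close>
    only outside the ring.\<close>
  define Z where "Z k x = monom (monom (\<phi> x) k) d" for k x
  have coeff_Z: "coeff (coeff (Z k x) l) n = (if l = d \<and> n = k then \<phi> x else 0)" for k x l n
    by (simp add: Z_def)
  have "Z (Suc i) \<in> S"
  proof (rule S_I)
    show "Z (Suc i) x = 0" if "x \<notin> E" for x using V_off[OF \<phi>(1) that] by (simp add: Z_def)
    show "(\<lambda>x. coeff (coeff (Z (Suc i) x) l) n) \<in> V n l" for n l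
      unfolding coeff_Z using \<phi>(1) V_zero by (cases "l = d \<and> n = Suc i") auto
  qed
  then obtain z where z: "z \<in> carrier A" "Z (Suc i) = h z" using h_surj by blast
  have Z_Suc: "Z (Suc i) x = [:[:0, 1:]:] * Z i x" for x
    by (simp add: Z_def monom_Suc smult_monom)
  have "\<not> cohen_macaulay_local (localization_at A m)"
  proof (rule lm.not_cohen_macaulay_localI[OF p0 p1 p01 p1m s(1) z(1)])
    fix b assume b: "b \<in> carrier A" "s \<otimes> b = \<zero>"
    then have "cst [:[:0, 1:]:] * h b = 0" using h_mult[OF s(1) b(1)] s(2) h_zero by simp
    then have "(\<lambda>x. [:[:0, 1:]:] * h b x) = 0"
      using cst_mult[OF h_in[OF b(1)], of "[:[:0, 1:]:]"] by (simp only:)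
    then have eq: "[:[:0, 1:]:] * h b x = 0" for x by (metis zero_fun_apply)
    have "h b = 0"
    proof
      fix x show "h b x = 0 x" using eq[of x] by simp
    qed
    then show "b = \<zero>" using h_inj[OF b(1) zero_closed] h_zero by simp
  next
    fix c assume c: "c \<in> m"
    then have cc: "c \<in> carrier A" by (rule ideal.Icarr[OF pm_ideal])
    \<comment> \<open>The quotient of \<open>c * z\<close> by \<open>s\<close>. Its coefficients are
      products of \<phi> with coefficients of \<open>c\<close>: the constant one is zero, and the
      others raise the total degree above \<open>i + d\<close>, where maximality excludes a
      violation.\<close>
    define W where "W x = h c x * Z i x" for x
    have coeff_W: "coeff (coeff (W x) l) n =
      (if d \<le> l \<and> i \<le> n then coeff (coeff (h c x) (l - d)) (n - i) * \<phi> x else 0)" for x l n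
      unfolding W_def Z_def mult.commute[of "h c x"] by (simp add: coeff_monom_mult mult.commute[of "\<phi> x"])
    have "W \<in> S"
    proof (rule S_I)
      show "W x = 0" if "x \<notin> E" for x using S_off[OF h_in[OF cc] that] by (simp add: W_def)
      fix n l
      show "(\<lambda>x. coeff (coeff (W x) l) n) \<in> V n l"
      proof (cases "d \<le> l \<and> i \<le> n")
        case True
        then obtain k t where kt: "l = d + k" "n = i + t" by (metis le_Suc_ex)
        define \<psi> where "\<psi> = (\<lambda>x. coeff (coeff (h c x) k) t)"
        have \<psi>: "\<psi> \<in> V t k" unfolding \<psi>_def by (rule S_coeff[OF h_in[OF cc]])
        have "(\<lambda>x. \<psi> x * \<phi> x) \<in> V (t + i) (k + d)"
        proof (cases "t = 0 \<and> k = 0")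
          case True
          have zero: "\<psi> x * \<phi> x = 0" for x
            using m_iff[OF cc] c V_off[OF \<phi>(1), of x] True unfolding \<psi>_def by (cases "x \<in> E") auto
          show ?thesis unfolding zero by (rule V_zero)
        next
          case False
          then have less: "i + d < (t + i) + (k + d)" by linarith
          have "(\<lambda>x. \<psi> x * \<phi> x) \<in> V (Suc (t + i)) (k + d)"
            using V_mult[OF \<psi> \<phi>(1)] by (simp only: add_Suc_right)
          moreover have "(\<lambda>x. \<psi> x * \<phi> x) \<in> V (t + i) (Suc (k + d))"
            using V_mult[OF \<psi> \<phi>(2)] by (simp only: add_Suc_right)
          ultimately show ?thesis using less by (rule max)
        qed
        then show ?thesis unfolding coeff_W kt \<psi>_def by (simp add: add.commute)
      next
        case False
        then show ?thesis unfolding coeff_W using V_zero by auto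
      qed
    qed
    then obtain w where w: "w \<in> carrier A" "W = h w" using h_surj by blast
    have "h (c \<otimes> z) = h (s \<otimes> w)"
    proof
      fix x
      have "h (c \<otimes> z) x = h c x * ([:[:0, 1:]:] * Z i x)"
        using h_mult[OF cc z(1)] z(2) Z_Suc by (metis times_fun_apply)
      also have "\<dots> = [:[:0, 1:]:] * W x" unfolding W_def by (simp only: mult.left_commute)
      also have "\<dots> = h (s \<otimes> w) x"
        using h_mult[OF s(1) w(1)] s(2) w(2) cst_mult[OF h_in[OF w(1)], of "[:[:0, 1:]:]"] by metis
      finally show "h (c \<otimes> z) x = h (s \<otimes> w) x" .
    qed
    then have "c \<otimes> z = s \<otimes> w" using h_inj cc z(1) s(1) w(1) by blast
    then show "\<exists>b\<in>carrier A. c \<otimes> z = s \<otimes> b" using w(1) by blast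
  next
    fix t b assume t: "t \<in> carrier A - m" and b: "b \<in> carrier A"
    show "t \<otimes> z \<noteq> s \<otimes> b"
    proof
      assume eq: "t \<otimes> z = s \<otimes> b"
      have tc: "t \<in> carrier A" using t by blast
      obtain c where c: "\<forall>y\<in>E. coeff (coeff (h t y) 0) 0 = c" using coeff00[OF tc] by blast
      have c0: "c \<noteq> 0" using c t m_iff[OF tc] by auto
      have "h t * Z (Suc i) = cst [:[:0, 1:]:] * h b"
        using h_mult[OF tc z(1)] h_mult[OF s(1) b] eq s(2) z(2) by simp
      then have eq': "h t x * Z (Suc i) x = [:[:0, 1:]:] * h b x" for x
        using cst_mult[OF h_in[OF b], of "[:[:0, 1:]:]"] by (metis times_fun_apply)
      \<comment> \<open>Comparing coefficients of s^(i+1) u^d: \<open>t\<close> contributes only its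
        nonzero constant coefficient, so \<phi> would be a scalar multiple of a coefficient of
        \<open>b\<close> and lie in \<open>V i d\<close>.\<close>
      have "inverse c * coeff (coeff (h b x) d) i = \<phi> x" for x
      proof (cases "x \<in> E")
        case True
        have "coeff (coeff (h b x) d) i = coeff (coeff ([:[:0, 1:]:] * h b x) d) (Suc i)" by simp
        also have "\<dots> = coeff (coeff (h t x) 0) 0 * \<phi> x"
          unfolding eq'[symmetric] Z_def mult.commute[of "h t x"]
          by (simp add: coeff_monom_mult mult.commute[of "\<phi> x"])
        finally show ?thesis using c c0 True by simp
      next
        case False
        then show ?thesis using V_off[OF \<phi>(1) False] S_off[OF h_in[OF b] False] by simp
      qed
      then have "\<phi> \<in> V i d"
        using V_scale[OF S_coeff[OF h_in[OF b], of d i], of "inverse c"] by simp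
      then show False using \<phi>(3) by blast
    qed
  qed
  then show ?thesis using max_m unfolding cohen_macaulay_def by blast
qed

end

section \<open>Points in general position\<close>

definition monom_value :: "('v \<Rightarrow> 'c::comm_ring_1) \<Rightarrow> ('v \<Rightarrow>\<^sub>0 nat) \<Rightarrow> 'c" where
  "monom_value v m = (\<Prod>x\<in>Poly_Mapping.keys m. v x ^ Poly_Mapping.lookup m x)"

lemma monom_value_superset:
  assumes "finite X" "Poly_Mapping.keys m \<subseteq> X"
  shows "monom_value v m = (\<Prod>x\<in>X. v x ^ Poly_Mapping.lookup m x)"
  unfolding monom_value_def
  by (rule prod.mono_neutral_left[OF assms]) (simp add: in_keys_iff)

lemma monom_value_add: "monom_value v (m + m') = monom_value v m * monom_value v m'"
proof -
  let ?X = "Poly_Mapping.keys m \<union> Poly_Mapping.keys m'"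
  have "Poly_Mapping.keys (m + m') \<subseteq> ?X" by (rule keys_add)
  then have "monom_value v (m + m') = (\<Prod>x\<in>?X. v x ^ Poly_Mapping.lookup (m + m') x)"
    by (intro monom_value_superset) simp
  also have "\<dots> = (\<Prod>x\<in>?X. v x ^ Poly_Mapping.lookup m x) * (\<Prod>x\<in>?X. v x ^ Poly_Mapping.lookup m' x)"
    by (simp add: lookup_add power_add prod.distrib)
  also have "\<dots> = monom_value v m * monom_value v m'"
    using monom_value_superset[of ?X m v] monom_value_superset[of ?X m' v] by simp
  finally show ?thesis .
qed

lemma monom_value_zero [simp]: "monom_value v 0 = 1"
  by (simp add: monom_value_def)

lemma monom_value_single [simp]: "monom_value v (Poly_Mapping.single x k) = v x ^ k"
  by (cases "k = 0") (simp_all add: monom_value_def)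

lemma mpoly_eq_sum_single:
  "f = (\<Sum>m\<in>Poly_Mapping.keys f. Poly_Mapping.single m (Poly_Mapping.lookup f m))"
proof (rule poly_mapping_eqI)
  fix m
  have "(\<Sum>m'\<in>Poly_Mapping.keys f. Poly_Mapping.lookup (Poly_Mapping.single m' (Poly_Mapping.lookup f m')) m) =
      (\<Sum>m'\<in>Poly_Mapping.keys f. if m' = m then Poly_Mapping.lookup f m' else 0)"
    by (rule sum.cong) (auto simp: lookup_single when_def)
  also have "\<dots> = Poly_Mapping.lookup f m" by (simp add: in_keys_iff)
  finally show "Poly_Mapping.lookup f m =
      Poly_Mapping.lookup (\<Sum>m\<in>Poly_Mapping.keys f. Poly_Mapping.single m (Poly_Mapping.lookup f m)) m"
    by (simp add: lookup_sum)
qed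

text \<open>Covers both evaluation at a point and evaluation with values in k[s,u], where \<phi>
  embeds the scalars.\<close>

locale substitution =
  fixes \<phi> :: "'k::comm_ring_1 \<Rightarrow> 'c::comm_ring_1" and v :: "'v \<Rightarrow> 'c"
  assumes \<phi>_add: "\<phi> (a + b) = \<phi> a + \<phi> b" and \<phi>_mult: "\<phi> (a * b) = \<phi> a * \<phi> b"
    and \<phi>_zero: "\<phi> 0 = 0" and \<phi>_one: "\<phi> 1 = 1"
begin

definition ins :: "('v, 'k) mpoly \<Rightarrow> 'c" where
  "ins f = (\<Sum>m\<in>Poly_Mapping.keys f. \<phi> (Poly_Mapping.lookup f m) * monom_value v m)"

lemma ins_superset:
  assumes "finite M" "Poly_Mapping.keys f \<subseteq> M"
  shows "ins f = (\<Sum>m\<in>M. \<phi> (Poly_Mapping.lookup f m) * monom_value v m)"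
  unfolding ins_def by (rule sum.mono_neutral_left[OF assms]) (simp add: in_keys_iff \<phi>_zero)

lemma ins_add: "ins (f + g) = ins f + ins g"
proof -
  let ?M = "Poly_Mapping.keys f \<union> Poly_Mapping.keys g"
  have "Poly_Mapping.keys (f + g) \<subseteq> ?M" by (rule keys_add)
  then have "ins (f + g) = (\<Sum>m\<in>?M. \<phi> (Poly_Mapping.lookup (f + g) m) * monom_value v m)"
    by (intro ins_superset) simp
  also have "\<dots> = (\<Sum>m\<in>?M. \<phi> (Poly_Mapping.lookup f m) * monom_value v m) +
      (\<Sum>m\<in>?M. \<phi> (Poly_Mapping.lookup g m) * monom_value v m)"
    by (simp add: lookup_add \<phi>_add sum.distrib distrib_right)
  also have "\<dots> = ins f + ins g" using ins_superset[of ?M f] ins_superset[of ?M g] by simp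
  finally show ?thesis .
qed

lemma ins_zero [simp]: "ins 0 = 0"
  by (simp add: ins_def)

lemma ins_single: "ins (Poly_Mapping.single m c) = \<phi> c * monom_value v m"
  by (cases "c = 0") (simp_all add: ins_def \<phi>_zero)

lemma ins_one [simp]: "ins 1 = 1"
  using ins_single[of 0 1] by (simp add: \<phi>_one)

lemma ins_sum: "ins (\<Sum>t\<in>T. f t) = (\<Sum>t\<in>T. ins (f t))"
  by (induction T rule: infinite_finite_induct) (auto simp: ins_add)

lemma ins_mult: "ins (f * g) = ins f * ins g"
proof -
  have "f * g = (\<Sum>m\<in>Poly_Mapping.keys f. \<Sum>m'\<in>Poly_Mapping.keys g.
      Poly_Mapping.single (m + m') (Poly_Mapping.lookup f m * Poly_Mapping.lookup g m'))"
    by (subst (1) mpoly_eq_sum_single[of f], subst (1) mpoly_eq_sum_single[of g])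
      (simp only: sum_product mult_single)
  then have "ins (f * g) = (\<Sum>m\<in>Poly_Mapping.keys f. \<Sum>m'\<in>Poly_Mapping.keys g.
      (\<phi> (Poly_Mapping.lookup f m) * monom_value v m) * (\<phi> (Poly_Mapping.lookup g m') * monom_value v m'))"
    by (simp only: ins_sum ins_single \<phi>_mult monom_value_add mult_ac)
  then show ?thesis by (simp only: ins_def sum_product)
qed

lemma ins_prod: "ins (\<Prod>t\<in>T. f t) = (\<Prod>t\<in>T. ins (f t))"
  by (induction T rule: infinite_finite_induct) (auto simp: ins_mult)

lemma ins_power: "ins (f ^ n) = ins f ^ n"
  by (induction n) (auto simp: ins_mult)

lemma ins_hom: "comm_ring_hom ins"
  by unfold_locales (simp_all add: ins_add ins_mult)

end

interpretation at_point: substitution "\<lambda>c. c" v for v :: "'v \<Rightarrow> 'k::comm_ring_1"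
  by unfold_locales auto

lemma eval_poly_eq: "eval_poly v f = at_point.ins v f"
  by (simp add: eval_poly_def at_point.ins_def monom_value_def)

definition variable :: "'v \<Rightarrow> ('v, 'k::comm_ring_1) mpoly" where
  "variable x = Poly_Mapping.single (Poly_Mapping.single x 1) 1"

lemma (in substitution) ins_variable [simp]: "ins (variable x) = v x"
  by (simp add: variable_def ins_single \<phi>_one)

text \<open>The common shape of having a bidegree, having a multidegree and involving only certain
  variables, so that closure under sums and products is proved once.\<close>

definition supported_on :: "('m \<Rightarrow> bool) \<Rightarrow> ('m \<Rightarrow>\<^sub>0 'k::zero) \<Rightarrow> bool" where
  "supported_on P f \<longleftrightarrow> (\<forall>m\<in>Poly_Mapping.keys f. P m)"

lemma supported_on_zero [simp]: "supported_on P 0"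
  by (simp add: supported_on_def)

lemma supported_on_add:
  "supported_on P f \<Longrightarrow> supported_on P g \<Longrightarrow> supported_on P (f + g)"
  unfolding supported_on_def using keys_add[of f g] by blast

lemma supported_on_sum:
  "(\<And>t. t \<in> T \<Longrightarrow> supported_on P (f t)) \<Longrightarrow> supported_on P (\<Sum>t\<in>T. f t)"
  by (induction T rule: infinite_finite_induct) (auto intro: supported_on_add)

lemma supported_on_mult:
  assumes "supported_on P f" "supported_on P' g" "\<And>m m'. P m \<Longrightarrow> P' m' \<Longrightarrow> P'' (m + m')"
  shows "supported_on P'' (f * g)"
  using assms keys_mult[of f g] unfolding supported_on_def by fast

lemma supported_on_single: "P m \<Longrightarrow> supported_on P (Poly_Mapping.single m c)"
  by (simp add: supported_on_def)

lemma supported_on_uminus: "supported_on P f \<Longrightarrow> supported_on P (- f :: _ \<Rightarrow>\<^sub>0 'k::comm_ring_1)"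
  by (simp add: supported_on_def)

section \<open>Interpolation conditions and general position\<close>

definition exponents :: "nat \<Rightarrow> nat \<Rightarrow> nat list set" where
  "exponents n d = {l. length l = Suc n \<and> sum_list l = d}"

lemma finite_exponents [simp]: "finite (exponents n d)"
proof (rule finite_subset)
  show "exponents n d \<subseteq> {l. set l \<subseteq> {..d} \<and> length l = Suc n}"
    using member_le_sum_list by (fastforce simp: exponents_def)
  show "finite {l. set l \<subseteq> {..d} \<and> length l = Suc n}" by (rule finite_lists_length_eq) simp
qed

lemma card_exponents: "card (exponents n d) = (d + n) choose n"
  unfolding exponents_def using card_length_sum_list[of "Suc n" d]
  by (simp add: binomial_symmetric[of d "d + n"])

definition power_product :: "(nat \<Rightarrow> 'c::comm_ring_1) \<Rightarrow> nat list \<Rightarrow> 'c" where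
  "power_product b l = (\<Prod>i<length l. b i ^ (l ! i))"

text \<open>
  Degrees above \<open>N\<close> need no condition: forms of degree \<open>N\<close> already separate \<open>N\<close> points in this position,
  hence so do forms of any larger degree.
\<close>

definition general_position :: "nat \<Rightarrow> nat \<Rightarrow> (nat \<Rightarrow> nat \<Rightarrow> 'k::field) \<Rightarrow> bool" where
  "general_position n N v \<longleftrightarrow> (\<forall>d\<le>N. \<forall>T\<subseteq>{..<N}. card T \<le> card (exponents n d) \<longrightarrow>
     (\<forall>\<psi>. \<exists>c. \<forall>q\<in>T. (\<Sum>l\<in>exponents n d. c l * power_product (v q) l) = \<psi> q) \<and>
     (card T = card (exponents n d) \<longrightarrow>
       (\<forall>c. (\<forall>q\<in>T. (\<Sum>l\<in>exponents n d. c l * power_product (v q) l) = 0) \<longrightarrow> (\<forall>l\<in>exponents n d. c l = 0))))"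

definition exponent_list :: "nat \<Rightarrow> nat \<Rightarrow> nat list list" where
  "exponent_list n d = (SOME ls. distinct ls \<and> set ls = exponents n d)"

lemma exponent_list: "distinct (exponent_list n d)" "set (exponent_list n d) = exponents n d"
proof -
  have "\<exists>ls. distinct ls \<and> set ls = exponents n d"
    using finite_distinct_list[OF finite_exponents] by blast
  from someI_ex[OF this] show "distinct (exponent_list n d)" "set (exponent_list n d) = exponents n d"
    unfolding exponent_list_def by blast+
qed

lemma length_exponent_list: "length (exponent_list n d) = card (exponents n d)"
  using exponent_list distinct_card by metis

text \<open>A square block of the interpolation matrix: rows are points, columns the first
  \<open>card T\<close> monomials in a fixed order. Its determinant is polynomial in the
  coordinates, which turns independence of the conditions into an open condition.\<close>

definition condition_matrix :: "nat \<Rightarrow> nat \<Rightarrow> nat set \<Rightarrow> (nat \<Rightarrow> nat \<Rightarrow> 'c::comm_ring_1) \<Rightarrow> 'c mat" where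
  "condition_matrix n d T v = mat (card T) (card T)
     (\<lambda>(a, b). power_product (v (sorted_list_of_set T ! a)) (exponent_list n d ! b))"

text \<open>An invertible block solves the interpolation problem with all other coefficients zero.
  With as many points as monomials the block is the whole matrix, and invertibility also gives
  uniqueness.\<close>

lemma general_positionI:
  fixes v :: "nat \<Rightarrow> nat \<Rightarrow> 'k::field"
  assumes "\<And>d T. \<lbrakk>d \<le> N; T \<subseteq> {..<N}; card T \<le> card (exponents n d)\<rbrakk> \<Longrightarrow> det (condition_matrix n d T v) \<noteq> 0"
  shows "general_position n N v"
  unfolding general_position_def
proof (intro allI impI)
  fix d T assume dT: "d \<le> N" "T \<subseteq> {..<N}" "card T \<le> card (exponents n d)"
  define r where "r = card T"
  define A where "A = condition_matrix n d T v"
  define t where "t = sorted_list_of_set T"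
  define e where "e = exponent_list n d"
  have finT: "finite T" using dT(2) finite_subset by blast
  have t: "set t = T" "length t = r" "distinct t" unfolding t_def r_def using finT by auto
  have e: "distinct e" "set e = exponents n d" "length e = card (exponents n d)"
    unfolding e_def using exponent_list length_exponent_list by auto
  have A: "A \<in> carrier_mat r r" by (simp add: A_def condition_matrix_def r_def)
  have A_index: "A $$ (a, b) = power_product (v (t ! a)) (e ! b)" if "a < r" "b < r" for a b
    using that by (simp add: A_def condition_matrix_def r_def t_def e_def)
  have det: "det A \<noteq> 0" unfolding A_def by (rule assms[OF dT])
  have inj: "inj_on (\<lambda>b. e ! b) {..<r}"
    using e(1,3) dT(3) by (auto simp: inj_on_def r_def nth_eq_iff_index_eq)
  have sub: "(\<lambda>b. e ! b) ` {..<r} \<subseteq> exponents n d"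
    using e(2,3) dT(3) unfolding r_def by (force simp flip: e(2))
  show "(\<forall>\<psi>. \<exists>c. \<forall>q\<in>T. (\<Sum>l\<in>exponents n d. c l * power_product (v q) l) = \<psi> q) \<and>
     (card T = card (exponents n d) \<longrightarrow>
       (\<forall>c. (\<forall>q\<in>T. (\<Sum>l\<in>exponents n d. c l * power_product (v q) l) = 0) \<longrightarrow> (\<forall>l\<in>exponents n d. c l = 0)))"
  proof (intro conjI allI impI)
    fix \<psi> :: "nat \<Rightarrow> 'k"
    have "A \<in> Units (ring_mat TYPE('k) r ())" by (rule det_non_zero_imp_unit[OF A det])
    then obtain B where B: "B \<in> carrier_mat r r" "A * B = 1\<^sub>m r"
      unfolding Units_def ring_mat_def by auto
    define p where "p = vec r (\<lambda>a. \<psi> (t ! a))"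
    define w where "w = B *\<^sub>v p"
    have p: "p \<in> carrier_vec r" by (simp add: p_def)
    then have w: "w \<in> carrier_vec r" using B by (simp add: w_def)
    have Aw: "A *\<^sub>v w = p"
      unfolding w_def assoc_mult_mat_vec[OF A B(1) p, symmetric] B(2) using p by simp
    define c where "c l = (\<Sum>b<r. if e ! b = l then w $ b else 0)" for l
    have c: "c (e ! b) = w $ b" if "b < r" for b
    proof -
      have "c (e ! b) = (\<Sum>b'<r. if b' = b then w $ b' else 0)"
        unfolding c_def using inj that by (intro sum.cong) (auto simp: inj_on_def)
      then show ?thesis using that by simp
    qed
    have c_off: "c l = 0" if "l \<notin> (\<lambda>b. e ! b) ` {..<r}" for l
      using that unfolding c_def by (intro sum.neutral) auto
    have "(\<Sum>l\<in>exponents n d. c l * power_product (v q) l) = \<psi> q" if q: "q \<in> T" for q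
    proof -
      obtain a where a: "a < r" "q = t ! a" using q t by (metis in_set_conv_nth)
      have "(\<Sum>l\<in>exponents n d. c l * power_product (v q) l) =
          (\<Sum>l\<in>(\<lambda>b. e ! b) ` {..<r}. c l * power_product (v q) l)"
        using sub c_off by (intro sum.mono_neutral_right) auto
      also have "\<dots> = (\<Sum>b<r. w $ b * power_product (v q) (e ! b))"
        by (subst sum.reindex[OF inj]) (simp add: c)
      also have "\<dots> = (A *\<^sub>v w) $ a"
        using A w a by (auto simp: scalar_prod_def A_index atLeast0LessThan mult.commute intro!: sum.cong)
      also have "\<dots> = \<psi> q" unfolding Aw p_def using a by simp
      finally show ?thesis .
    qed
    then show "\<exists>c. \<forall>q\<in>T. (\<Sum>l\<in>exponents n d. c l * power_product (v q) l) = \<psi> q" by blast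
  next
    assume eq: "card T = card (exponents n d)"
    fix c assume c: "\<forall>q\<in>T. (\<Sum>l\<in>exponents n d. c l * power_product (v q) l) = 0"
    define w where "w = vec r (\<lambda>b. c (e ! b))"
    have w: "w \<in> carrier_vec r" by (simp add: w_def)
    have img: "(\<lambda>b. e ! b) ` {..<r} = exponents n d"
      using e(2,3) eq unfolding r_def by (auto simp: in_set_conv_nth simp flip: e(2))
    have "A *\<^sub>v w = 0\<^sub>v r"
    proof (rule eq_vecI)
      fix a assume "a < dim_vec (0\<^sub>v r :: 'k vec)"
      then have a: "a < r" by simp
      then have "t ! a \<in> T" using t nth_mem by metis
      have "(A *\<^sub>v w) $ a = (\<Sum>b<r. c (e ! b) * power_product (v (t ! a)) (e ! b))"
        using A w a by (auto simp: scalar_prod_def A_index w_def atLeast0LessThan mult.commute intro!: sum.cong)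
      also have "\<dots> = (\<Sum>l\<in>exponents n d. c l * power_product (v (t ! a)) l)"
        unfolding img[symmetric] by (subst sum.reindex[OF inj]) simp
      also have "\<dots> = 0" using c \<open>t ! a \<in> T\<close> by blast
      finally show "(A *\<^sub>v w) $ a = 0\<^sub>v r $ a" using a by simp
    qed (use A in simp)
    then have "w = 0\<^sub>v r" using det det_0_iff_vec_prod_zero_field[OF A] w by blast
    then have "c (e ! b) = 0" if "b < r" for b
      using that by (metis index_vec index_zero_vec(1) w_def)
    then show "\<forall>l\<in>exponents n d. c l = 0" unfolding img[symmetric] by auto
  qed
qed

section \<open>Multihomogeneity of the determinants\<close>

definition has_multidegree :: "nat \<Rightarrow> nat \<Rightarrow> (nat \<Rightarrow> nat) \<Rightarrow> (nat \<times> nat \<Rightarrow>\<^sub>0 nat) \<Rightarrow> bool" where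
  "has_multidegree n N \<delta> m \<longleftrightarrow> Poly_Mapping.keys m \<subseteq> {..<N} \<times> {..n} \<and>
     (\<forall>j<N. (\<Sum>i\<le>n. Poly_Mapping.lookup m (j, i)) = \<delta> j)"

lemma has_multidegree_add:
  "has_multidegree n N \<delta> m \<Longrightarrow> has_multidegree n N \<delta>' m' \<Longrightarrow> has_multidegree n N (\<lambda>j. \<delta> j + \<delta>' j) (m + m')"
  unfolding has_multidegree_def using keys_add[of m m'] by (auto simp: lookup_add sum.distrib)

lemma multihomogeneousI: "supported_on (has_multidegree n N \<delta>) f \<Longrightarrow> multihomogeneous n N f"
  unfolding multihomogeneous_def supported_on_def has_multidegree_def vars_def by blast

lemma multidegree_one: "supported_on (has_multidegree n N (\<lambda>_. 0)) (1 :: (nat \<times> nat, 'k::comm_ring_1) mpoly)"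
  unfolding single_one[symmetric] by (intro supported_on_single) (simp add: has_multidegree_def)

lemma multidegree_prod:
  assumes "\<And>t. t \<in> T \<Longrightarrow> supported_on (has_multidegree n N (\<delta> t)) (f t :: (nat \<times> nat, 'k::comm_ring_1) mpoly)"
  shows "supported_on (has_multidegree n N (\<lambda>j. \<Sum>t\<in>T. \<delta> t j)) (\<Prod>t\<in>T. f t)"
  using assms
proof (induction T rule: infinite_finite_induct)
  case (insert t T)
  have "supported_on (has_multidegree n N (\<lambda>j. \<delta> t j + (\<Sum>t\<in>T. \<delta> t j))) (f t * (\<Prod>t\<in>T. f t))"
  proof (rule supported_on_mult)
    show "supported_on (has_multidegree n N (\<delta> t)) (f t)" using insert.prems by simp
    show "supported_on (has_multidegree n N (\<lambda>j. \<Sum>t\<in>T. \<delta> t j)) (\<Prod>t\<in>T. f t)"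
      using insert by simp
  qed (rule has_multidegree_add)
  then show ?case using insert.hyps by simp
qed (use multidegree_one in auto)

lemma multidegree_variable:
  "j < N \<Longrightarrow> i \<le> n \<Longrightarrow> supported_on (has_multidegree n N (\<lambda>j'. if j' = j then 1 else 0)) (variable (j, i))"
  unfolding variable_def by (intro supported_on_single) (auto simp: has_multidegree_def lookup_single when_def)

lemma multidegree_power_product:
  assumes "j < N" "length l = Suc n"
  shows "supported_on (has_multidegree n N (\<lambda>j'. if j' = j then sum_list l else 0))
    (power_product (\<lambda>i. variable (j, i) :: (nat \<times> nat, 'k::comm_ring_1) mpoly) l)"
proof -
  have "supported_on (has_multidegree n N (\<lambda>j'. \<Sum>i<length l. \<Sum>s<l ! i. if j' = j then 1 else 0))
      (\<Prod>i<length l. \<Prod>s<l ! i. variable (j, i) :: (nat \<times> nat, 'k) mpoly)"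
    using assms by (intro multidegree_prod multidegree_variable) auto
  moreover have "(\<lambda>j'. \<Sum>i<length l. \<Sum>s<l ! i. if j' = j then 1 else 0) = (\<lambda>j'. if j' = j then sum_list l else 0)"
    by (auto simp: fun_eq_iff sum_list_sum_nth atLeast0LessThan)
  ultimately show ?thesis by (simp add: power_product_def)
qed

text \<open>Each summand of the determinant takes one entry from every row, and the row of a point
  consists of monomials of degree \<open>d\<close> in the coordinates of that point. So all summands
  share one multidegree.\<close>

lemma multidegree_det:
  assumes "finite T" "T \<subseteq> {..<N}" "card T \<le> card (exponents n d)"
  shows "supported_on (has_multidegree n N (\<lambda>j. if j \<in> T then d else 0))
    (det (condition_matrix n d T (\<lambda>j i. variable (j, i) :: (nat \<times> nat, 'k::comm_ring_1) mpoly)))"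
proof -
  define r where "r = card T"
  define t where "t = sorted_list_of_set T"
  define A where "A = condition_matrix n d T (\<lambda>j i. variable (j, i) :: (nat \<times> nat, 'k::comm_ring_1) mpoly)"
  have t: "set t = T" "length t = r" "distinct t" unfolding t_def r_def using assms(1) by auto
  have A: "A \<in> carrier_mat r r" by (simp add: A_def condition_matrix_def r_def)
  have deg: "(\<lambda>j. \<Sum>a\<in>{0..<r}. if j = t ! a then d else 0) = (\<lambda>j. if j \<in> T then d else 0)"
  proof
    fix j
    have inj: "inj_on ((!) t) {0..<r}" using t(2,3) by (auto simp: inj_on_def nth_eq_iff_index_eq)
    have img: "(!) t ` {0..<r} = T" using t(1,2) by (auto simp: in_set_conv_nth simp flip: t(1))
    have "(\<Sum>a\<in>{0..<r}. if j = t ! a then d else 0) = (\<Sum>q\<in>T. if j = q then d else 0)"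
      unfolding img[symmetric] by (simp add: sum.reindex[OF inj])
    also have "\<dots> = (if j \<in> T then d else 0)" using assms(1) by simp
    finally show "(\<Sum>a\<in>{0..<r}. if j = t ! a then d else 0) = (if j \<in> T then d else 0)" .
  qed
  have "supported_on (has_multidegree n N (\<lambda>j. if j \<in> T then d else 0)) (\<Prod>a = 0..<r. A $$ (a, p a))"
    if p: "p permutes {0..<r}" for p
    unfolding deg[symmetric]
  proof (rule multidegree_prod)
    fix a assume a: "a \<in> {0..<r}"
    then have pa: "p a < r" using permutes_in_image[OF p] by auto
    have "exponent_list n d ! p a \<in> exponents n d"
      using pa assms(3) exponent_list(2)[of n d] length_exponent_list[of n d] unfolding r_def
      by (metis nth_mem order.strict_trans2)
    then have l: "length (exponent_list n d ! p a) = Suc n" "sum_list (exponent_list n d ! p a) = d"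
      by (auto simp: exponents_def)
    have "t ! a \<in> T" using a t nth_mem by fastforce
    then have "t ! a < N" using assms(2) by blast
    have "A $$ (a, p a) = power_product (\<lambda>i. variable (t ! a, i)) (exponent_list n d ! p a)"
      using a pa by (simp add: A_def condition_matrix_def r_def t_def)
    then show "supported_on (has_multidegree n N (\<lambda>j. if j = t ! a then d else 0)) (A $$ (a, p a))"
      using multidegree_power_product[OF \<open>t ! a < N\<close> l(1), where 'k = 'k, unfolded l(2)] by (simp only:)
  qed
  then have "supported_on (has_multidegree n N (\<lambda>j. if j \<in> T then d else 0))
      (\<Sum>p\<in>{p. p permutes {0..<r}}. signof p * (\<Prod>a = 0..<r. A $$ (a, p a)))"
    by (intro supported_on_sum) (auto simp: sign_def intro: supported_on_uminus)
  then show ?thesis unfolding det_def'[OF A, unfolded A_def] A_def .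
qed

text \<open>In matrix terms, generalized Vandermonde determinants with exponents from
  \<open>X\<close> are nonzero. The values are chosen one after another: with one exponent more than
  points, the hypothesis leaves at most one relation up to scaling, so for each of finitely many
  pairs the next value has to avoid the roots of at most one nonzero polynomial.\<close>

lemma sparse_polynomials_independent:
  assumes inf: "infinite (UNIV :: 'k::field set)" and X: "finite X"
  shows "\<exists>z :: nat \<Rightarrow> 'k. (\<forall>q<N. z q \<noteq> 0) \<and>
    (\<forall>T M c. T \<subseteq> {..<N} \<longrightarrow> M \<subseteq> X \<longrightarrow> card M \<le> card T \<longrightarrow>
      (\<forall>q\<in>T. (\<Sum>e\<in>M. c e * z q ^ e) = 0) \<longrightarrow> (\<forall>e\<in>M. c e = 0))"
proof (induction N)
  case 0
  show ?case using finite_subset[OF _ X] by (auto simp: card_eq_0_iff)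
next
  case (Suc N)
  then obtain z :: "nat \<Rightarrow> 'k" where z: "\<forall>q<N. z q \<noteq> 0"
    and indep: "\<And>T M c. \<lbrakk>T \<subseteq> {..<N}; M \<subseteq> X; card M \<le> card T; \<forall>q\<in>T. (\<Sum>e\<in>M. c e * z q ^ e) = 0\<rbrakk>
        \<Longrightarrow> \<forall>e\<in>M. c e = 0"
    by blast
  define bad where "bad T M = {x. \<exists>c. (\<forall>q\<in>T. (\<Sum>e\<in>M. c e * z q ^ e) = 0) \<and> (\<exists>e\<in>M. c e \<noteq> 0) \<and>
      (\<Sum>e\<in>M. c e * x ^ e) = 0}" for T and M :: "nat set"
  have "finite (bad T M)" if TM: "T \<subseteq> {..<N}" "M \<subseteq> X" "card M = Suc (card T)" for T M
  proof (cases "\<exists>c. (\<forall>q\<in>T. (\<Sum>e\<in>M. c e * z q ^ e) = 0) \<and> (\<exists>e\<in>M. c e \<noteq> 0)")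
    case True
    then obtain c e0 where c: "\<forall>q\<in>T. (\<Sum>e\<in>M. c e * z q ^ e) = 0" "e0 \<in> M" "c e0 \<noteq> 0" by blast
    have M: "finite M" using TM(2) X finite_subset by blast
    define p where "p = (\<Sum>e\<in>M. monom (c e) e)"
    have "coeff p e0 = c e0" using M c(2) by (simp add: p_def coeff_sum)
    then have "p \<noteq> 0" using c(3) by auto
    have "poly p x = 0" if x: "x \<in> bad T M" for x
    proof -
      obtain c' where c': "\<forall>q\<in>T. (\<Sum>e\<in>M. c' e * z q ^ e) = 0" "\<exists>e\<in>M. c' e \<noteq> 0" "(\<Sum>e\<in>M. c' e * x ^ e) = 0"
        using x unfolding bad_def by blast
      \<comment> \<open>Subtracting this multiple removes the exponent \<open>e0\<close>; the
        hypothesis for one exponent fewer makes the difference vanish.\<close>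
      define \<mu> where "\<mu> = c' e0 / c e0"
      have sum_M: "(\<Sum>e\<in>M - {e0}. (c' e - \<mu> * c e) * y ^ e) = (\<Sum>e\<in>M. c' e * y ^ e) - \<mu> * (\<Sum>e\<in>M. c e * y ^ e)" for y
      proof -
        have "(\<Sum>e\<in>M. (c' e - \<mu> * c e) * y ^ e) = (\<Sum>e\<in>M - {e0}. (c' e - \<mu> * c e) * y ^ e)"
          using M c(2,3) by (simp add: sum.remove[of M e0] \<mu>_def)
        then show ?thesis by (simp add: left_diff_distrib sum_subtractf sum_distrib_left mult.assoc)
      qed
      have "\<forall>e\<in>M - {e0}. c' e - \<mu> * c e = 0"
      proof (rule indep[OF TM(1), of "M - {e0}" "\<lambda>e. c' e - \<mu> * c e"])
        show "M - {e0} \<subseteq> X" using TM(2) by blast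
        show "card (M - {e0}) \<le> card T" using TM(3) c(2) M by simp
        show "\<forall>q\<in>T. (\<Sum>e\<in>M - {e0}. (c' e - \<mu> * c e) * z q ^ e) = 0"
          unfolding sum_M using c(1) c'(1) by simp
      qed
      then have proportional: "c' e = \<mu> * c e" if "e \<in> M" for e using that c(3) by (cases "e = e0") (auto simp: \<mu>_def)
      then have "\<mu> \<noteq> 0" using c'(2) by auto
      moreover have "(\<Sum>e\<in>M. c' e * x ^ e) = \<mu> * poly p x"
        by (simp add: p_def poly_sum poly_monom sum_distrib_left proportional mult.assoc)
      ultimately show ?thesis using c'(3) by simp
    qed
    then have "bad T M \<subseteq> {x. poly p x = 0}" by blast
    then show ?thesis using poly_roots_finite[OF \<open>p \<noteq> 0\<close>] finite_subset by blast
  next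
    case False
    then have "bad T M = {}" unfolding bad_def by blast
    then show ?thesis by simp
  qed
  moreover have "finite {(T, M). T \<subseteq> {..<N} \<and> M \<subseteq> X \<and> card M = Suc (card T)}"
    by (rule finite_subset[of _ "Pow {..<N} \<times> Pow X"]) (use X in auto)
  ultimately have "finite (insert 0 (\<Union>(T, M)\<in>{(T, M). T \<subseteq> {..<N} \<and> M \<subseteq> X \<and> card M = Suc (card T)}. bad T M))"
    by auto
  then obtain y where y: "y \<notin> insert 0 (\<Union>(T, M)\<in>{(T, M). T \<subseteq> {..<N} \<and> M \<subseteq> X \<and> card M = Suc (card T)}. bad T M)"
    using ex_new_if_finite[OF inf] by blast
  define z' where "z' = z(N := y)"
  have z'_old: "z' q = z q" if "q < N" for q using that by (simp add: z'_def)
  have "\<forall>e\<in>M. c e = 0" if T: "T \<subseteq> {..<Suc N}" and M: "M \<subseteq> X" "card M \<le> card T"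
    and c: "\<forall>q\<in>T. (\<Sum>e\<in>M. c e * z' q ^ e) = 0" for T M c
  proof -
    define T0 where "T0 = T - {N}"
    have T0: "T0 \<subseteq> {..<N}" using T unfolding T0_def by (auto simp: less_Suc_eq)
    have c0: "\<forall>q\<in>T0. (\<Sum>e\<in>M. c e * z q ^ e) = 0"
    proof
      fix q assume q: "q \<in> T0"
      then have "z' q = z q" using T0 by (intro z'_old) auto
      then show "(\<Sum>e\<in>M. c e * z q ^ e) = 0" using c q unfolding T0_def by auto
    qed
    show ?thesis
    proof (cases "card M \<le> card T0")
      case True
      then show ?thesis by (rule indep[OF T0 M(1) _ c0])
    next
      case False
      have finT: "finite T" using T finite_subset by blast
      have NT: "N \<in> T"
      proof (rule ccontr)
        assume "N \<notin> T"
        then have "T0 = T" unfolding T0_def by blast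
        then show False using False M(2) by simp
      qed
      then have "card T = Suc (card T0)" unfolding T0_def using card.remove[OF finT NT] by simp
      then have cM: "card M = Suc (card T0)" using False M(2) by linarith
      have "y \<notin> bad T0 M" using y T0 M(1) cM by auto
      moreover have "(\<Sum>e\<in>M. c e * y ^ e) = 0" using c NT by (auto simp: z'_def)
      ultimately show ?thesis using c0 unfolding bad_def by blast
    qed
  qed
  moreover have "\<forall>q<Suc N. z' q \<noteq> 0" using z y by (auto simp: z'_def less_Suc_eq)
  ultimately show ?case by blast
qed

lemma digits_inject:
  fixes l l' :: "nat list"
  assumes "length l = length l'" "\<forall>x\<in>set l. x < D" "\<forall>x\<in>set l'. x < D"
    "(\<Sum>i<length l. l ! i * D ^ i) = (\<Sum>i<length l'. l' ! i * D ^ i)"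
  shows "l = l'"
  using assms
proof (induction l l' rule: list_induct2)
  case (Cons x xs y ys)
  have shift: "(\<Sum>i<length (x # xs). (x # xs) ! i * D ^ i) = x + D * (\<Sum>i<length xs. xs ! i * D ^ i)" for x and xs :: "nat list"
    by (simp add: sum.lessThan_Suc_shift sum_distrib_left mult_ac del: sum.lessThan_Suc)
  have eq: "x + D * (\<Sum>i<length xs. xs ! i * D ^ i) = y + D * (\<Sum>i<length ys. ys ! i * D ^ i)"
    using Cons.prems(3) unfolding shift .
  have xy: "x < D" "y < D" using Cons.prems by auto
  have "x = y" using arg_cong[OF eq, of "\<lambda>k. k mod D"] xy by simp
  moreover have "D > 0" using xy by simp
  ultimately have "(\<Sum>i<length xs. xs ! i * D ^ i) = (\<Sum>i<length ys. ys ! i * D ^ i)" using eq by simp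
  then show ?case using Cons \<open>x = y\<close> by simp
qed simp

text \<open>
  On the curve with coordinates \<open>z ^ (Suc N ^ i)\<close> distinct monomials of degree at most \<open>N\<close> become
  distinct powers of \<open>z\<close>.
\<close>

lemma exists_point_in_general_position:
  assumes inf: "infinite (UNIV :: 'k::field set)"
  shows "\<exists>v :: nat \<Rightarrow> nat \<Rightarrow> 'k. (\<forall>j<N. v j \<in> coord_vectors n) \<and>
    (\<forall>d\<le>N. \<forall>T\<subseteq>{..<N}. card T \<le> card (exponents n d) \<longrightarrow> det (condition_matrix n d T v) \<noteq> 0)"
proof -
  define ex where "ex l = (\<Sum>i<length l. l ! i * Suc N ^ i)" for l
  define X where "X = (\<Union>d\<le>N. ex ` exponents n d)"
  have "finite X" by (simp add: X_def)
  from sparse_polynomials_independent[OF inf this, of N] obtain z :: "nat \<Rightarrow> 'k" where z: "\<forall>q<N. z q \<noteq> 0"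
    and indep: "\<And>T M c. \<lbrakk>T \<subseteq> {..<N}; M \<subseteq> X; card M \<le> card T; \<forall>q\<in>T. (\<Sum>e\<in>M. c e * z q ^ e) = 0\<rbrakk>
        \<Longrightarrow> \<forall>e\<in>M. c e = 0"
    by blast
  define v where "v j i = (if i \<le> n then z j ^ (Suc N ^ i) else 0)" for j i
  have "v j \<in> coord_vectors n" if "j < N" for j
    using z that by (auto simp: coord_vectors_def v_def intro!: exI[of _ 0])
  moreover have "det (condition_matrix n d T v) \<noteq> 0"
    if d: "d \<le> N" and T: "T \<subseteq> {..<N}" "card T \<le> card (exponents n d)" for d T
  proof
    assume det: "det (condition_matrix n d T v) = 0"
    define r where "r = card T"
    define t where "t = sorted_list_of_set T"
    define e where "e = exponent_list n d"
    define A where "A = condition_matrix n d T v"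
    have finT: "finite T" using T(1) finite_subset by blast
    have t: "set t = T" "length t = r" "distinct t" unfolding t_def r_def using finT by auto
    have e: "distinct e" "set e = exponents n d" "length e = card (exponents n d)"
      unfolding e_def using exponent_list length_exponent_list by auto
    have A: "A \<in> carrier_mat r r" by (simp add: A_def condition_matrix_def r_def)
    have A_index: "A $$ (a, b) = power_product (v (t ! a)) (e ! b)" if "a < r" "b < r" for a b
      using that by (simp add: A_def condition_matrix_def r_def t_def e_def)
    obtain w where w: "w \<in> carrier_vec r" "w \<noteq> 0\<^sub>v r" "A *\<^sub>v w = 0\<^sub>v r"
      using det det_0_iff_vec_prod_zero_field[OF A] unfolding A_def by blast
    have eb: "e ! b \<in> exponents n d" if "b < r" for b
      using that e(2,3) T(2) unfolding r_def by (metis nth_mem order.strict_trans2)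
    have inj_ex: "inj_on ex (exponents n d)"
    proof (rule inj_onI)
      fix l l' assume l: "l \<in> exponents n d" "l' \<in> exponents n d" "ex l = ex l'"
      have small: "\<forall>x\<in>set l. x < Suc N" if "l \<in> exponents n d" for l
        using that d member_le_sum_list[of _ l] by (fastforce simp: exponents_def)
      show "l = l'"
        by (rule digits_inject[of l l' "Suc N"]) (use l small in \<open>auto simp: exponents_def ex_def\<close>)
    qed
    have inj: "inj_on (\<lambda>b. ex (e ! b)) {..<r}"
    proof (rule inj_onI)
      fix b b' assume b: "b \<in> {..<r}" "b' \<in> {..<r}" "ex (e ! b) = ex (e ! b')"
      then have "e ! b = e ! b'" using inj_onD[OF inj_ex] eb by auto
      then show "b = b'" using e(1,3) b T(2) by (auto simp: r_def nth_eq_iff_index_eq)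
    qed
    define M where "M = (\<lambda>b. ex (e ! b)) ` {..<r}"
    define c where "c k = (\<Sum>b<r. if ex (e ! b) = k then w $ b else 0)" for k
    have c: "c (ex (e ! b)) = w $ b" if "b < r" for b
    proof -
      have "c (ex (e ! b)) = (\<Sum>b'<r. if b' = b then w $ b' else 0)"
        unfolding c_def using inj that by (intro sum.cong) (auto simp: inj_on_def)
      then show ?thesis using that by simp
    qed
    have power_product_v: "power_product (v q) l = z q ^ ex l" if l: "l \<in> exponents n d" for q l
    proof -
      have "power_product (v q) l = (\<Prod>i<length l. z q ^ (l ! i * Suc N ^ i))"
        unfolding power_product_def
      proof (rule prod.cong[OF refl])
        fix i assume "i \<in> {..<length l}"
        then have "i \<le> n" using l by (simp add: exponents_def)
        then show "v q i ^ (l ! i) = z q ^ (l ! i * Suc N ^ i)"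
          by (simp only: v_def if_True power_mult[symmetric] mult.commute)
      qed
      then show ?thesis by (simp only: ex_def power_sum)
    qed
    have "\<forall>k\<in>M. c k = 0"
    proof (rule indep[OF T(1)])
      show "M \<subseteq> X" unfolding M_def X_def using d eb by auto
      show "card M \<le> card T" unfolding M_def r_def using card_image_le[of "{..<card T}"] by fastforce
      show "\<forall>q\<in>T. (\<Sum>k\<in>M. c k * z q ^ k) = 0"
      proof
        fix q assume "q \<in> T"
        then obtain a where a: "a < r" "q = t ! a" using t by (metis in_set_conv_nth)
        have "(\<Sum>k\<in>M. c k * z q ^ k) = (\<Sum>b<r. w $ b * z q ^ ex (e ! b))"
          unfolding M_def by (subst sum.reindex[OF inj]) (simp add: c)
        also have "\<dots> = (\<Sum>b<r. power_product (v q) (e ! b) * w $ b)"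
          using power_product_v eb by (intro sum.cong) (simp_all add: mult.commute)
        also have "\<dots> = (A *\<^sub>v w) $ a"
          using A w(1) a by (auto simp: scalar_prod_def A_index atLeast0LessThan intro!: sum.cong)
        also have "\<dots> = 0" unfolding w(3) using a by simp
        finally show "(\<Sum>k\<in>M. c k * z q ^ k) = 0" .
      qed
    qed
    then have "w $ b = 0" if "b < r" for b using c[OF that] that unfolding M_def by auto
    then have "w = 0\<^sub>v r" using w(1) by (intro eq_vecI) auto
    then show False using w(2) by blast
  qed
  ultimately show ?thesis by blast
qed

text \<open>The excluded locus is one hypersurface, given by the product of finitely many
  determinants. A point off it has coordinate vectors at which no determinant vanishes; the points
  on the monomial curve show that the open set is nonempty.\<close>

lemma zariski_open_general_position:
  assumes inf: "infinite (UNIV :: 'k::field set)"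
  shows "\<exists>U :: (nat \<Rightarrow> 'k proj_point) set. zariski_open n N U \<and> U \<noteq> {} \<and>
    (\<forall>Q\<in>U. Q \<in> proj_power n N \<and> (\<exists>v. (\<forall>j<N. v j \<in> Q j) \<and> general_position n N v))"
proof -
  define I where "I = {(d, T). d \<le> N \<and> T \<subseteq> {..<N} \<and> card T \<le> card (exponents n d)}"
  define g :: "nat \<times> nat set \<Rightarrow> (nat \<times> nat, 'k) mpoly"
    where "g = (\<lambda>(d, T). det (condition_matrix n d T (\<lambda>j i. variable (j, i))))"
  define f where "f = (\<Prod>p\<in>I. g p)"
  have "finite I" by (rule finite_subset[of _ "{..N} \<times> Pow {..<N}"]) (auto simp: I_def)
  have "supported_on (has_multidegree n N (\<lambda>j. \<Sum>p\<in>I. if j \<in> snd p then fst p else 0)) f"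
    unfolding f_def
  proof (rule multidegree_prod)
    fix p assume "p \<in> I"
    then obtain d T where p: "p = (d, T)" "T \<subseteq> {..<N}" "card T \<le> card (exponents n d)"
      unfolding I_def by blast
    have "finite T" using p(2) finite_subset by blast
    from multidegree_det[OF this p(2,3), where 'k = 'k]
    have "supported_on (has_multidegree n N (\<lambda>j. if j \<in> T then d else 0)) (g p)"
      unfolding g_def p(1) prod.case .
    then show "supported_on (has_multidegree n N (\<lambda>j. if j \<in> snd p then fst p else 0)) (g p)"
      unfolding p(1) fst_conv snd_conv .
  qed
  then have hom: "multihomogeneous n N f" by (rule multihomogeneousI)
  have eval: "eval_poly (\<lambda>(j, i). v j i) f = (\<Prod>(d, T)\<in>I. det (condition_matrix n d T v))" for v
  proof -
    define w where "w = (\<lambda>(j, i). v j i)"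
    interpret h: comm_ring_hom "at_point.ins w" by (rule at_point.ins_hom)
    have "at_point.ins w (det (condition_matrix n d T (\<lambda>j i. variable (j, i)))) = det (condition_matrix n d T v)" for d T
    proof -
      have "map_mat (at_point.ins w) (condition_matrix n d T (\<lambda>j i. variable (j, i))) = condition_matrix n d T v"
        by (rule eq_matI) (auto simp: condition_matrix_def power_product_def at_point.ins_prod at_point.ins_power w_def)
      then show ?thesis by (simp flip: h.hom_det)
    qed
    then show ?thesis
      unfolding eval_poly_eq w_def[symmetric] f_def at_point.ins_prod g_def by (intro prod.cong) auto
  qed
  define U where "U = proj_power n N - zero_locus n N {f}"
  have open_U: "zariski_open n N U" unfolding zariski_open_def U_def using hom by (intro exI[of _ "{f}"]) auto
  have gen: "Q \<in> proj_power n N \<and> (\<exists>v. (\<forall>j<N. v j \<in> Q j) \<and> general_position n N v)" if Q: "Q \<in> U" for Q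
  proof -
    obtain v where v: "\<forall>j<N. v j \<in> Q j" "eval_poly (\<lambda>(j, i). v j i) f \<noteq> 0"
      using Q unfolding U_def zero_locus_def by auto
    have "general_position n N v"
      using v(2) \<open>finite I\<close> unfolding eval by (intro general_positionI) (auto simp: I_def)
    then show ?thesis using v(1) Q unfolding U_def by blast
  qed
  obtain v :: "nat \<Rightarrow> nat \<Rightarrow> 'k" where v: "\<forall>j<N. v j \<in> coord_vectors n"
    "\<forall>d\<le>N. \<forall>T\<subseteq>{..<N}. card T \<le> card (exponents n d) \<longrightarrow> det (condition_matrix n d T v) \<noteq> 0"
    using exists_point_in_general_position[OF inf, of N n] by blast
  define Q where "Q = (\<lambda>j\<in>{..<N}. proportional `` {v j})"
  have "Q \<in> proj_power n N"
    unfolding proj_power_def Q_def proj_space_def using v(1) by (auto intro!: quotientI)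
  moreover have "\<forall>j<N. v j \<in> Q j" by (auto simp: Q_def proportional_def intro!: exI[of _ 1])
  moreover have "eval_poly (\<lambda>(j, i). v j i) f \<noteq> 0"
    unfolding eval using v(2) \<open>finite I\<close> by (auto simp: I_def)
  ultimately have "Q \<in> U" unfolding U_def zero_locus_def by auto
  then show ?thesis using open_U gen by blast
qed

section \<open>The coordinate ring of a set of points\<close>

definition ring_variables :: "nat \<Rightarrow> (nat + nat) set" where
  "ring_variables n = Inl ` {..1} \<union> Inr ` {..n}"

definition degree_x :: "(nat + nat \<Rightarrow>\<^sub>0 nat) \<Rightarrow> nat" where
  "degree_x m = (\<Sum>i\<le>1. Poly_Mapping.lookup m (Inl i))"

definition degree_y :: "nat \<Rightarrow> (nat + nat \<Rightarrow>\<^sub>0 nat) \<Rightarrow> nat" where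
  "degree_y n m = (\<Sum>j\<le>n. Poly_Mapping.lookup m (Inr j))"

definition has_bidegree :: "nat \<Rightarrow> nat \<Rightarrow> nat \<Rightarrow> (nat + nat \<Rightarrow>\<^sub>0 nat) \<Rightarrow> bool" where
  "has_bidegree n i j m \<longleftrightarrow> Poly_Mapping.keys m \<subseteq> ring_variables n \<and> degree_x m = i \<and> degree_y n m = j"

lemma has_bidegree_add:
  "has_bidegree n i j m \<Longrightarrow> has_bidegree n k l m' \<Longrightarrow> has_bidegree n (i + k) (j + l) (m + m')"
  unfolding has_bidegree_def degree_x_def degree_y_def using keys_add[of m m']
  by (auto simp: lookup_add sum.distrib)

lemma bidegree_mult:
  "supported_on (has_bidegree n i j) f \<Longrightarrow> supported_on (has_bidegree n k l) g \<Longrightarrow>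
    supported_on (has_bidegree n (i + k) (j + l)) (f * g)"
  using supported_on_mult[of "has_bidegree n i j" f "has_bidegree n k l" g "has_bidegree n (i + k) (j + l)"]
    has_bidegree_add by blast

lemma bidegree_const: "supported_on (has_bidegree n 0 0) (Poly_Mapping.single 0 c)"
  by (rule supported_on_single) (simp add: has_bidegree_def degree_x_def degree_y_def)

lemma bidegree_x: "i \<le> 1 \<Longrightarrow> supported_on (has_bidegree n 1 0) (variable (Inl i))"
  unfolding variable_def
  by (rule supported_on_single)
    (auto simp: has_bidegree_def degree_x_def degree_y_def ring_variables_def lookup_single when_def)

lemma bidegree_y: "j \<le> n \<Longrightarrow> supported_on (has_bidegree n 0 1) (variable (Inr j))"
  unfolding variable_def
  by (rule supported_on_single)
    (auto simp: has_bidegree_def degree_x_def degree_y_def ring_variables_def lookup_single when_def)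

lemma bidegree_zero_imp:
  assumes "has_bidegree n 0 0 m"
  shows "m = 0"
proof (rule poly_mapping_eqI)
  fix v
  have "\<forall>i\<in>{..1}. Poly_Mapping.lookup m (Inl i) = 0" "\<forall>j\<in>{..n}. Poly_Mapping.lookup m (Inr j) = 0"
    using assms unfolding has_bidegree_def degree_x_def degree_y_def
    by (auto simp only: sum_eq_0_iff finite_atMost)
  then have "Poly_Mapping.lookup m v = 0" if "v \<in> ring_variables n"
    using that unfolding ring_variables_def by (elim UnE imageE) simp_all
  moreover have "Poly_Mapping.lookup m v = 0" if "v \<notin> ring_variables n"
    using that assms by (auto simp: has_bidegree_def simp flip: not_in_keys_iff_lookup_eq_zero)
  ultimately show "Poly_Mapping.lookup m v = Poly_Mapping.lookup 0 v" by auto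
qed

lemma carrier_coord_ring:
  "f \<in> carrier (coord_ring n) \<longleftrightarrow> supported_on (\<lambda>m. Poly_Mapping.keys m \<subseteq> ring_variables n) f"
  by (auto simp: coord_ring_def vars_def supported_on_def ring_variables_def)

lemma coord_ring_simps [simp]:
  "mult (coord_ring n) = (*)" "one (coord_ring n) = 1" "zero (coord_ring n) = 0" "add (coord_ring n) = (+)"
  by (simp_all add: coord_ring_def)

lemma bidegree_carrier: "supported_on (has_bidegree n i j) f \<Longrightarrow> f \<in> carrier (coord_ring n)"
  unfolding carrier_coord_ring supported_on_def has_bidegree_def by blast

lemma coord_ring_closed:
  assumes "f \<in> carrier (coord_ring n)" "g \<in> carrier (coord_ring n)"
  shows "f + g \<in> carrier (coord_ring n)" "f * g \<in> carrier (coord_ring n)" "- f \<in> carrier (coord_ring n)"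
proof -
  show "f + g \<in> carrier (coord_ring n)" "- f \<in> carrier (coord_ring n)"
    using assms unfolding carrier_coord_ring by (auto intro: supported_on_add supported_on_uminus)
  show "f * g \<in> carrier (coord_ring n)"
    using assms unfolding carrier_coord_ring
  proof (rule supported_on_mult)
    fix m m' :: "nat + nat \<Rightarrow>\<^sub>0 nat"
    assume "Poly_Mapping.keys m \<subseteq> ring_variables n" "Poly_Mapping.keys m' \<subseteq> ring_variables n"
    then show "Poly_Mapping.keys (m + m') \<subseteq> ring_variables n" using keys_add[of m m'] by blast
  qed
qed

lemma cring_coord_ring: "cring (coord_ring n :: (nat + nat, 'k::field) mpoly ring)"
proof (rule cringI)
  have one: "1 \<in> carrier (coord_ring n :: (nat + nat, 'k) mpoly ring)"
    unfolding carrier_coord_ring single_one[symmetric] by (rule supported_on_single) simp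
  have zero: "0 \<in> carrier (coord_ring n :: (nat + nat, 'k) mpoly ring)"
    unfolding carrier_coord_ring by simp
  show "abelian_group (coord_ring n :: (nat + nat, 'k) mpoly ring)"
  proof (rule abelian_groupI)
    fix f :: "(nat + nat, 'k) mpoly" assume f: "f \<in> carrier (coord_ring n)"
    show "\<exists>g\<in>carrier (coord_ring n). g \<oplus>\<^bsub>coord_ring n\<^esub> f = \<zero>\<^bsub>coord_ring n\<^esub>"
      using coord_ring_closed(3)[OF f f] by (intro bexI[of _ "- f"]) auto
  qed (use zero in \<open>auto simp: coord_ring_closed add_ac\<close>)
  show "comm_monoid (coord_ring n :: (nat + nat, 'k) mpoly ring)"
    by (rule comm_monoidI) (use one in \<open>auto simp: coord_ring_closed mult_ac\<close>)
qed (auto simp: distrib_right)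

definition component :: "nat \<Rightarrow> nat \<times> nat \<Rightarrow> (nat + nat, 'k::field) mpoly \<Rightarrow> (nat + nat, 'k) mpoly" where
  "component n ij f = (\<Sum>m\<in>{m \<in> Poly_Mapping.keys f. (degree_x m, degree_y n m) = ij}.
     Poly_Mapping.single m (Poly_Mapping.lookup f m))"

lemma component_bidegree:
  assumes "f \<in> carrier (coord_ring n)"
  shows "supported_on (has_bidegree n i j) (component n (i, j) f)"
  unfolding component_def
  by (intro supported_on_sum supported_on_single)
    (use assms in \<open>auto simp: carrier_coord_ring supported_on_def has_bidegree_def\<close>)

lemma sum_components:
  "f = (\<Sum>ij\<in>(\<lambda>m. (degree_x m, degree_y n m)) ` Poly_Mapping.keys f. component n ij f)"
  unfolding component_def
  by (subst sum.group) (auto intro: mpoly_eq_sum_single)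

lemma monom_monom_mult: "monom (monom (c :: 'k::comm_ring_1) i) j * monom (monom d k) l = monom (monom (c * d) (i + k)) (j + l)"
  by (simp add: mult_monom)

lemma monom_monom_power: "monom (monom (c :: 'k::comm_ring_1) i) j ^ r = monom (monom (c ^ r) (i * r)) (j * r)"
  by (simp add: monom_power)

lemma monom_sum: "monom (\<Sum>t\<in>T. c t) k = (\<Sum>t\<in>T. monom (c t) k)"
  by (induction T rule: infinite_finite_induct) (auto simp: add_monom[symmetric])

lemma coeff_sum_monom_monom:
  assumes "finite T"
  shows "coeff (coeff (\<Sum>(k, l)\<in>T. monom (monom (c (k, l) :: 'k::comm_ring_1) k) l) j) i =
    (if (i, j) \<in> T then c (i, j) else 0)"
proof -
  have "coeff (coeff (\<Sum>(k, l)\<in>T. monom (monom (c (k, l)) k) l) j) i =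
      (\<Sum>t\<in>T. coeff (coeff (monom (monom (c t) (fst t)) (snd t)) j) i)"
    by (simp only: coeff_sum case_prod_unfold prod.collapse)
  also have "\<dots> = (\<Sum>t\<in>T. if t = (i, j) then c t else 0)"
    by (rule sum.cong) (auto simp: prod_eq_iff)
  also have "\<dots> = (if (i, j) \<in> T then c (i, j) else 0)"
    using assms by (simp add: sum.delta)
  finally show ?thesis .
qed

lemma monom_monom_prod:
  "(\<Prod>t\<in>T. monom (monom (c t :: 'k::comm_ring_1) (i t)) (j t)) = monom (monom (\<Prod>t\<in>T. c t) (\<Sum>t\<in>T. i t)) (\<Sum>t\<in>T. j t)"
proof (induction T rule: infinite_finite_induct)
  case (insert t T)
  then show ?case by (simp add: monom_monom_mult)
qed (simp_all add: monom_0 one_pCons)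

section \<open>Evaluation at the points as a graded homomorphism\<close>

interpretation lift: substitution "\<lambda>c::'k::field. [:[:c:]:]" v for v :: "'v \<Rightarrow> 'k::field poly poly"
  by unfold_locales (auto simp: one_pCons)

lemma proj_space_elem:
  assumes "P \<in> proj_space n" "v \<in> P"
  shows "v \<in> coord_vectors n" "w \<in> P \<longleftrightarrow> (\<exists>c. c \<noteq> 0 \<and> w = (\<lambda>i. c * v i))"
proof -
  obtain u where u: "u \<in> coord_vectors n" "P = proportional `` {u}"
    using assms(1) unfolding proj_space_def quotient_def by blast
  then obtain c where c: "c \<noteq> 0" "v = (\<lambda>i. c * u i)" using assms(2) by (auto simp: proportional_def)
  show "v \<in> coord_vectors n" using u(1) c by (auto simp: coord_vectors_def)
  show "w \<in> P \<longleftrightarrow> (\<exists>c. c \<noteq> 0 \<and> w = (\<lambda>i. c * v i))"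
  proof
    assume "w \<in> P"
    then obtain d where "d \<noteq> 0" "w = (\<lambda>i. d * u i)" using u by (auto simp: proportional_def)
    then show "\<exists>c. c \<noteq> 0 \<and> w = (\<lambda>i. c * v i)" using c by (intro exI[of _ "d / c"]) auto
  next
    assume "\<exists>c. c \<noteq> 0 \<and> w = (\<lambda>i. c * v i)"
    then obtain d where "d \<noteq> 0" "w = (\<lambda>i. d * v i)" by blast
    then show "w \<in> P" using u c by (auto simp: proportional_def intro!: exI[of _ "d * c"])
  qed
qed

text \<open>Points are index pairs in \<open>E\<close>, with coordinate vectors \<open>a p\<close>
  and \<open>b q\<close>; \<alpha> and \<beta> are the coefficients of the two linear forms. As
  these have value one, multiplication by them leaves a function on the points unchanged, and the
  spaces \<open>V\<close> increase.\<close>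

locale configuration =
  fixes n :: nat and E :: "(nat \<times> nat) set" and a b :: "nat \<Rightarrow> nat \<Rightarrow> 'k::field" and \<alpha> \<beta> :: "nat \<Rightarrow> 'k"
  assumes finite_E: "finite E" and E_nonempty: "E \<noteq> {}"
    and normalized_x: "(p, q) \<in> E \<Longrightarrow> (\<Sum>i\<le>1. \<alpha> i * a p i) = 1"
    and normalized_y: "(p, q) \<in> E \<Longrightarrow> (\<Sum>j\<le>n. \<beta> j * b q j) = 1"
begin

definition pt :: "nat \<times> nat \<Rightarrow> nat + nat \<Rightarrow> 'k" where
  "pt x = case_sum (a (fst x)) (b (snd x))"

definition ev :: "(nat + nat, 'k) mpoly \<Rightarrow> nat \<times> nat \<Rightarrow> 'k" where
  "ev f = (\<lambda>x. if x \<in> E then eval_poly (pt x) f else 0)"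

definition V :: "nat \<Rightarrow> nat \<Rightarrow> (nat \<times> nat \<Rightarrow> 'k) set" where
  "V i j = {ev f | f. supported_on (has_bidegree n i j) f}"

text \<open>Coordinate vectors scaled by \<open>s\<close> in the first factor and by
  \<open>u\<close> in the second. A form of bidegree (i, j) takes its value times s^i u^j there, so
  the bihomogeneous parts are read off as coefficients.\<close>

definition generic_pt :: "nat \<times> nat \<Rightarrow> nat + nat \<Rightarrow> 'k poly poly" where
  "generic_pt x v = (case v of Inl i \<Rightarrow> monom (monom (pt x v) 1) 0 | Inr j \<Rightarrow> monom (monom (pt x v) 0) 1)"

definition \<Psi> :: "(nat + nat, 'k) mpoly \<Rightarrow> nat \<times> nat \<Rightarrow> 'k poly poly" where
  "\<Psi> f = (\<lambda>x. if x \<in> E then lift.ins (generic_pt x) f else 0)"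

lemma V_I: "supported_on (has_bidegree n i j) f \<Longrightarrow> (\<And>x. x \<in> E \<Longrightarrow> \<phi> x = eval_poly (pt x) f) \<Longrightarrow>
    (\<And>x. x \<notin> E \<Longrightarrow> \<phi> x = 0) \<Longrightarrow> \<phi> \<in> V i j"
  unfolding V_def ev_def by (intro CollectI exI[of _ f]) auto

lemma V_E:
  assumes "\<phi> \<in> V i j"
  obtains f where "supported_on (has_bidegree n i j) f" "\<And>x. x \<in> E \<Longrightarrow> \<phi> x = eval_poly (pt x) f"
    "\<And>x. x \<notin> E \<Longrightarrow> \<phi> x = 0"
  using assms unfolding V_def ev_def by auto

lemma monom_value_generic:
  assumes "has_bidegree n i j m"
  shows "monom_value (generic_pt x) m = monom (monom (monom_value (pt x) m) i) j"
proof -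
  define dx dy :: "nat + nat \<Rightarrow> nat" where "dx v = (case v of Inl _ \<Rightarrow> 1 | Inr _ \<Rightarrow> 0)"
    and "dy v = (case v of Inl _ \<Rightarrow> 0 | Inr _ \<Rightarrow> 1)" for v
  let ?X = "ring_variables n" and ?l = "Poly_Mapping.lookup m"
  have X: "finite ?X" "Poly_Mapping.keys m \<subseteq> ?X" using assms by (auto simp: ring_variables_def has_bidegree_def)
  have gen: "generic_pt x v = monom (monom (pt x v) (dx v)) (dy v)" for v
    by (cases v) (auto simp: generic_pt_def dx_def dy_def)
  have split: "(\<Sum>v\<in>?X. w v) = (\<Sum>i\<le>1. w (Inl i)) + (\<Sum>j\<le>n. w (Inr j))" for w :: "nat + nat \<Rightarrow> nat"
    unfolding ring_variables_def by (subst sum.union_disjoint) (auto simp: sum.reindex inj_on_def)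
  have "(\<Sum>v\<in>?X. dx v * ?l v) = i" "(\<Sum>v\<in>?X. dy v * ?l v) = j"
    unfolding split using assms by (auto simp: dx_def dy_def has_bidegree_def degree_x_def degree_y_def)
  then show ?thesis
    unfolding monom_value_superset[OF X] gen monom_monom_power monom_monom_prod by simp
qed

lemma \<Psi>_bidegree:
  assumes "supported_on (has_bidegree n i j) f" "x \<in> E"
  shows "\<Psi> f x = monom (monom (eval_poly (pt x) f) i) j"
proof -
  have "\<Psi> f x = (\<Sum>m\<in>Poly_Mapping.keys f. [:[:Poly_Mapping.lookup f m:]:] * monom_value (generic_pt x) m)"
    using assms(2) by (simp only: \<Psi>_def lift.ins_def if_True)
  also have "\<dots> = (\<Sum>m\<in>Poly_Mapping.keys f. monom (monom (Poly_Mapping.lookup f m * monom_value (pt x) m) i) j)"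
  proof (rule sum.cong[OF refl])
    fix m assume "m \<in> Poly_Mapping.keys f"
    then have "has_bidegree n i j m" using assms(1) by (simp add: supported_on_def)
    then show "[:[:Poly_Mapping.lookup f m:]:] * monom_value (generic_pt x) m =
        monom (monom (Poly_Mapping.lookup f m * monom_value (pt x) m) i) j"
      by (simp add: monom_value_generic smult_monom)
  qed
  also have "\<dots> = monom (monom (eval_poly (pt x) f) i) j"
    by (simp add: eval_poly_eq at_point.ins_def monom_sum)
  finally show ?thesis .
qed

lemma \<Psi>_add: "\<Psi> (f + g) = \<Psi> f + \<Psi> g"
  by (auto simp: \<Psi>_def lift.ins_add fun_eq_iff)

lemma \<Psi>_mult: "\<Psi> (f * g) = \<Psi> f * \<Psi> g"
  by (auto simp: \<Psi>_def lift.ins_mult fun_eq_iff)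

lemma \<Psi>_one: "\<Psi> 1 = (\<lambda>x. if x \<in> E then 1 else 0)"
  by (simp only: \<Psi>_def lift.ins_one)

lemma \<Psi>_zero: "\<Psi> 0 = 0"
  by (simp only: \<Psi>_def lift.ins_zero fun_eq_iff zero_fun_apply if_cancel simp_thms)

lemma \<Psi>_sum: "\<Psi> (\<Sum>t\<in>T. f t) x = (\<Sum>t\<in>T. \<Psi> (f t) x)"
  by (induction T rule: infinite_finite_induct) (auto simp: \<Psi>_add \<Psi>_zero)

lemma coeff_\<Psi>:
  assumes "f \<in> carrier (coord_ring n)" "x \<in> E"
  shows "coeff (coeff (\<Psi> f x) j) i = eval_poly (pt x) (component n (i, j) f)"
proof -
  let ?d = "\<lambda>m. (degree_x m, degree_y n m)"
  have "\<Psi> f x = (\<Sum>ij\<in>?d ` Poly_Mapping.keys f. \<Psi> (component n ij f) x)"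
    by (subst sum_components[of f n]) (rule \<Psi>_sum)
  also have "\<dots> = (\<Sum>(k, l)\<in>?d ` Poly_Mapping.keys f. monom (monom (eval_poly (pt x) (component n (k, l) f)) k) l)"
    using \<Psi>_bidegree[OF component_bidegree[OF assms(1)] assms(2)] by (intro sum.cong) auto
  finally have "coeff (coeff (\<Psi> f x) j) i =
      (if (i, j) \<in> ?d ` Poly_Mapping.keys f then eval_poly (pt x) (component n (i, j) f) else 0)"
    by (simp only: coeff_sum_monom_monom[of "?d ` Poly_Mapping.keys f" "\<lambda>ij. eval_poly (pt x) (component n ij f)"]
        finite_imageI finite_keys)
  also have "\<dots> = eval_poly (pt x) (component n (i, j) f)"
  proof (cases "(i, j) \<in> ?d ` Poly_Mapping.keys f")
    case False
    then have "{m \<in> Poly_Mapping.keys f. ?d m = (i, j)} = {}" by blast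
    then have "component n (i, j) f = 0" unfolding component_def by (simp only: sum.empty)
    then show ?thesis by (simp add: eval_poly_eq)
  qed simp
  finally show ?thesis .
qed

lemma \<Psi>_in: "f \<in> carrier (coord_ring n) \<Longrightarrow> \<Psi> f \<in> graded_functions E V"
  unfolding graded_functions_def
proof (intro CollectI conjI allI impI)
  assume f: "f \<in> carrier (coord_ring n)"
  show "\<Psi> f x = 0" if "x \<notin> E" for x using that by (simp add: \<Psi>_def)
  show "(\<lambda>x. coeff (coeff (\<Psi> f x) j) i) \<in> V i j" for i j
  proof (rule V_I[OF component_bidegree[OF f]])
    show "coeff (coeff (\<Psi> f x) j) i = eval_poly (pt x) (component n (i, j) f)" if "x \<in> E" for x
      by (rule coeff_\<Psi>[OF f that])
  qed (simp add: \<Psi>_def)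
qed

text \<open>Each coefficient function comes from a form of the matching bidegree. The finitely many
  polynomials have a common degree bound \<open>D\<close>, so a finite sum of such forms is a
  preimage.\<close>

lemma \<Psi>_surj: "\<Psi> ` carrier (coord_ring n) = graded_functions E V"
proof (intro equalityI subsetI)
  fix F assume F: "F \<in> graded_functions E V"
  have "\<exists>f. supported_on (has_bidegree n i j) f \<and> (\<forall>x\<in>E. coeff (coeff (F x) j) i = eval_poly (pt x) f)" for i j
  proof -
    have "(\<lambda>x. coeff (coeff (F x) j) i) \<in> V i j" using F by (simp add: graded_functions_def)
    then show ?thesis by (rule V_E) blast
  qed
  then obtain f where f: "\<And>i j. supported_on (has_bidegree n i j) (f i j)"
    "\<And>i j x. x \<in> E \<Longrightarrow> coeff (coeff (F x) j) i = eval_poly (pt x) (f i j)"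
    by metis
  have "\<exists>D. \<forall>x. x \<in> E \<longrightarrow> bidegree_le D (F x)"
    using finite_E
  proof (induction E rule: finite_induct)
    case (insert y E)
    then obtain D where "\<forall>x. x \<in> E \<longrightarrow> bidegree_le D (F x)" by blast
    moreover obtain D' where "bidegree_le D' (F y)" using ex_bidegree_le by blast
    ultimately show ?case
      using bidegree_le_mono[OF _ le_add1] bidegree_le_mono[OF _ le_add2]
      by (intro exI[of _ "D + D'"]) blast
  qed simp
  then obtain D where D: "\<And>x. x \<in> E \<Longrightarrow> bidegree_le D (F x)" by blast
  define g where "g = (\<Sum>(i, j)\<in>{..D} \<times> {..D}. f i j)"
  have "g \<in> carrier (coord_ring n)"
    unfolding g_def carrier_coord_ring
    using bidegree_carrier[OF f(1)] by (intro supported_on_sum) (auto simp: carrier_coord_ring)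
  moreover have "\<Psi> g x = F x" for x
  proof (cases "x \<in> E")
    case True
    have "\<Psi> g x = (\<Sum>(i, j)\<in>{..D} \<times> {..D}. monom (monom (coeff (coeff (F x) j) i) i) j)"
      unfolding g_def \<Psi>_sum using \<Psi>_bidegree[OF f(1) True] f(2)[OF True] by (intro sum.cong) auto
    then have "coeff (coeff (\<Psi> g x) l) k = (if (k, l) \<in> {..D} \<times> {..D} then coeff (coeff (F x) l) k else 0)" for k l
      using coeff_sum_monom_monom[of "{..D} \<times> {..D}" "\<lambda>(i, j). coeff (coeff (F x) j) i" l k] by simp
    then have "coeff (coeff (\<Psi> g x) l) k = coeff (coeff (F x) l) k" for k l
      using D[OF True] unfolding bidegree_le_def by (cases "coeff (coeff (F x) l) k = 0") auto
    then show ?thesis by (intro poly_eqI)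
  next
    case False
    then show ?thesis using F unfolding \<Psi>_def graded_functions_def by (cases x) auto
  qed
  ultimately show "F \<in> \<Psi> ` carrier (coord_ring n)" by (intro image_eqI[of _ _ g]) auto
qed (use \<Psi>_in in auto)

definition graded_ring :: "(nat \<times> nat \<Rightarrow> 'k poly poly) ring" where
  "graded_ring = \<lparr>carrier = graded_functions E V, mult = (*), one = (\<lambda>x. if x \<in> E then 1 else 0),
     zero = 0, add = (+)\<rparr>"

lemma ring_graded_ring: "ring graded_ring"
proof (rule ringI)
  interpret R: cring "coord_ring n :: (nat + nat, 'k) mpoly ring" by (rule cring_coord_ring)
  have closed: "F + G \<in> graded_functions E V" "F * G \<in> graded_functions E V"
    if FG: "F \<in> graded_functions E V" "G \<in> graded_functions E V" for F G
  proof -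
    obtain f g where fg: "F = \<Psi> f" "f \<in> carrier (coord_ring n)" "G = \<Psi> g" "g \<in> carrier (coord_ring n)"
      using FG unfolding \<Psi>_surj[symmetric] by blast
    show "F + G \<in> graded_functions E V" "F * G \<in> graded_functions E V"
      using \<Psi>_in[OF coord_ring_closed(1)[OF fg(2,4)]] \<Psi>_in[OF coord_ring_closed(2)[OF fg(2,4)]]
      unfolding fg(1,3) \<Psi>_add \<Psi>_mult by blast+
  qed
  have zero: "0 \<in> graded_functions E V" using \<Psi>_in[OF R.zero_closed] by (simp add: \<Psi>_zero)
  have one: "(\<lambda>x. if x \<in> E then 1 else 0) \<in> graded_functions E V"
    using \<Psi>_in[OF R.one_closed] by (simp add: \<Psi>_one)
  have off: "F x = 0" if "F \<in> graded_functions E V" "x \<notin> E" for F x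
    using that unfolding graded_functions_def by blast
  show "abelian_group graded_ring"
  proof (rule abelian_groupI)
    fix F assume "F \<in> carrier graded_ring"
    then obtain f where f: "F = \<Psi> f" "f \<in> carrier (coord_ring n)"
      unfolding graded_ring_def \<Psi>_surj[symmetric] by auto
    have "\<Psi> (- f) + F = 0" unfolding f(1) \<Psi>_add[symmetric] by (simp add: \<Psi>_zero)
    moreover have "\<Psi> (- f) \<in> graded_functions E V" by (rule \<Psi>_in[OF coord_ring_closed(3)[OF f(2) f(2)]])
    ultimately show "\<exists>G\<in>carrier graded_ring. G \<oplus>\<^bsub>graded_ring\<^esub> F = \<zero>\<^bsub>graded_ring\<^esub>"
      by (auto simp: graded_ring_def)
  qed (use closed zero in \<open>simp_all add: graded_ring_def add_ac\<close>)
  show "Group.monoid graded_ring"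
    by (rule monoidI) (use closed one off in \<open>auto simp: graded_ring_def mult_ac fun_eq_iff\<close>)
qed (auto simp: graded_ring_def distrib_left distrib_right)

lemma \<Psi>_hom: "ring_hom_ring (coord_ring n) graded_ring \<Psi>"
proof (rule ring_hom_ringI)
  show "ring (coord_ring n :: (nat + nat, 'k) mpoly ring)" using cring_coord_ring cring.axioms(1) by blast
  show "ring graded_ring" by (rule ring_graded_ring)
qed (use \<Psi>_in in \<open>auto simp: graded_ring_def \<Psi>_add \<Psi>_mult \<Psi>_one\<close>)

lemma V_add: "\<phi> \<in> V i j \<Longrightarrow> \<psi> \<in> V i j \<Longrightarrow> (\<lambda>x. \<phi> x + \<psi> x) \<in> V i j"
  by (elim V_E, rule V_I[OF supported_on_add]) (auto simp: eval_poly_eq at_point.ins_add)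

lemma V_mult: "\<phi> \<in> V i j \<Longrightarrow> \<psi> \<in> V k l \<Longrightarrow> (\<lambda>x. \<phi> x * \<psi> x) \<in> V (i + k) (j + l)"
  by (elim V_E, rule V_I[OF bidegree_mult]) (auto simp: eval_poly_eq at_point.ins_mult)

lemma V_const: "(\<lambda>x. if x \<in> E then c else 0) \<in> V 0 0"
  by (rule V_I[OF bidegree_const[of n c]]) (auto simp: eval_poly_eq at_point.ins_single)

lemma V_off: "\<phi> \<in> V i j \<Longrightarrow> x \<notin> E \<Longrightarrow> \<phi> x = 0"
  by (auto elim: V_E)

lemma V_scale: "\<phi> \<in> V i j \<Longrightarrow> (\<lambda>x. c * \<phi> x) \<in> V i j"
proof -
  assume \<phi>: "\<phi> \<in> V i j"
  have "(\<lambda>x. (if x \<in> E then c else 0) * \<phi> x) = (\<lambda>x. c * \<phi> x)" using V_off[OF \<phi>] by auto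
  then show ?thesis using V_mult[OF V_const[of c] \<phi>] by simp
qed

lemma V_sum: "(\<And>t. t \<in> T \<Longrightarrow> \<phi> t \<in> V i j) \<Longrightarrow> (\<lambda>x. \<Sum>t\<in>T. \<phi> t x) \<in> V i j"
proof (induction T rule: infinite_finite_induct)
  case (insert t T)
  then show ?case using V_add[of "\<phi> t" i j "\<lambda>x. \<Sum>t\<in>T. \<phi> t x"] by simp
qed (rule V_I[of i j 0]; simp add: eval_poly_eq)+

lemma V_zero_zero: "\<phi> \<in> V 0 0 \<Longrightarrow> \<exists>c. \<phi> = (\<lambda>x. if x \<in> E then c else 0)"
proof (elim V_E)
  fix f assume f: "supported_on (has_bidegree n 0 0) f" "\<And>x. x \<in> E \<Longrightarrow> \<phi> x = eval_poly (pt x) f"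
    "\<And>x. x \<notin> E \<Longrightarrow> \<phi> x = 0"
  have "Poly_Mapping.keys f \<subseteq> {0}" using f(1) bidegree_zero_imp unfolding supported_on_def by blast
  then have "eval_poly (pt x) f = Poly_Mapping.lookup f 0" for x
    using at_point.ins_superset[of "{0}" f "pt x"] by (simp add: eval_poly_eq)
  then show ?thesis using f(2,3) by (intro exI[of _ "Poly_Mapping.lookup f 0"]) auto
qed

lemma V_x: "i \<le> 1 \<Longrightarrow> (\<lambda>x. if x \<in> E then a (fst x) i else 0) \<in> V 1 0"
  by (rule V_I[OF bidegree_x[of i n]]) (auto simp: eval_poly_eq pt_def)

lemma V_y: "j \<le> n \<Longrightarrow> (\<lambda>x. if x \<in> E then b (snd x) j else 0) \<in> V 0 1"
  by (rule V_I[OF bidegree_y[of j n]]) (auto simp: eval_poly_eq pt_def)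

lemma V_one_x: "(\<lambda>x. if x \<in> E then 1 else 0) \<in> V 1 0"
proof -
  have "(\<lambda>x. \<Sum>i\<le>1. \<alpha> i * (if x \<in> E then a (fst x) i else 0)) \<in> V 1 0"
    by (intro V_sum V_scale V_x) simp
  moreover have "(\<lambda>x. \<Sum>i\<le>1. \<alpha> i * (if x \<in> E then a (fst x) i else 0)) = (\<lambda>x. if x \<in> E then 1 else 0)"
    using normalized_x by (auto simp: fun_eq_iff)
  ultimately show ?thesis by simp
qed

lemma V_one_y: "(\<lambda>x. if x \<in> E then 1 else 0) \<in> V 0 1"
proof -
  have "(\<lambda>x. \<Sum>j\<le>n. \<beta> j * (if x \<in> E then b (snd x) j else 0)) \<in> V 0 1"
    by (intro V_sum V_scale V_y) simp
  moreover have "(\<lambda>x. \<Sum>j\<le>n. \<beta> j * (if x \<in> E then b (snd x) j else 0)) = (\<lambda>x. if x \<in> E then 1 else 0)"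
    using normalized_y by (auto simp: fun_eq_iff)
  ultimately show ?thesis by simp
qed

lemma V_Suc: "V i j \<subseteq> V (Suc i) j" "V i j \<subseteq> V i (Suc j)"
proof -
  have eq: "(\<lambda>x. (if x \<in> E then 1 else 0) * \<phi> x) = \<phi>" if "\<phi> \<in> V i j" for \<phi>
    using V_off[OF that] by auto
  show "V i j \<subseteq> V (Suc i) j" using V_mult[OF V_one_x] eq by force
  show "V i j \<subseteq> V i (Suc j)" using V_mult[OF V_one_y] eq by force
qed

text \<open>An element is killed exactly when all its bihomogeneous components vanish at the chosen
  coordinate vectors. Rescaling these vectors multiplies a bihomogeneous value by a nonzero factor,
  so this is vanishing at the points.\<close>

lemma kernel_eq_vanishing_ideal:
  assumes P: "\<And>p q. (p, q) \<in> E \<Longrightarrow> P p \<in> proj_space 1 \<and> a p \<in> P p"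
    and Q: "\<And>p q. (p, q) \<in> E \<Longrightarrow> Q q \<in> proj_space n \<and> b q \<in> Q q"
  shows "a_kernel (coord_ring n) graded_ring \<Psi> = vanishing_ideal n (point_configuration E P Q)"
proof -
  have kernel: "f \<in> a_kernel (coord_ring n) graded_ring \<Psi> \<longleftrightarrow> f \<in> carrier (coord_ring n) \<and> \<Psi> f = 0" for f
    by (simp add: a_kernel_def' graded_ring_def)
  interpret R: cring "coord_ring n :: (nat + nat, 'k) mpoly ring" by (rule cring_coord_ring)
  note kernel_ideal = ring_hom_ring.kernel_is_ideal[OF \<Psi>_hom]
  let ?X = "point_configuration E P Q"
  define Gen where "Gen = {f \<in> carrier (coord_ring n). bihomogeneous n f \<and> vanishes_on f ?X}"
  have vanish: "vanishes_on f ?X \<longleftrightarrow> (\<forall>x\<in>E. eval_poly (pt x) f = 0)"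
    if f: "supported_on (has_bidegree n i j) f" for f i j
  proof
    assume v: "vanishes_on f ?X"
    show "\<forall>x\<in>E. eval_poly (pt x) f = 0"
    proof
      fix x assume x: "x \<in> E"
      obtain p q where pq: "x = (p, q)" by (cases x)
      have "(P p, Q q) \<in> ?X" using x pq unfolding point_configuration_def by force
      then have "eval_poly (case_sum (a p) (b q)) f = 0"
        using v P[of p q] Q[of p q] x pq unfolding vanishes_on_def by blast
      then show "eval_poly (pt x) f = 0" by (simp add: pt_def pq)
    qed
  next
    assume v: "\<forall>x\<in>E. eval_poly (pt x) f = 0"
    show "vanishes_on f ?X"
      unfolding vanishes_on_def point_configuration_def
    proof (intro ballI, clarify)
      fix p q w w' assume pq: "(p, q) \<in> E" and w: "w \<in> P p" "w' \<in> Q q"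
      obtain c where c: "w = (\<lambda>i. c * a p i)" using proj_space_elem(2) P[OF pq] w(1) by blast
      obtain c' where c': "w' = (\<lambda>j. c' * b q j)" using proj_space_elem(2) Q[OF pq] w(2) by blast
      have "monom_value (case_sum w w') m = c ^ i * c' ^ j * monom_value (pt (p, q)) m"
        if m: "has_bidegree n i j m" for m
      proof -
        let ?l = "Poly_Mapping.lookup m"
        have X: "finite (ring_variables n)" "Poly_Mapping.keys m \<subseteq> ring_variables n"
          using m by (auto simp: ring_variables_def has_bidegree_def)
        have split: "(\<Prod>v\<in>ring_variables n. g v) = (\<Prod>i\<le>1. g (Inl i)) * (\<Prod>j\<le>n. g (Inr j))" for g :: "nat + nat \<Rightarrow> 'k"
          unfolding ring_variables_def by (subst prod.union_disjoint) (auto simp: prod.reindex inj_on_def)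
        have "(\<Prod>k\<le>1. c ^ ?l (Inl k)) = c ^ i" "(\<Prod>k\<le>n. c' ^ ?l (Inr k)) = c' ^ j"
          using m unfolding power_sum[symmetric] by (simp_all only: has_bidegree_def degree_x_def degree_y_def)
        moreover have "monom_value (case_sum w w') m =
            ((\<Prod>k\<le>1. c ^ ?l (Inl k)) * (\<Prod>k\<le>1. a p k ^ ?l (Inl k))) *
            ((\<Prod>k\<le>n. c' ^ ?l (Inr k)) * (\<Prod>k\<le>n. b q k ^ ?l (Inr k)))"
          unfolding monom_value_superset[OF X] split prod.distrib[symmetric] power_mult_distrib[symmetric]
          by (simp only: sum.case c c')
        moreover have "monom_value (pt (p, q)) m = (\<Prod>k\<le>1. a p k ^ ?l (Inl k)) * (\<Prod>k\<le>n. b q k ^ ?l (Inr k))"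
          unfolding monom_value_superset[OF X] split by (simp only: sum.case pt_def fst_conv snd_conv)
        ultimately show ?thesis by (simp only: mult_ac)
      qed
      then have "eval_poly (case_sum w w') f = c ^ i * c' ^ j * eval_poly (pt (p, q)) f"
        using f by (simp add: eval_poly_eq at_point.ins_def supported_on_def sum_distrib_left mult_ac)
      then show "eval_poly (case_sum w w') f = 0" using v pq by simp
    qed
  qed
  have Gen_kernel: "Gen \<subseteq> a_kernel (coord_ring n) graded_ring \<Psi>"
  proof
    fix f assume f: "f \<in> Gen"
    then obtain i j where ij: "supported_on (has_bidegree n i j) f"
      unfolding Gen_def bihomogeneous_def carrier_coord_ring supported_on_def has_bidegree_def
        degree_x_def degree_y_def by blast
    have "\<Psi> f x = 0" for x
    proof (cases "x \<in> E")
      case True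
      then show ?thesis using \<Psi>_bidegree[OF ij True] f vanish[OF ij] by (simp add: Gen_def)
    qed (simp add: \<Psi>_def)
    then show "f \<in> a_kernel (coord_ring n) graded_ring \<Psi>"
      using f by (auto simp: kernel Gen_def fun_eq_iff)
  qed
  have Gen_sub: "Gen \<subseteq> carrier (coord_ring n)" by (auto simp: Gen_def)
  have "Idl\<^bsub>coord_ring n\<^esub> Gen \<subseteq> a_kernel (coord_ring n) graded_ring \<Psi>"
    by (rule R.genideal_minimal[OF kernel_ideal Gen_kernel])
  moreover have "f \<in> Idl\<^bsub>coord_ring n\<^esub> Gen" if f: "f \<in> a_kernel (coord_ring n) graded_ring \<Psi>" for f
  proof -
    have fc: "f \<in> carrier (coord_ring n)" "\<Psi> f = 0" using f by (auto simp: kernel)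
    have "component n ij f \<in> Gen" for ij
    proof -
      obtain i j where ij: "ij = (i, j)" by (cases ij)
      have sup: "supported_on (has_bidegree n i j) (component n ij f)"
        unfolding ij by (rule component_bidegree[OF fc(1)])
      have "eval_poly (pt x) (component n ij f) = 0" if "x \<in> E" for x
        using coeff_\<Psi>[OF fc(1) that, of j i] fc(2) by (simp add: ij)
      then have "vanishes_on (component n ij f) ?X" using vanish[OF sup] by blast
      moreover have "bihomogeneous n (component n ij f)"
        using sup unfolding bihomogeneous_def supported_on_def has_bidegree_def degree_x_def degree_y_def by blast
      ultimately show ?thesis using bidegree_carrier[OF sup] by (simp add: Gen_def)
    qed
    then have mem: "component n ij f \<in> Idl\<^bsub>coord_ring n\<^esub> Gen" for ij
      using R.genideal_self[OF Gen_sub] by blast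
    have "ideal (Idl\<^bsub>coord_ring n\<^esub> Gen) (coord_ring n)" by (rule R.genideal_ideal[OF Gen_sub])
    then have add: "additive_subgroup (Idl\<^bsub>coord_ring n\<^esub> Gen) (coord_ring n)" by (rule ideal.axioms(1))
    have "(\<Sum>ij\<in>T. component n ij f) \<in> Idl\<^bsub>coord_ring n\<^esub> Gen" for T
    proof (induction T rule: infinite_finite_induct)
      case (insert ij T)
      then show ?case using additive_subgroup.a_closed[OF add mem[of ij] insert.IH] by simp
    qed (use additive_subgroup.zero_closed[OF add] in simp_all)
    then show ?thesis by (subst sum_components[of f n])
  qed
  ultimately show ?thesis unfolding vanishing_ideal_def Gen_def by blast
qed

text \<open>The first isomorphism theorem for \<Psi> identifies the quotient ring with the graded
  functions, to which the abstract criterion applies.\<close>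

theorem arithmetically_cohen_macaulay_iff:
  assumes P: "\<And>p q. (p, q) \<in> E \<Longrightarrow> P p \<in> proj_space 1 \<and> a p \<in> P p"
    and Q: "\<And>p q. (p, q) \<in> E \<Longrightarrow> Q q \<in> proj_space n \<and> b q \<in> Q q"
    and stable1: "\<And>i j. K \<le> i \<Longrightarrow> V (Suc i) j \<subseteq> V i j"
    and stable2: "\<And>i j. K \<le> j \<Longrightarrow> V i (Suc j) \<subseteq> V i j"
  shows "arithmetically_cohen_macaulay n (point_configuration E P Q) \<longleftrightarrow>
    (\<forall>i j. V (Suc i) j \<inter> V i (Suc j) \<subseteq> V i j)"
proof -
  interpret \<Psi>: ring_hom_ring "coord_ring n" graded_ring \<Psi> by (rule \<Psi>_hom)
  define A where "A = coord_ring n Quot (a_kernel (coord_ring n) graded_ring \<Psi>)"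
  define h where "h = (\<lambda>C. the_elem (\<Psi> ` C))"
  have A: "cring A" unfolding A_def by (rule ideal.quotient_is_cring[OF \<Psi>.kernel_is_ideal cring_coord_ring])
  have "h \<in> ring_iso A graded_ring"
    unfolding A_def h_def by (rule \<Psi>.FactRing_iso_set) (simp add: graded_ring_def \<Psi>_surj)
  then have h: "bij_betw h (carrier A) (graded_functions E V)"
    "\<And>c d. c \<in> carrier A \<Longrightarrow> d \<in> carrier A \<Longrightarrow> h (c \<otimes>\<^bsub>A\<^esub> d) = h c * h d"
    "\<And>c d. c \<in> carrier A \<Longrightarrow> d \<in> carrier A \<Longrightarrow> h (c \<oplus>\<^bsub>A\<^esub> d) = h c + h d"
    "h \<one>\<^bsub>A\<^esub> = (\<lambda>x. if x \<in> E then 1 else 0)"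
    by (auto simp: ring_iso_def Ring.ring_hom_def graded_ring_def)
  interpret bigraded_ring A E V h K
  proof (rule bigraded_ring.intro[OF A], unfold_locales)
  qed (fact finite_E E_nonempty V_off V_add V_scale V_const V_zero_zero V_mult V_Suc stable1 stable2 h)+
  have "a_kernel (coord_ring n) graded_ring \<Psi> = vanishing_ideal n (point_configuration E P Q)"
    by (rule kernel_eq_vanishing_ideal) (use P Q in blast)+
  then have "arithmetically_cohen_macaulay n (point_configuration E P Q) \<longleftrightarrow> cohen_macaulay A"
    by (simp only: arithmetically_cohen_macaulay_def A_def)
  then show ?thesis using cohen_macaulayI not_cohen_macaulayI by blast
qed

end

section \<open>Counting conditions\<close>

definition monomial_count :: "nat \<Rightarrow> nat \<Rightarrow> nat" where
  "monomial_count n d = (d + n) choose n"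

lemma card_exponents': "card (exponents n d) = monomial_count n d"
  by (simp add: card_exponents monomial_count_def)

lemma monomial_count_gt: "n \<ge> 1 \<Longrightarrow> d < monomial_count n d"
proof (induction n rule: dec_induct)
  case (step n)
  have "monomial_count (Suc n) d = monomial_count n d + ((d + n) choose Suc n)"
    by (simp add: monomial_count_def)
  then show ?case using step.IH by simp
qed (simp add: monomial_count_def)

lemma monomial_count_mono: "d \<le> d' \<Longrightarrow> monomial_count n d \<le> monomial_count n d'"
proof (induction d' rule: dec_induct)
  case (step d')
  have "monomial_count n d' \<le> monomial_count n (Suc d')"
    unfolding monomial_count_def by (cases n) simp_all
  then show ?case using step.IH by simp
qed simp

text \<open>Rescaling a coordinate vector multiplies the values of all forms of degree
  \<open>d\<close> there by one nonzero factor. This carries general position over to the normalized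
  vectors.\<close>

lemma general_position_scale:
  fixes v :: "nat \<Rightarrow> nat \<Rightarrow> 'k::field"
  assumes gen: "general_position n N v" and s: "\<And>q. q < N \<Longrightarrow> s q \<noteq> 0"
    and b: "\<And>q i. q < N \<Longrightarrow> b q i = s q * v q i"
  shows "general_position n N b"
  unfolding general_position_def
proof (intro allI impI)
  fix d T assume dT: "d \<le> N" "T \<subseteq> {..<N}" "card T \<le> card (exponents n d)"
  have power_product_b: "(\<Sum>l\<in>exponents n d. c l * power_product (b q) l) = s q ^ d * (\<Sum>l\<in>exponents n d. c l * power_product (v q) l)"
    if q: "q \<in> T" for c q
  proof -
    have "power_product (b q) l = s q ^ d * power_product (v q) l" if "l \<in> exponents n d" for l
    proof -
      have "sum_list l = (\<Sum>i<length l. l ! i)"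
        using sum_list_sum_nth[of l] by (simp only: atLeast0LessThan)
      moreover have "sum_list l = d" using that by (simp add: exponents_def)
      ultimately have "d = (\<Sum>i<length l. l ! i)" by (simp only:)
      then have "s q ^ d = (\<Prod>i<length l. s q ^ (l ! i))" by (simp only: power_sum)
      then show ?thesis
        using b q dT(2) by (auto simp: power_product_def power_mult_distrib prod.distrib)
    qed
    then show ?thesis by (simp add: sum_distrib_left mult_ac)
  qed
  have s0: "s q ^ d \<noteq> 0" if "q \<in> T" for q using s that dT(2) by auto
  have 1: "\<exists>c. \<forall>q\<in>T. (\<Sum>l\<in>exponents n d. c l * power_product (v q) l) = \<psi> q" for \<psi>
    using gen dT unfolding general_position_def by blast
  have 2: "\<forall>l\<in>exponents n d. c l = 0"
    if "card T = card (exponents n d)" "\<forall>q\<in>T. (\<Sum>l\<in>exponents n d. c l * power_product (v q) l) = 0" for c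
    using gen dT that unfolding general_position_def by blast
  show "(\<forall>\<psi>. \<exists>c. \<forall>q\<in>T. (\<Sum>l\<in>exponents n d. c l * power_product (b q) l) = \<psi> q) \<and>
     (card T = card (exponents n d) \<longrightarrow>
       (\<forall>c. (\<forall>q\<in>T. (\<Sum>l\<in>exponents n d. c l * power_product (b q) l) = 0) \<longrightarrow> (\<forall>l\<in>exponents n d. c l = 0)))"
  proof (intro conjI allI impI)
    fix \<psi> :: "nat \<Rightarrow> 'k"
    obtain c where "\<forall>q\<in>T. (\<Sum>l\<in>exponents n d. c l * power_product (v q) l) = \<psi> q / s q ^ d"
      using 1[of "\<lambda>q. \<psi> q / s q ^ d"] by blast
    then have "\<forall>q\<in>T. (\<Sum>l\<in>exponents n d. c l * power_product (b q) l) = \<psi> q"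
      using power_product_b s0 by simp
    then show "\<exists>c. \<forall>q\<in>T. (\<Sum>l\<in>exponents n d. c l * power_product (b q) l) = \<psi> q" by blast
  next
    fix c assume card: "card T = card (exponents n d)"
      and zero: "\<forall>q\<in>T. (\<Sum>l\<in>exponents n d. c l * power_product (b q) l) = 0"
    have "(\<Sum>l\<in>exponents n d. c l * power_product (v q) l) = 0" if "q \<in> T" for q
      using power_product_b[OF that, of c] s0[OF that] zero that by (metis mult_eq_0_iff)
    then show "\<forall>l\<in>exponents n d. c l = 0" using 2[OF card] by blast
  qed
qed

text \<open>By \<open>\<alpha>_0\<close> the normalization expresses \<open>a p 0\<close> through
  \<open>a p 1\<close>, which thus is an affine coordinate on the first factor. The assumption
  \<open>disjoint\<close> is the condition on intersections of level sets: an index shared by two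
  levels is shared by all.\<close>

locale generic_configuration = configuration n E a b \<alpha> \<beta>
  for n E and a b :: "nat \<Rightarrow> nat \<Rightarrow> 'k::field" and \<alpha> \<beta> +
  fixes t N :: nat
  assumes n_pos: "1 \<le> n" and fst_E: "fst ` E = {..<t}" and snd_E: "snd ` E = {..<N}"
    and \<alpha>_0: "\<alpha> 0 = 1" and inj_a: "inj_on (\<lambda>p. a p 1) {..<t}"
    and general: "general_position n N b"
    and disjoint: "\<lbrakk>(p, q) \<in> E; (p', q) \<in> E; p \<noteq> p'; r < t\<rbrakk> \<Longrightarrow> (r, q) \<in> E"
begin

definition \<tau> :: "nat \<Rightarrow> 'k" where "\<tau> p = a p 1"

definition form :: "nat \<Rightarrow> (nat list \<Rightarrow> 'k) \<Rightarrow> nat \<Rightarrow> 'k" where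
  "form j c q = (\<Sum>e\<in>exponents n j. c e * power_product (b q) e)"

text \<open>Polynomials of degree at most \<open>i\<close> in the affine coordinate with forms of
  degree \<open>j\<close> as coefficients. By \<open>tensor_in_V\<close> and \<open>V_tensor\<close>
  they are exactly the members of \<open>V i j\<close>, so membership becomes a matter of
  polynomials in one variable.\<close>

definition tensor :: "nat \<Rightarrow> nat \<Rightarrow> (nat \<Rightarrow> nat list \<Rightarrow> 'k) \<Rightarrow> nat \<times> nat \<Rightarrow> 'k" where
  "tensor i j g = (\<lambda>x. if x \<in> E then \<Sum>l\<le>i. \<tau> (fst x) ^ l * form j (g l) (snd x) else 0)"

definition B where "B = {q. q < N \<and> (\<forall>p<t. (p, q) \<in> E)}"

lemma E_less: "(p, q) \<in> E \<Longrightarrow> p < t \<and> q < N"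
  using fst_E snd_E by force

lemma V_mono: "i \<le> k \<Longrightarrow> j \<le> l \<Longrightarrow> V i j \<subseteq> V k l"
proof -
  assume "i \<le> k" "j \<le> l"
  have "V i j \<subseteq> V k j" using \<open>i \<le> k\<close> by (induction rule: dec_induct) (use V_Suc in blast)+
  also have "\<dots> \<subseteq> V k l" using \<open>j \<le> l\<close> by (induction rule: dec_induct) (use V_Suc in blast)+
  finally show ?thesis .
qed

lemma power_in_V:
  assumes "(\<lambda>x. if x \<in> E then f x else 0) \<in> V i j"
  shows "(\<lambda>x. if x \<in> E then f x ^ r else 0) \<in> V (r * i) (r * j)"
proof (induction r)
  case 0
  then show ?case using V_const[of 1] by (simp cong: if_cong)
next
  case (Suc r)
  have "(\<lambda>x. (if x \<in> E then f x else 0) * (if x \<in> E then f x ^ r else 0)) \<in> V (i + r * i) (j + r * j)"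
    by (rule V_mult[OF assms Suc.IH])
  moreover have "(\<lambda>x. (if x \<in> E then f x else 0) * (if x \<in> E then f x ^ r else 0)) =
      (\<lambda>x. if x \<in> E then f x ^ Suc r else 0)" by auto
  ultimately show ?case by simp
qed

lemma tau_power_in_V: "(\<lambda>x. if x \<in> E then \<tau> (fst x) ^ l else 0) \<in> V l 0"
  using power_in_V[OF V_x[of 1], of l] by (simp add: \<tau>_def cong: if_cong)

lemma power_product_in_V:
  assumes "e \<in> exponents n j"
  shows "(\<lambda>x. if x \<in> E then power_product (b (snd x)) e else 0) \<in> V 0 j"
proof -
  have len: "length e = Suc n" "j = (\<Sum>i<length e. e ! i)"
    using assms by (auto simp: exponents_def sum_list_sum_nth atLeast0LessThan)
  have "k \<le> Suc n \<Longrightarrow> (\<lambda>x. if x \<in> E then \<Prod>i<k. b (snd x) i ^ (e ! i) else 0) \<in> V 0 (\<Sum>i<k. e ! i)" for k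
  proof (induction k)
    case 0
    then show ?case using V_const[of 1] by (simp cong: if_cong)
  next
    case (Suc k)
    have "(\<lambda>x. if x \<in> E then b (snd x) k ^ (e ! k) else 0) \<in> V 0 (e ! k)"
      using power_in_V[OF V_y[of k], of "e ! k"] Suc.prems by simp
    from V_mult[OF Suc.IH this] Suc.prems
    have "(\<lambda>x. (if x \<in> E then \<Prod>i<k. b (snd x) i ^ (e ! i) else 0) * (if x \<in> E then b (snd x) k ^ (e ! k) else 0))
        \<in> V 0 (\<Sum>i<Suc k. e ! i)" by simp
    moreover have "(\<lambda>x. (if x \<in> E then \<Prod>i<k. b (snd x) i ^ (e ! i) else 0) * (if x \<in> E then b (snd x) k ^ (e ! k) else 0)) =
      (\<lambda>x. if x \<in> E then \<Prod>i<Suc k. b (snd x) i ^ (e ! i) else 0)" by auto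
    ultimately show ?case by (simp only:)
  qed
  from this[of "Suc n"] show ?thesis unfolding power_product_def len by simp
qed

lemma form_in_V: "(\<lambda>x. if x \<in> E then form j c (snd x) else 0) \<in> V 0 j"
proof -
  have "(\<lambda>x. \<Sum>e\<in>exponents n j. c e * (if x \<in> E then power_product (b (snd x)) e else 0)) \<in> V 0 j"
    by (intro V_sum V_scale power_product_in_V)
  moreover have "(\<lambda>x. \<Sum>e\<in>exponents n j. c e * (if x \<in> E then power_product (b (snd x)) e else 0)) =
      (\<lambda>x. if x \<in> E then form j c (snd x) else 0)"
    by (auto simp: form_def)
  ultimately show ?thesis by simp
qed

lemma tensor_in_V: "tensor i j g \<in> V i j"
proof -
  have "(\<lambda>x. \<Sum>l\<le>i. (if x \<in> E then \<tau> (fst x) ^ l else 0) * (if x \<in> E then form j (g l) (snd x) else 0)) \<in> V i j"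
  proof (rule V_sum)
    fix l assume "l \<in> {..i}"
    then show "(\<lambda>x. (if x \<in> E then \<tau> (fst x) ^ l else 0) * (if x \<in> E then form j (g l) (snd x) else 0)) \<in> V i j"
      using V_mult[OF tau_power_in_V[of l] form_in_V[of j "g l"]] V_mono[of l i j j] by auto
  qed
  moreover have "(\<lambda>x. \<Sum>l\<le>i. (if x \<in> E then \<tau> (fst x) ^ l else 0) * (if x \<in> E then form j (g l) (snd x) else 0)) = tensor i j g"
    by (auto simp: tensor_def)
  ultimately show ?thesis by simp
qed

lemma V_tensor:
  assumes "\<phi> \<in> V i j"
  obtains g where "\<phi> = tensor i j g"
proof -
  obtain f where f: "supported_on (has_bidegree n i j) f" "\<And>x. x \<in> E \<Longrightarrow> \<phi> x = eval_poly (pt x) f"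
    "\<And>x. x \<notin> E \<Longrightarrow> \<phi> x = 0"
    using V_E[OF assms] by blast
  define ex where "ex m = map (\<lambda>k. Poly_Mapping.lookup m (Inr k)) [0..<Suc n]" for m :: "nat + nat \<Rightarrow>\<^sub>0 nat"
  \<comment> \<open>The part of a monomial in the variables of the first factor, as a polynomial in
    the affine coordinate after eliminating \<open>a p 0\<close>.\<close>
  define R where "R m = [:1, - \<alpha> 1:] ^ Poly_Mapping.lookup m (Inl 0) * [:0, 1:] ^ Poly_Mapping.lookup m (Inl 1)"
    for m :: "nat + nat \<Rightarrow>\<^sub>0 nat"
  define g where "g l e = (\<Sum>m\<in>{m \<in> Poly_Mapping.keys f. ex m = e}. Poly_Mapping.lookup f m * coeff (R m) l)" for l e
  have ex: "ex m \<in> exponents n j" if "has_bidegree n i j m" for m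
  proof -
    have "sum_list (ex m) = (\<Sum>k\<le>n. Poly_Mapping.lookup m (Inr k))"
      unfolding ex_def by (simp only: interv_sum_list_conv_sum_set_nat set_upt atLeast0LessThan lessThan_Suc_atMost)
    then show ?thesis using that by (simp add: exponents_def ex_def has_bidegree_def degree_y_def)
  qed
  have "\<phi> x = tensor i j g x" if x: "x \<in> E" for x
  proof -
    obtain p q where pq: "x = (p, q)" by (cases x)
    have a0: "a p 0 = 1 - \<alpha> 1 * \<tau> p"
      using normalized_x[of p q] x pq \<alpha>_0 by (simp add: \<tau>_def algebra_simps)
    have monomial: "monom_value (pt x) m = (\<Sum>l\<le>i. coeff (R m) l * \<tau> p ^ l) * power_product (b q) (ex m)"
      if m: "has_bidegree n i j m" for m
    proof -
      let ?l = "Poly_Mapping.lookup m"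
      have X: "finite (ring_variables n)" "Poly_Mapping.keys m \<subseteq> ring_variables n"
        using m by (auto simp: ring_variables_def has_bidegree_def)
      have split: "(\<Prod>v\<in>ring_variables n. h v) = (\<Prod>i\<le>1. h (Inl i)) * (\<Prod>j\<le>n. h (Inr j))" for h :: "nat + nat \<Rightarrow> 'k"
        unfolding ring_variables_def by (subst prod.union_disjoint) (auto simp: prod.reindex inj_on_def)
      have "monom_value (pt x) m = (a p 0 ^ ?l (Inl 0) * a p 1 ^ ?l (Inl 1)) * (\<Prod>k\<le>n. b q k ^ ?l (Inr k))"
        unfolding monom_value_superset[OF X] split pq by (simp add: pt_def)
      also have "a p 0 ^ ?l (Inl 0) * a p 1 ^ ?l (Inl 1) = poly (R m) (\<tau> p)"
        unfolding a0 R_def by (simp add: \<tau>_def algebra_simps)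
      also have "poly (R m) (\<tau> p) = (\<Sum>l\<le>i. coeff (R m) l * \<tau> p ^ l)"
      proof -
        have "degree (R m) \<le> degree ([:1, - \<alpha> 1:] ^ ?l (Inl 0)) + degree ([:0, 1 :: 'k:] ^ ?l (Inl 1))"
          unfolding R_def by (rule degree_mult_le)
        also have "\<dots> \<le> degree [:1, - \<alpha> 1:] * ?l (Inl 0) + degree [:0, 1 :: 'k:] * ?l (Inl 1)"
          by (intro add_mono degree_power_le)
        also have "\<dots> \<le> 1 * ?l (Inl 0) + 1 * ?l (Inl 1)"
          by (intro add_mono mult_right_mono) (auto simp: degree_pCons_eq_if)
        also have "\<dots> = i" using m by (simp add: has_bidegree_def degree_x_def)
        finally have "degree (R m) \<le> i" .
        then have "(\<Sum>l\<le>i. coeff (R m) l * \<tau> p ^ l) = (\<Sum>l\<le>degree (R m). coeff (R m) l * \<tau> p ^ l)"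
          by (intro sum.mono_neutral_right) (auto simp: coeff_eq_0)
        then show ?thesis by (simp add: poly_altdef)
      qed
      also have "(\<Prod>k\<le>n. b q k ^ ?l (Inr k)) = power_product (b q) (ex m)"
        unfolding power_product_def ex_def by (rule prod.cong) (auto simp del: upt_Suc)
      finally show ?thesis .
    qed
    have keys: "has_bidegree n i j m" if "m \<in> Poly_Mapping.keys f" for m
      using f(1) that by (simp add: supported_on_def)
    have form_g: "form j (g l) q = (\<Sum>m\<in>Poly_Mapping.keys f. Poly_Mapping.lookup f m * coeff (R m) l * power_product (b q) (ex m))" for l
    proof -
      have "form j (g l) q = (\<Sum>e\<in>exponents n j. \<Sum>m\<in>{m \<in> Poly_Mapping.keys f. ex m = e}.
          Poly_Mapping.lookup f m * coeff (R m) l * power_product (b q) (ex m))"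
        unfolding form_def g_def sum_distrib_right by (intro sum.cong) auto
      also have "\<dots> = (\<Sum>m\<in>Poly_Mapping.keys f. Poly_Mapping.lookup f m * coeff (R m) l * power_product (b q) (ex m))"
        by (rule sum.group) (use ex keys in auto)
      finally show ?thesis .
    qed
    have "\<phi> x = (\<Sum>m\<in>Poly_Mapping.keys f. Poly_Mapping.lookup f m * monom_value (pt x) m)"
      using f(2)[OF x] by (simp add: eval_poly_eq at_point.ins_def)
    also have "\<dots> = (\<Sum>m\<in>Poly_Mapping.keys f. \<Sum>l\<le>i. \<tau> p ^ l * (Poly_Mapping.lookup f m * coeff (R m) l * power_product (b q) (ex m)))"
      using monomial[OF keys] by (intro sum.cong) (simp_all add: sum_distrib_left sum_distrib_right mult_ac)
    also have "\<dots> = (\<Sum>l\<le>i. \<tau> p ^ l * form j (g l) q)"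
      unfolding form_g sum_distrib_left by (rule sum.swap)
    finally show ?thesis using x by (simp add: tensor_def pq)
  qed
  then have "\<phi> = tensor i j g" using f(3) by (auto simp: fun_eq_iff tensor_def)
  then show thesis by (rule that)
qed

lemma interpolation:
  assumes "d \<le> N" "T \<subseteq> {..<N}" "card T \<le> monomial_count n d"
  obtains c where "\<And>q. q \<in> T \<Longrightarrow> form d c q = \<psi> q"
  using general assms unfolding general_position_def card_exponents' form_def by meson

lemma vanishing:
  assumes "d \<le> N" "T \<subseteq> {..<N}" "card T = monomial_count n d" "\<And>q. q \<in> T \<Longrightarrow> form d c q = 0"
  shows "form d c q = 0"
proof -
  have "\<forall>e\<in>exponents n d. c e = 0"
    using general assms unfolding general_position_def card_exponents' form_def by auto
  then show ?thesis by (simp add: form_def)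
qed

lemma form_diff: "form d (\<lambda>e. c e - s * c' e) q = form d c q - s * form d c' q"
  by (simp add: form_def left_diff_distrib sum_subtractf sum_distrib_left mult.assoc)

text \<open>With at least as many monomials of degree \<open>d0\<close> as points, every coefficient
  form can be replaced on the points by one of degree \<open>d0\<close>.\<close>

lemma V_full:
  assumes "d0 \<le> N" "N \<le> monomial_count n d0" "d0 \<le> d"
  shows "V i j \<subseteq> V i d"
proof
  fix \<phi> assume "\<phi> \<in> V i j"
  then obtain g where g: "\<phi> = tensor i j g" by (rule V_tensor)
  have "\<exists>c. \<forall>q\<in>{..<N}. form d0 c q = form j (g l) q" for l
    using interpolation[OF assms(1) subset_refl, of "form j (g l)"] assms(2)
    by (metis card_lessThan)
  then obtain c where c: "\<And>l q. q < N \<Longrightarrow> form d0 (c l) q = form j (g l) q" by (metis lessThan_iff)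
  have "\<phi> = tensor i d0 c"
    unfolding g tensor_def using c E_less by (auto simp: fun_eq_iff)
  then show "\<phi> \<in> V i d" using tensor_in_V V_mono[of i i d0 d] assms(3) by auto
qed

lemma stable2: "N \<le> j \<Longrightarrow> V i (Suc j) \<subseteq> V i j"
  using V_full[of N j i "Suc j"] monomial_count_gt[OF n_pos, of N] by simp

lemma inj_\<tau>: "inj_on \<tau> {..<t}"
  using inj_a unfolding \<tau>_def[abs_def] .

text \<open>A monic polynomial of degree \<open>Suc i\<close> with roots at all \<open>t\<close>
  values of \<tau> expresses the top power of \<tau> on the points through lower ones. The extra
  factor in \<open>W\<close> fills up the degree.\<close>

lemma stable1:
  assumes "t \<le> Suc i"
  shows "V (Suc i) j \<subseteq> V i j"
proof
  fix \<phi> assume "\<phi> \<in> V (Suc i) j"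
  then obtain g where g: "\<phi> = tensor (Suc i) j g" by (rule V_tensor)
  define W where "W = (\<Prod>p<t. [:- \<tau> p, 1:]) * monom 1 (Suc i - t)"
  have deg_prod: "degree (\<Prod>p<t. [:- \<tau> p, 1:]) = t"
    by (subst degree_prod_eq_sum_degree) auto
  have monic: "lead_coeff (\<Prod>p<t. [:- \<tau> p, 1:]) = 1"
    by (simp add: lead_coeff_prod)
  have "degree W = Suc i"
    unfolding W_def using assms deg_prod monic
    by (subst degree_mult_eq) (auto simp: degree_monom_eq)
  moreover have "lead_coeff W = 1"
    unfolding W_def lead_coeff_mult using monic by (simp add: degree_monom_eq)
  ultimately have W: "poly W x = (\<Sum>l\<le>i. coeff W l * x ^ l) + x ^ Suc i" for x
    by (simp add: poly_altdef)
  have root: "poly W (\<tau> p) = 0" if "p < t" for p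
    using that unfolding W_def by (auto simp: poly_prod)
  define g' where "g' = (\<lambda>l e. g l e - coeff W l * g (Suc i) e)"
  have "\<phi> x = tensor i j g' x" for x
  proof (cases "x \<in> E")
    case True
    then have p: "fst x < t" using E_less by (cases x) auto
    have "\<tau> (fst x) ^ Suc i = - (\<Sum>l\<le>i. coeff W l * \<tau> (fst x) ^ l)"
      using root[OF p] W[of "\<tau> (fst x)"] by (simp add: eq_neg_iff_add_eq_0 add.commute)
    then have "\<phi> x = (\<Sum>l\<le>i. \<tau> (fst x) ^ l * form j (g l) (snd x)) -
        (\<Sum>l\<le>i. coeff W l * \<tau> (fst x) ^ l) * form j (g (Suc i)) (snd x)"
      using True by (simp add: g tensor_def del: power_Suc)
    also have "\<dots> = (\<Sum>l\<le>i. \<tau> (fst x) ^ l * (form j (g l) (snd x) - coeff W l * form j (g (Suc i)) (snd x)))"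
      by (simp add: right_diff_distrib sum_subtractf sum_distrib_left mult_ac)
    finally show ?thesis using True by (simp add: tensor_def g'_def form_diff)
  qed (simp add: g tensor_def)
  then show "\<phi> \<in> V i j" using tensor_in_V[of i j g'] by (metis ext)
qed

lemma B_sub: "B \<subseteq> {..<N}"
  by (auto simp: B_def)

lemma saturated:
  assumes cond: "\<And>d. monomial_count n d \<le> card B \<or> N \<le> monomial_count n d"
  shows "V (Suc i) d \<inter> V i (Suc d) \<subseteq> V i d"
proof (cases "N \<le> d \<or> t \<le> Suc i")
  case True
  then show ?thesis using stable1[of i d] stable2[of d i] by blast
next
  case False
  then have d: "d < N" and i: "Suc i < t" by auto
  show ?thesis
  proof (cases "N \<le> monomial_count n d")
    case True
    then show ?thesis using V_full[of d d i "Suc d"] d by auto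
  next
    case False
    then have "monomial_count n d \<le> card B" using cond by blast
    then obtain T where T: "T \<subseteq> B" "card T = monomial_count n d" by (metis obtain_subset_with_card_n)
    show ?thesis
    proof
      fix \<phi> assume \<phi>: "\<phi> \<in> V (Suc i) d \<inter> V i (Suc d)"
      obtain g where g: "\<phi> = tensor (Suc i) d g" using \<phi> V_tensor by blast
      obtain g' where g': "\<phi> = tensor i (Suc d) g'" using \<phi> V_tensor by blast
      have "form d (g (Suc i)) q = 0" if q: "q \<in> T" for q
      proof -
        \<comment> \<open>The difference of the two expansions at \<open>q\<close>. As
          \<open>q\<close> belongs to every level, it has \<open>t\<close> distinct roots, more than
          its degree allows, so its coefficient at \<open>Suc i\<close> is zero.\<close>
        define W where "W = (\<Sum>l\<le>Suc i. monom (form d (g l) q) l) - (\<Sum>l\<le>i. monom (form (Suc d) (g' l) q) l)"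
        have coeff_W: "coeff W (Suc i) = form d (g (Suc i)) q"
          by (simp add: W_def coeff_sum)
        have "degree W \<le> Suc i"
          unfolding W_def by (intro degree_diff_le degree_sum_le) (auto intro: order.trans[OF degree_monom_le])
        have root: "poly W (\<tau> p) = 0" if "p < t" for p
        proof -
          have "(p, q) \<in> E" using q T(1) that by (auto simp: B_def)
          then have "(\<Sum>l\<le>Suc i. \<tau> p ^ l * form d (g l) q) = (\<Sum>l\<le>i. \<tau> p ^ l * form (Suc d) (g' l) q)"
            using fun_cong[OF g, of "(p, q)"] fun_cong[OF g', of "(p, q)"] by (simp add: tensor_def)
          then show ?thesis
            by (simp add: W_def poly_sum poly_monom mult.commute del: sum.atMost_Suc)
        qed
        have "W = 0"
        proof (rule ccontr)
          assume W: "W \<noteq> 0"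
          have "t = card (\<tau> ` {..<t})" using card_image[OF inj_\<tau>] by simp
          also have "\<dots> \<le> card {x. poly W x = 0}"
            using root by (intro card_mono poly_roots_finite[OF W]) auto
          also have "\<dots> \<le> degree W" by (rule card_poly_roots_bound[OF W])
          finally show False using \<open>degree W \<le> Suc i\<close> i by simp
        qed
        then show ?thesis using coeff_W by simp
      qed
      then have "form d (g (Suc i)) q = 0" for q
        using vanishing[of d T "g (Suc i)"] T d B_sub by auto
      then have "\<phi> = tensor i d g" by (auto simp: g tensor_def fun_eq_iff)
      then show "\<phi> \<in> V i d" using tensor_in_V by simp
    qed
  qed
qed

lemma unique_p:
  assumes "(p, q) \<in> E" "(p', q) \<in> E" "q \<notin> B"
  shows "p = p'"
  using assms disjoint[of p q p'] E_less[of p q] by (auto simp: B_def)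

text \<open>
  Take a form \<open>c\<close> of degree \<open>d\<close> that vanishes on \<open>B\<close> and on all but one of as many further points as
  the number of monomials allows. The function \<open>\<tau> c\<close> on \<open>E\<close> is given by a form of degree \<open>N\<close>
  in the second factor, and saturation would make it one of degree \<open>d\<close>, which interpolation excludes.
\<close>

lemma not_saturated:
  assumes d: "card B < monomial_count n d" "monomial_count n d < N"
    and q: "(p\<^sub>0, q\<^sub>0) \<in> E" "(p\<^sub>1, q\<^sub>1) \<in> E" "p\<^sub>0 \<noteq> p\<^sub>1" "q\<^sub>0 \<notin> B" "q\<^sub>1 \<notin> B"
  shows "\<exists>i j. \<not> V (Suc i) j \<inter> V i (Suc j) \<subseteq> V i j"
proof (rule ccontr)
  assume "\<not> ?thesis"
  then have sat: "V (Suc i) j \<inter> V i (Suc j) \<subseteq> V i j" for i j by blast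
  have dN: "d \<le> N" using d(2) monomial_count_gt[OF n_pos, of d] by simp
  have q01: "q\<^sub>0 \<noteq> q\<^sub>1" using unique_p q by blast
  have lt: "q\<^sub>0 < N" "q\<^sub>1 < N" "p\<^sub>0 < t" "p\<^sub>1 < t" using q E_less by blast+
  define A where "A = {..<N} - B"
  have finB: "finite B" using B_sub finite_subset by blast
  have cardA: "card A = N - card B" unfolding A_def using B_sub finB by (simp add: card_Diff_subset)
  \<comment> \<open>The number of points outside \<open>B\<close> that bring the conditions up to
    the number of monomials. One place is kept free for \<open>q\<^sub>0\<close> or
    \<open>q\<^sub>1\<close>, so \<open>T0\<close> has one point fewer than there are
    monomials.\<close>
  define w where "w = monomial_count n d - card B"
  have w: "0 < w" "w < card A" using d cardA by (auto simp: w_def)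
  have "w - 1 \<le> card (A - {q\<^sub>0, q\<^sub>1})"
  proof -
    have "card (A - {q\<^sub>0, q\<^sub>1}) = card A - 2"
      using q01 q lt by (subst card_Diff_subset) (auto simp: A_def)
    then show ?thesis using w by simp
  qed
  then obtain A1 where A1: "A1 \<subseteq> A - {q\<^sub>0, q\<^sub>1}" "card A1 = w - 1" "finite A1"
    by (rule obtain_subset_with_card_n)
  define T0 where "T0 = B \<union> A1"
  have T0: "T0 \<subseteq> {..<N}" "finite T0" "q\<^sub>0 \<notin> T0" "q\<^sub>1 \<notin> T0"
    using A1 B_sub finB q by (auto simp: T0_def A_def)
  have "card T0 = card B + card A1"
    unfolding T0_def using A1 finB by (intro card_Un_disjoint) (auto simp: A_def)
  then have cardT: "card (insert q T0) = monomial_count n d" if "q \<notin> T0" for q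
    using A1(2) w d T0(2) that by (simp add: w_def)
  obtain c where c: "\<And>q. q \<in> insert q\<^sub>1 T0 \<Longrightarrow> form d c q = (if q = q\<^sub>1 then 1 else 0)"
    using interpolation[OF dN, of "insert q\<^sub>1 T0" "\<lambda>q. if q = q\<^sub>1 then 1 else 0"] T0 lt cardT by auto
  have c1: "form d c q\<^sub>1 = 1" using c by simp
  have c0: "form d c q = 0" if "q \<in> T0" for q using c[of q] that T0(4) by auto
  \<comment> \<open>Outside \<open>B\<close> a point lies in a single level, so \<tau> becomes a
    function of \<open>q\<close>. On \<open>B\<close> any choice will do, since the form given by
    \<open>c\<close> vanishes there.\<close>
  define pr where "pr q = (SOME p. (p, q) \<in> E)" for q
  have pr: "pr q = p" if "(p, q) \<in> E" "q \<notin> B" for p q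
    using someI[of "\<lambda>p. (p, q) \<in> E" p] that unique_p unfolding pr_def by blast
  define F where "F = (\<lambda>x. if x \<in> E then \<tau> (fst x) * form d c (snd x) else 0)"
  have "(\<lambda>x. (if x \<in> E then \<tau> (fst x) ^ 1 else 0) * (if x \<in> E then form d c (snd x) else 0)) = F"
    by (auto simp: F_def)
  then have F1: "F \<in> V 1 d"
    using V_mult[OF tau_power_in_V[of 1] form_in_V[of d c]] by (simp only: add_0_left add_0_right)
  obtain c' where c': "\<And>q. q \<in> {..<N} \<Longrightarrow> form N c' q = \<tau> (pr q) * form d c q"
    using interpolation[of N "{..<N}" "\<lambda>q. \<tau> (pr q) * form d c q"] monomial_count_gt[OF n_pos, of N] by auto
  have F_eq: "F x = form N c' (snd x)" if "x \<in> E" for x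
  proof -
    obtain p q where x: "x = (p, q)" by (cases x)
    then have "q < N" using E_less that by blast
    then have "form N c' q = \<tau> (pr q) * form d c q" using c' by simp
    also have "\<dots> = \<tau> p * form d c q"
      using pr[of p q] that x c0[of q] by (cases "q \<in> B") (auto simp: T0_def)
    finally show ?thesis using that by (simp add: F_def x)
  qed
  have "F = (\<lambda>x. if x \<in> E then form N c' (snd x) else 0)"
    using F_eq by (auto simp: F_def fun_eq_iff)
  then have FN: "F \<in> V 0 N" using form_in_V by simp
  \<comment> \<open>Saturation lowers the second degree from \<open>N\<close> to \<open>d\<close>
    step by step, because \<open>F\<close> lies in \<open>V 1 k\<close> for every \<open>k\<close>
    from \<open>d\<close> on.\<close>
  have "F \<in> V 0 d"
    using dN
  proof (induction rule: inc_induct)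
    case base
    show ?case by (rule FN)
  next
    case (step k)
    have "F \<in> V (Suc 0) k" using F1 V_mono[of 1 1 d k] step.hyps by auto
    then show ?case using step.IH sat[of 0 k] by blast
  qed
  then obtain g where "F = tensor 0 d g" by (rule V_tensor)
  then have g: "F x = form d (g 0) (snd x)" if "x \<in> E" for x using that by (simp add: tensor_def)
  \<comment> \<open>This form vanishes at as many points as there are monomials, hence everywhere.
    At \<open>q\<^sub>0\<close> the factor is \<open>\<tau> p\<^sub>0\<close> instead of
    \<open>\<tau> p\<^sub>1\<close>, so the form given by \<open>c\<close> vanishes there as well,
    and then at all points.\<close>
  have "form d (\<lambda>e. g 0 e - \<tau> p\<^sub>1 * c e) q = 0" if q': "q \<in> insert q\<^sub>1 T0" for q
  proof -
    have "q < N" using q' T0 lt by auto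
    then obtain p where p: "(p, q) \<in> E" using snd_E by (metis imageE lessThan_iff prod.collapse)
    have "form d (g 0) q = \<tau> p * form d c q" using g[OF p] p by (simp add: F_def)
    moreover have "\<tau> p * form d c q = \<tau> p\<^sub>1 * form d c q"
    proof (cases "q = q\<^sub>1")
      case True
      then show ?thesis using unique_p[of p q\<^sub>1 p\<^sub>1] p q by simp
    next
      case False
      then show ?thesis using c0 q' by auto
    qed
    ultimately show ?thesis by (simp add: form_diff)
  qed
  then have "form d (\<lambda>e. g 0 e - \<tau> p\<^sub>1 * c e) q\<^sub>0 = 0"
    using vanishing[OF dN, of "insert q\<^sub>1 T0"] T0 lt cardT by auto
  then have "form d (g 0) q\<^sub>0 = \<tau> p\<^sub>1 * form d c q\<^sub>0" by (simp add: form_diff)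
  moreover have "form d (g 0) q\<^sub>0 = \<tau> p\<^sub>0 * form d c q\<^sub>0" using g[OF q(1)] q(1) by (simp add: F_def)
  moreover have "\<tau> p\<^sub>0 \<noteq> \<tau> p\<^sub>1" using inj_\<tau> lt q(3) by (auto dest: inj_onD)
  ultimately have "form d c q\<^sub>0 = 0" by simp
  then have "form d c q = 0" if "q \<in> insert q\<^sub>0 T0" for q using c0 that by auto
  then have "form d c q\<^sub>1 = 0" using vanishing[OF dN, of "insert q\<^sub>0 T0" c q\<^sub>1] T0 lt cardT by auto
  then show False using c1 by simp
qed

theorem cohen_macaulay_iff_count:
  assumes P: "\<And>p. p < t \<Longrightarrow> P p \<in> proj_space 1 \<and> a p \<in> P p"
    and Q: "\<And>q. q < N \<Longrightarrow> Q q \<in> proj_space n \<and> b q \<in> Q q"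
    and q: "(p\<^sub>0, q\<^sub>0) \<in> E" "(p\<^sub>1, q\<^sub>1) \<in> E" "p\<^sub>0 \<noteq> p\<^sub>1" "q\<^sub>0 \<notin> B" "q\<^sub>1 \<notin> B"
  shows "arithmetically_cohen_macaulay n (point_configuration E P Q) \<longleftrightarrow>
    (\<forall>d. monomial_count n d \<le> card B \<or> N \<le> monomial_count n d)"
proof -
  have "arithmetically_cohen_macaulay n (point_configuration E P Q) \<longleftrightarrow>
    (\<forall>i j. V (Suc i) j \<inter> V i (Suc j) \<subseteq> V i j)"
  proof (rule arithmetically_cohen_macaulay_iff[where K = "max t N"])
    show "P p \<in> proj_space 1 \<and> a p \<in> P p" "Q q \<in> proj_space n \<and> b q \<in> Q q" if "(p, q) \<in> E" for p q
      using P Q E_less[OF that] by blast+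
    show "V (Suc i) j \<subseteq> V i j" if "max t N \<le> i" for i j using stable1 that by simp
    show "V i (Suc j) \<subseteq> V i j" if "max t N \<le> j" for i j using stable2 that by simp
  qed
  also have "\<dots> \<longleftrightarrow> (\<forall>d. monomial_count n d \<le> card B \<or> N \<le> monomial_count n d)"
    using saturated not_saturated[OF _ _ q] by (meson not_le)
  finally show ?thesis .
qed

end

text \<open>The form with coefficients 1, z, z^2, ... takes at each vector a value that is a nonzero
  polynomial in z, so all but finitely many z work. Its zeroth coefficient is one, as
  \<open>generic_configuration\<close> asks of \<open>\<alpha> 0\<close>.\<close>

lemma linear_form_nonvanishing:
  assumes "finite J" "\<And>j. j \<in> J \<Longrightarrow> v j \<in> coord_vectors n" "infinite (UNIV :: 'k::field set)"
  shows "\<exists>z :: 'k. \<forall>j\<in>J. (\<Sum>i\<le>n. z ^ i * v j i) \<noteq> 0"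
proof -
  define p where "p j = (\<Sum>i\<le>n. monom (v j i) i)" for j
  have "p j \<noteq> 0" if "j \<in> J" for j
  proof
    assume "p j = 0"
    then have "v j i = 0" if "i \<le> n" for i
    proof -
      have "coeff (p j) i = v j i" using that by (simp add: p_def coeff_sum)
      then show ?thesis using \<open>p j = 0\<close> by simp
    qed
    then show False using assms(2)[OF \<open>j \<in> J\<close>] unfolding coord_vectors_def by (auto simp: not_le) (meson not_le)
  qed
  then have "finite (\<Union>j\<in>J. {x. poly (p j) x = 0})"
    using assms(1) poly_roots_finite by blast
  then obtain z where "z \<notin> (\<Union>j\<in>J. {x. poly (p j) x = 0})"
    using ex_new_if_finite[OF assms(3)] by blast
  then show ?thesis by (intro exI[of _ z]) (auto simp: p_def poly_sum poly_monom mult.commute)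
qed

text \<open>With \<open>N0 X + i = d + n\<close> the interval runs from the number of monomials of
  degree \<open>d\<close> to that of degree \<open>d + 1\<close> minus \<open>N0 X\<close>. So
  membership places \<open>N1 X\<close> and \<open>N0 X + N1 X\<close> between two consecutive
  counts, and by monotonicity no count falls strictly between them.\<close>

lemma mem_D_set_iff:
  assumes n: "n \<ge> 1" and N0: "N0 X \<ge> 2"
  shows "int (N1 X) \<in> D_set n X \<longleftrightarrow>
    (\<forall>d. monomial_count n d \<le> N1 X \<or> N0 X + N1 X \<le> monomial_count n d)"
proof -
  let ?M = "monomial_count n"
  have binom: "int_binom (int (d + n)) n = int (?M d)" for d
    by (simp add: int_binom_def monomial_count_def flip: of_nat_add)
  show ?thesis
  proof
    assume "int (N1 X) \<in> D_set n X"
    then obtain i where i: "int_binom (int (N0 X) + i) n \<le> int (N1 X)"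
      "int (N1 X) \<le> int_binom (int (N0 X) + i + 1) n - int (N0 X)"
      unfolding D_set_def by auto
    \<comment> \<open>Binomials with upper index at most \<open>n\<close> are at most one, so this
      bound forces the index to come from a degree \<open>d\<close> that is a natural
      number.\<close>
    have ge2: "2 \<le> int_binom (int (N0 X) + i + 1) n" using i(2) N0 by linarith
    have "int n \<le> int (N0 X) + i"
    proof (rule ccontr)
      assume "\<not> ?thesis"
      then have "int (N0 X) + i + 1 < int n \<or> int (N0 X) + i + 1 = int n" by linarith
      then have "int_binom (int (N0 X) + i + 1) n \<le> 1" by (auto simp: int_binom_def)
      then show False using ge2 by simp
    qed
    then obtain d where d: "int (N0 X) + i = int (d + n)"
      by (metis add.commute of_nat_add zle_iff_zadd)
    have M: "?M d \<le> N1 X" "N0 X + N1 X \<le> ?M (Suc d)"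
      using i binom[of d] binom[of "Suc d"] unfolding d by (simp_all add: add.commute)
    show "\<forall>d. ?M d \<le> N1 X \<or> N0 X + N1 X \<le> ?M d"
    proof
      fix d' show "?M d' \<le> N1 X \<or> N0 X + N1 X \<le> ?M d'"
        using M monomial_count_mono[of d' d n] monomial_count_mono[of "Suc d" d' n]
        by (cases "d' \<le> d") auto
    qed
  next
    assume cond: "\<forall>d. ?M d \<le> N1 X \<or> N0 X + N1 X \<le> ?M d"
    \<comment> \<open>The count in degree zero is below \<open>N0 X + N1 X\<close>, hence at most
      \<open>N1 X\<close>; the greatest degree with this property is the required one.\<close>
    have "?M 0 = 1" by (simp add: monomial_count_def)
    then have "?M 0 \<le> N1 X" using cond[rule_format, of 0] N0 by auto
    moreover have "\<forall>d. ?M d \<le> N1 X \<longrightarrow> d \<le> N1 X"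
      using monomial_count_gt[OF n] by (meson less_imp_le order.trans)
    ultimately obtain d where d: "?M d \<le> N1 X" "\<forall>d'. ?M d' \<le> N1 X \<longrightarrow> d' \<le> d"
      using Nat.ex_has_greatest_nat[of "\<lambda>d. ?M d \<le> N1 X" 0 "N1 X"] by blast
    then have "\<not> ?M (Suc d) \<le> N1 X" by (meson Suc_n_not_le_n)
    then have "N0 X + N1 X \<le> ?M (Suc d)" using cond by blast
    then have "int (N1 X) \<in> {int_binom (int (N0 X) + (int (d + n) - int (N0 X))) n ..
        int_binom (int (N0 X) + (int (d + n) - int (N0 X)) + 1) n - int (N0 X)}"
      using d(1) binom[of d] binom[of "Suc d"] by (simp add: add.commute)
    then show "int (N1 X) \<in> D_set n X" unfolding D_set_def by blast
  qed
qed

section \<open>From index pairs to points of projective space\<close>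

theorem theorem4p9:
  fixes n t N :: nat
    and P :: "nat \<Rightarrow> 'k::field_char_0 proj_point"
    and E :: "(nat \<times> nat) set"
  assumes "n \<ge> 2"
    and "\<forall>i<t. P i \<in> proj_space 1"
    and "inj_on P {..<t}"
    and "fst ` E = {..<t}"
    and "snd ` E = {..<N}"
  shows "holds_generically n N (\<lambda>Q :: nat \<Rightarrow> 'k proj_point.
    \<forall>X. X = point_configuration E P Q \<longrightarrow>
        \<not> inclusion_property X \<longrightarrow>
        (\<forall>P\<^sub>1\<in>fst ` X. \<forall>P\<^sub>2\<in>fst ` X. P\<^sub>1 \<noteq> P\<^sub>2 \<longrightarrow>
           level_image X P\<^sub>1 \<inter> level_image X P\<^sub>2 \<subseteq> snd ` B_part X) \<longrightarrow>
        (arithmetically_cohen_macaulay n X \<longleftrightarrow> int (N1 X) \<in> D_set n X))"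
proof -
  \<comment> \<open>Characteristic zero supplies the infinite field behind the nonempty open set and
    the linear forms that vanish at none of the points.\<close>
  have inf: "infinite (UNIV :: 'k set)" by (rule infinite_UNIV_char_0)
  obtain U :: "(nat \<Rightarrow> 'k proj_point) set" where U: "zariski_open n N U" "U \<noteq> {}"
    "\<And>Q. Q \<in> U \<Longrightarrow> Q \<in> proj_power n N \<and> (\<exists>v. (\<forall>j<N. v j \<in> Q j) \<and> general_position n N v)"
    using zariski_open_general_position[OF inf, of n N] by blast
  have "arithmetically_cohen_macaulay n X \<longleftrightarrow> int (N1 X) \<in> D_set n X"
    if QU: "Q \<in> U" and injQ: "inj_on Q {..<N}" and X: "X = point_configuration E P Q"
      and not_incl: "\<not> inclusion_property X"
      and disj: "\<forall>P\<^sub>1\<in>fst ` X. \<forall>P\<^sub>2\<in>fst ` X. P\<^sub>1 \<noteq> P\<^sub>2 \<longrightarrow> level_image X P\<^sub>1 \<inter> level_image X P\<^sub>2 \<subseteq> snd ` B_part X"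
    for Q X
  proof -
    have less: "p < t" "q < N" if "(p, q) \<in> E" for p q using that assms(4,5) by force+
    have ex_p: "\<exists>p. (p, q) \<in> E" if "q < N" for q
    proof -
      have "q \<in> snd ` E" using that assms(5) by simp
      then show ?thesis by auto
    qed
    define B where "B = {q. q < N \<and> (\<forall>p<t. (p, q) \<in> E)}"
    have P_eq: "P p = P p' \<longleftrightarrow> p = p'" if "p < t" "p' < t" for p p'
      using assms(3) that by (auto simp: inj_on_def)
    have Q_eq: "Q q = Q q' \<longleftrightarrow> q = q'" if "q < N" "q' < N" for q q'
      using injQ that by (auto simp: inj_on_def)
    have fstX: "fst ` X = P ` {..<t}"
      unfolding X point_configuration_def assms(4)[symmetric] by force
    have level: "level_image X (P p) = Q ` {q. (p, q) \<in> E}" if p: "p < t" for p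
    proof -
      have "level_image X (P p) = {Q q | p' q. (p', q) \<in> E \<and> P p' = P p}"
        unfolding level_image_def level_set_def X point_configuration_def by force
      also have "\<dots> = Q ` {q. (p, q) \<in> E}" using P_eq[OF _ p] less by blast
      finally show ?thesis .
    qed
    have mem_level: "Q q \<in> level_image X (P p) \<longleftrightarrow> (p, q) \<in> E" if "p < t" "q < N" for p q
      using level[OF that(1)] Q_eq[OF that(2)] less by (auto simp: image_iff)
    have mem_all: "Q q \<in> (\<Inter>R\<in>fst ` X. level_image X R) \<longleftrightarrow> q \<in> B" if "q < N" for q
      using mem_level[OF _ that] that unfolding fstX B_def by auto
    obtain p\<^sub>0 p\<^sub>1 where p: "p\<^sub>0 < t" "p\<^sub>1 < t" "\<not> level_image X (P p\<^sub>0) \<subseteq> level_image X (P p\<^sub>1)"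
      "\<not> level_image X (P p\<^sub>1) \<subseteq> level_image X (P p\<^sub>0)"
      using not_incl unfolding inclusion_property_def fstX by blast
    obtain q\<^sub>0 where q0: "(p\<^sub>0, q\<^sub>0) \<in> E" "(p\<^sub>1, q\<^sub>0) \<notin> E"
      using p(3) unfolding level[OF p(1)] level[OF p(2)] by blast
    obtain q\<^sub>1 where q1: "(p\<^sub>1, q\<^sub>1) \<in> E" "(p\<^sub>0, q\<^sub>1) \<notin> E"
      using p(4) unfolding level[OF p(1)] level[OF p(2)] by blast
    \<comment> \<open>Each of two incomparable level sets has a point missing from the other.
      Neither point is common to all levels, so \<open>N0 X\<close> is at least two.\<close>
    have q: "(p\<^sub>0, q\<^sub>0) \<in> E" "(p\<^sub>1, q\<^sub>1) \<in> E" "p\<^sub>0 \<noteq> p\<^sub>1" "q\<^sub>0 \<notin> B" "q\<^sub>1 \<notin> B"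
      using q0 q1 p by (auto simp: B_def)
    have X_E: thesis if "z \<in> X" "\<And>p q. (p, q) \<in> E \<Longrightarrow> z = (P p, Q q) \<Longrightarrow> thesis" for z thesis
    proof -
      obtain e where e: "z = (\<lambda>(i, j). (P i, Q j)) e" "e \<in> E"
        using \<open>z \<in> X\<close> unfolding X point_configuration_def by (rule imageE)
      then show thesis using that(2)[of "fst e" "snd e"] by (simp add: case_prod_unfold)
    qed
    have B_part_E: thesis if "z \<in> B_part X" "\<And>p q. (p, q) \<in> E \<Longrightarrow> z = (P p, Q q) \<Longrightarrow> thesis" for z thesis
      by (rule X_E[OF _ that(2)]) (use that(1) in \<open>simp_all add: B_part_def\<close>)
    have sndB: "snd ` B_part X = Q ` B"
    proof
      show "snd ` B_part X \<subseteq> Q ` B"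
      proof (rule image_subsetI)
        fix z assume z: "z \<in> B_part X"
        then obtain p q where pq: "(p, q) \<in> E" "z = (P p, Q q)" by (rule B_part_E)
        then show "snd z \<in> Q ` B" using z mem_all[OF less(2)[OF pq(1)]] by (simp add: B_part_def)
      qed
      show "Q ` B \<subseteq> snd ` B_part X"
      proof (rule image_subsetI)
        fix q assume q: "q \<in> B"
        then have "q < N" by (simp add: B_def)
        then obtain p where "(p, q) \<in> E" using ex_p by blast
        then have "(P p, Q q) \<in> X" unfolding X point_configuration_def by force
        then have "(P p, Q q) \<in> B_part X" using mem_all[OF \<open>q < N\<close>] q by (simp add: B_part_def)
        then show "Q q \<in> snd ` B_part X" by (rule rev_image_eqI) simp
      qed
    qed
    have sndA: "snd ` A_part X = Q ` ({..<N} - B)"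
    proof
      show "snd ` A_part X \<subseteq> Q ` ({..<N} - B)"
      proof (rule image_subsetI)
        fix z assume z: "z \<in> A_part X"
        then have "z \<in> X" by (simp add: A_part_def)
        then obtain p q where pq: "(p, q) \<in> E" "z = (P p, Q q)" by (rule X_E)
        then have "q \<notin> B"
          using z \<open>z \<in> X\<close> mem_all[OF less(2)[OF pq(1)]] by (auto simp: A_part_def B_part_def)
        then show "snd z \<in> Q ` ({..<N} - B)" using pq less(2)[OF pq(1)] by simp
      qed
      show "Q ` ({..<N} - B) \<subseteq> snd ` A_part X"
      proof (rule image_subsetI)
        fix q assume q: "q \<in> {..<N} - B"
        then have "q < N" by simp
        then obtain p where "(p, q) \<in> E" using ex_p by blast
        then have "(P p, Q q) \<in> X" unfolding X point_configuration_def by force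
        then have "(P p, Q q) \<in> A_part X" using mem_all[OF \<open>q < N\<close>] q by (simp add: A_part_def B_part_def)
        then show "Q q \<in> snd ` A_part X" by (rule rev_image_eqI) simp
      qed
    qed
    have BN: "B \<subseteq> {..<N}" by (auto simp: B_def)
    have finB: "finite B" using BN finite_subset by blast
    have N1: "N1 X = card B"
      unfolding N1_def sndB by (rule card_image[OF inj_on_subset[OF injQ BN]])
    have N0: "N0 X = card ({..<N} - B)"
      unfolding N0_def sndA by (rule card_image[OF inj_on_subset[OF injQ Diff_subset]])
    have "{q\<^sub>0, q\<^sub>1} \<subseteq> {..<N} - B" "q\<^sub>0 \<noteq> q\<^sub>1" using q q0 q1 less by auto
    then have N0_ge: "2 \<le> N0 X" unfolding N0 using card_mono[of "{..<N} - B" "{q\<^sub>0, q\<^sub>1}"] by simp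
    have sum: "N0 X + N1 X = N"
      unfolding N0 N1 using card_Diff_subset[OF finB BN] card_mono[OF _ BN] by simp
    obtain v where v: "\<And>j. j < N \<Longrightarrow> v j \<in> Q j" and gen: "general_position n N v"
      using U(3)[OF QU] by blast
    have Qproj: "Q j \<in> proj_space n" if "j < N" for j
      using U(3)[OF QU] that by (auto simp: proj_power_def)
    have vc: "v j \<in> coord_vectors n" if "j \<in> {..<N}" for j
      using proj_space_elem(1)[OF Qproj v] that by simp
    have "\<exists>u. u \<in> P p" if p: "p < t" for p
    proof -
      have "P p \<in> proj_space 1" using assms(2) p by blast
      then obtain w where "P p = proportional `` {w}" unfolding proj_space_def by (rule quotientE)
      then have "w \<in> P p" by (auto simp: proportional_def intro!: exI[of _ 1])
      then show ?thesis by blast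
    qed
    then obtain u where u: "\<And>p. p < t \<Longrightarrow> u p \<in> P p" by metis
    have uc: "u p \<in> coord_vectors 1" if "p \<in> {..<t}" for p
      using proj_space_elem(1)[OF _ u] assms(2) that by simp
    have "\<exists>x :: 'k. \<forall>p\<in>{..<t}. (\<Sum>i\<le>1. x ^ i * u p i) \<noteq> 0"
      by (rule linear_form_nonvanishing[OF finite_lessThan uc inf])
    then obtain x :: 'k where x: "\<forall>p\<in>{..<t}. (\<Sum>i\<le>1. x ^ i * u p i) \<noteq> 0" ..
    have "\<exists>y :: 'k. \<forall>q\<in>{..<N}. (\<Sum>i\<le>n. y ^ i * v q i) \<noteq> 0"
      by (rule linear_form_nonvanishing[OF finite_lessThan vc inf])
    then obtain y :: 'k where y: "\<forall>q\<in>{..<N}. (\<Sum>i\<le>n. y ^ i * v q i) \<noteq> 0" ..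
    define a where "a p i = u p i / (\<Sum>i\<le>1. x ^ i * u p i)" for p i
    define b where "b q i = v q i / (\<Sum>i\<le>n. y ^ i * v q i)" for q i
    have aP: "P p \<in> proj_space 1 \<and> a p \<in> P p" if "p < t" for p
    proof -
      have "a p \<in> P p"
        using proj_space_elem(2)[of "P p" 1 "u p" "a p"] assms(2) u[OF that] x that
        by (auto simp: a_def[abs_def] intro!: exI[of _ "1 / (\<Sum>i\<le>1. x ^ i * u p i)"])
      then show ?thesis using assms(2) that by blast
    qed
    have bQ: "Q q \<in> proj_space n \<and> b q \<in> Q q" if "q < N" for q
    proof -
      have "b q \<in> Q q"
        using proj_space_elem(2)[of "Q q" n "v q" "b q"] Qproj[OF that] v[OF that] y that
        by (auto simp: b_def[abs_def] intro!: exI[of _ "1 / (\<Sum>i\<le>n. y ^ i * v q i)"])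
      then show ?thesis using Qproj that by blast
    qed
    have norm_a: "(\<Sum>i\<le>1. x ^ i * a p i) = 1" if "p < t" for p
      using x that unfolding a_def times_divide_eq_right sum_divide_distrib[symmetric] by simp
    have norm_b: "(\<Sum>i\<le>n. y ^ i * b q i) = 1" if "q < N" for q
      using y that unfolding b_def times_divide_eq_right sum_divide_distrib[symmetric] by simp
    interpret G: generic_configuration n E a b "\<lambda>i. x ^ i" "\<lambda>i. y ^ i" t N
    proof unfold_locales
      show "finite E" by (rule finite_subset[of _ "{..<t} \<times> {..<N}"]) (use less in auto)
      show "E \<noteq> {}" using q by blast
      show "(\<Sum>i\<le>1. x ^ i * a p i) = 1" "(\<Sum>i\<le>n. y ^ i * b q i) = 1" if "(p, q) \<in> E" for p q
        using norm_a norm_b less[OF that] by blast+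
      show "1 \<le> n" using assms(1) by simp
      \<comment> \<open>The normalization recovers \<open>a p 0\<close> from \<open>a p 1\<close>,
        so equal affine coordinates mean equal points of the projective line.\<close>
      show "inj_on (\<lambda>p. a p 1) {..<t}"
      proof (rule inj_onI)
        fix p p' assume pp: "p \<in> {..<t}" "p' \<in> {..<t}" "a p 1 = a p' 1"
        have "a p i = a p' i" for i
        proof -
          have off: "a p i = 0" if "p < t" "i > 1" for p
            using proj_space_elem(1) aP[OF that(1)] that(2) by (fastforce simp: coord_vectors_def)
          have "a p 0 + x * a p' 1 = a p' 0 + x * a p' 1" using norm_a[of p] norm_a[of p'] pp by simp
          then have "a p 0 = a p' 0" by (simp only: add_right_cancel)
          then show ?thesis using pp off[of p] off[of p'] by (cases "i > 1") (auto simp: not_less le_Suc_eq)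
        qed
        then have "a p = a p'" by blast
        have mem: "w \<in> P r \<longleftrightarrow> (\<exists>c. c \<noteq> 0 \<and> w = (\<lambda>i. c * a r i))" if "r < t" for w r
          using aP[OF that] by (intro proj_space_elem(2)) blast+
        have "P p = P p'"
          using pp(1,2) unfolding set_eq_iff lessThan_iff by (simp only: mem \<open>a p = a p'\<close>) simp
        then show "p = p'" using P_eq pp by simp
      qed
      show "general_position n N b"
        by (rule general_position_scale[OF gen, of "\<lambda>q. 1 / (\<Sum>i\<le>n. y ^ i * v q i)"]) (use y in \<open>auto simp: b_def\<close>)
      show "(r, q) \<in> E" if "(p, q) \<in> E" "(p', q) \<in> E" "p \<noteq> p'" "r < t" for p q p' r
      proof -
        have "P p \<in> fst ` X" "P p' \<in> fst ` X" "P p \<noteq> P p'" using less that P_eq unfolding fstX by auto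
        moreover have "Q q \<in> level_image X (P p) \<inter> level_image X (P p')"
          using mem_level less that by auto
        ultimately have "Q q \<in> snd ` B_part X" using disj by blast
        then have "q \<in> B" unfolding sndB using Q_eq less(2)[OF that(1)] BN by auto
        then show ?thesis using that(4) by (simp add: B_def)
      qed
    qed (use assms(4,5) in auto)
    have "B = G.B" by (simp only: B_def G.B_def)
    then have "arithmetically_cohen_macaulay n X \<longleftrightarrow> (\<forall>d. monomial_count n d \<le> card B \<or> N \<le> monomial_count n d)"
      using G.cohen_macaulay_iff_count[of P Q p\<^sub>0 q\<^sub>0 p\<^sub>1 q\<^sub>1] aP bQ q unfolding X by blast
    also have "\<dots> \<longleftrightarrow> int (N1 X) \<in> D_set n X"
      using mem_D_set_iff[OF _ N0_ge, of n, unfolded sum] assms(1) by (simp add: N1)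
    finally show ?thesis .
  qed
  then show ?thesis unfolding holds_generically_def using U(1,2) by blast
qed

end
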